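(* Let $\mathbf{C}$ be an adhesive category (i.e. $\mathcal{M}$ is the class of all monomorphisms) satisfying the standing assumptions of the SqPO setting described in the context. Let $R_j=(r_j,\mathsf{c}_{I_j})$, $j=1,2,3$, be linear rules with application conditions. Define $$M_A:=\{(\mu_{21},\mu_{3(21)})\mid \mu_{21}\in M^{sq}_{R_2}(R_1),\ \mu_{3(21)}\in M^{sq}_{R_3}(R_{21})\},\quad R_{21}:=R_2\,{}^{\mu_{21}}\!\!\circ_{sq} R_1,$$ $$M_B:=\{(\mu_{32},\mu_{(32)1})\mid \mu_{32}\in M^{sq}_{R_3}(R_2),\ \mu_{(32)1}\in M^{sq}_{R_{32}}(R_1)\},\quad R_{32}:=R_3\,{}^{\mu_{32}}\!\!\circ_{sq} R_2.$$ Then there is a bijection between $M_A$ and $M_B$ such that whenever $(\mu_{21},\mu_{3(21)})$ corresponds to $(\mu_{32},\mu_{(32)1})$, the underlying linear rules satisfy $r_3\,{}^{\mu_{3(21)}}\!\!\circ_{sq}(r_2\,{}^{\mu_{21}}\!\!\circ_{sq} r_1)\cong(r_3\,{}^{\mu_{32}}\!\!\circ_{sq} r_2)\,{}^{\mu_{(32)1}}\!\!\circ_{sq} r_1$, and the corresponding application conditions $\mathsf{c}_{I_{3(21)}}$ and $\mathsf{c}_{I_{(32)1}}$ (identified along this isomorphism) are equivalent, $\mathsf{c}_{I_{3(21)}}\equiv\mathsf{c}_{I_{(32)1}}$.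
   Context: Base setting. $\mathcal{M}$ is a class of monomorphisms of $\mathbf{C}$ with $(\mathbf{C},\mathcal{M})$ $\mathcal{M}$-adhesive: $\mathcal{M}$ contains isos, is closed under composition and decomposition ($g\circ f,g\in\mathcal{M}\Rightarrow f\in\mathcal{M}$); pushouts and pullbacks along $\mathcal{M}$-morphisms exist; $\mathcal{M}$ is stable under pushout and pullback; pushouts along $\mathcal{M}$-morphisms are $\mathcal{M}$-van Kampen squares. Further: epi-$\mathcal{M}$-factorizations exist; $\mathbf{C}$ is balanced; $\mathbf{C}$ has a strict $\mathcal{M}$-initial object $\varnothing$; $\mathbf{C}$ has $\mathcal{M}$-effective unions (if $B\xleftarrow{b'}A\xrightarrow{c'}C$ are $\mathcal{M}$-morphisms with pushout $D$, and $\mathcal{M}$-morphisms $b:B\to E$, $c:C\to E$ with $b b'=c c'$ form a pullback, then the induced $D\to E$ is in $\mathcal{M}$). SqPO extras: a pair $(b:A\to D,d:D\to C)$ is a final pullback complement (FPC) of composable $A\xrightarrow{a}B\xrightarrow{c}C$ if $c\circ a=d\circ b$ is a pullback and for every pullback square $P\xrightarrow{x}B$, $P\xrightarrow{y}Q$, $c\circ x=z\circ y$ with $z:Q\to C$, and every $w:P\to A$ with $a\circ w=x$, there is a unique $w^*:Q\to D$ with $d\circ w^*=z$ and $w^*\circ y=w$. Assume FPCs of all composable pairs of $\mathcal{M}$-morphisms exist and consist of $\mathcal{M}$-morphisms. Conditions, satisfaction ($\models$ by $\mathcal{M}$-morphisms), equivalence $\equiv$, $\mathsf{false},\bigvee$: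 as usual — conditions over $P$: $\mathsf{true}$, $\exists(a,\mathsf{c}_Q)$ ($a:P\to Q$ in $\mathcal{M}$), $\neg$, $\bigwedge$; $p\models\exists(a,\mathsf{c}_Q)$ iff there is $q\in\mathcal{M}$ with $q\circ a=p$, $q\models\mathsf{c}_Q$; $\mathsf{c}\equiv\mathsf{c}'$ iff satisfied by the same $\mathcal{M}$-morphisms. $\mathsf{Shift}(p,\cdot)$ along an $\mathcal{M}$-morphism $p:P\to Q$: commutes with $\mathsf{true},\neg,\bigwedge$, and $\mathsf{Shift}(p,\exists(a:P\to A,\mathsf{c}_A))=\bigvee_{(r,s)}\exists(r,\mathsf{Shift}(s,\mathsf{c}_A))$ over iso classes of pushouts $(r:Q\to E,s:A\to E)$ of spans $Q\xleftarrow{p''}X\xrightarrow{a''}A$ of $\mathcal{M}$-morphisms admitting an $\mathcal{M}$-morphism $x:P\to X$ with $p''x=p$, $a''x=a$. Linear rules $r=(O\xleftarrow{o}K\xrightarrow{i}I)$ are spans of $\mathcal{M}$-morphisms; rules with conditions $R=(r,\mathsf{c}_I)$. $\mathsf{Trans}(r,\mathsf{c}_O)$: $\mathsf{true}\mapsto\mathsf{true}$, commutes with $\neg,\bigwedge$; $\exists(a:O\to O',\mathsf{c}')\mapsto\exists(a^*,\mathsf{Trans}(r',\mathsf{c}'))$ if the pushout complement $K\to K'\xrightarrow{o'}O'$ of $K\xrightarrow{o}O\xrightarrow{a}O'$ exists, where $I\xrightarrow{a^*}I'\xleftarrow{i'}K'$ is the pushout of $I\xleftarrow{i}K\to K'$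 and $r'=(O'\xleftarrow{o'}K'\xrightarrow{i'}I')$, and $\mapsto\mathsf{false}$ otherwise. SqPO composition. For $R_j=(r_j,\mathsf{c}_{I_j})$, $r_j=(O_j\xleftarrow{o_j}K_j\xrightarrow{i_j}I_j)$, and a span $\mu_{21}=(I_2\xleftarrow{m_2}M_{21}\xrightarrow{m_1}O_1)$ of $\mathcal{M}$-morphisms, let $I_2\xrightarrow{m_2'}N_{21}\xleftarrow{m_1'}O_1$ be its pushout; let $K_2\to K_2'\to N_{21}$ be the FPC of $K_2\xrightarrow{i_2}I_2\xrightarrow{m_2'}N_{21}$; require a pushout complement $K_1\to K_1'\to N_{21}$ of $K_1\xrightarrow{o_1}O_1\xrightarrow{m_1'}N_{21}$; let $O_{21}$ be the pushout of $O_2\xleftarrow{o_2}K_2\to K_2'$, $I_{21}$ the pushout of $K_1'\leftarrow K_1\xrightarrow{i_1}I_1$ (with $p_1:I_1\to I_{21}$), $K_{21}$ the pullback of $K_2'\to N_{21}\leftarrow K_1'$, $r_2\,{}^{\mu_{21}}\!\!\circ_{sq} r_1:=(O_{21}\leftarrow K_{21}\to I_{21})$, and $\mathsf{c}_{I_{21}}:=\mathsf{Shift}(p_1,\mathsf{c}_{I_1})\wedge\mathsf{Trans}((N_{21}\leftarrow K_1'\to I_{21}),\mathsf{Shift}(m_2',\mathsf{c}_{I_2}))$. If constructible and $\mathsf{c}_{I_{21}}\not\equiv\mathsf{false}$, $\mu_{21}\in M^{sq}_{R_2}(R_1)$ and $R_2\,{}^{\mu_{21}}\!\!\circ_{sq}R_1:=(r_2\,{}^{\mu_{21}}\!\!\circ_{sq}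 r_1,\mathsf{c}_{I_{21}})$. *)

theory Defs
  imports Main
begin

section \<open>Categories with a distinguished class of morphisms\<close>

text \<open>\<open>g \<cdot> f\<close> is the composite ``first \<open>f\<close>, then \<open>g\<close>''. Operations are only meaningful on the
  carriers \<open>Obj\<close> and \<open>Arr\<close>. The field \<open>MM\<close> is the class of morphisms called
  \<open>\<M>\<close> in the literature on \<open>\<M>\<close>-adhesive categories.\<close>

record ('o, 'm) mcat =
  Obj :: "'o set"
  Arr :: "'m set"
  Dom :: "'m \<Rightarrow> 'o"
  Cod :: "'m \<Rightarrow> 'o"
  Idn :: "'o \<Rightarrow> 'm"
  Comp :: "'m \<Rightarrow> 'm \<Rightarrow> 'm"  (infixl "\<cdot>\<index>" 70)
  MM :: "'m set"

definition arrows :: "('o, 'm) mcat \<Rightarrow> 'o \<Rightarrow> 'o \<Rightarrow> 'm set" where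
  "arrows C A B = {f \<in> Arr C. Dom C f = A \<and> Cod C f = B}"

definition monic :: "('o, 'm) mcat \<Rightarrow> 'm \<Rightarrow> bool" where
  "monic C f \<longleftrightarrow> f \<in> Arr C \<and>
    (\<forall>g\<in>Arr C. \<forall>h\<in>Arr C. Cod C g = Dom C f \<and> Cod C h = Dom C f \<and> Dom C g = Dom C h \<and>
       f \<cdot>\<^bsub>C\<^esub> g = f \<cdot>\<^bsub>C\<^esub> h \<longrightarrow> g = h)"

definition epic :: "('o, 'm) mcat \<Rightarrow> 'm \<Rightarrow> bool" where
  "epic C f \<longleftrightarrow> f \<in> Arr C \<and>
    (\<forall>g\<in>Arr C. \<forall>h\<in>Arr C. Dom C g = Cod C f \<and> Dom C h = Cod C f \<and> Cod C g = Cod C h \<and>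
       g \<cdot>\<^bsub>C\<^esub> f = h \<cdot>\<^bsub>C\<^esub> f \<longrightarrow> g = h)"

definition iso_arrow :: "('o, 'm) mcat \<Rightarrow> 'm \<Rightarrow> bool" where
  "iso_arrow C f \<longleftrightarrow> f \<in> Arr C \<and>
    (\<exists>g \<in> arrows C (Cod C f) (Dom C f).
       g \<cdot>\<^bsub>C\<^esub> f = Idn C (Dom C f) \<and> f \<cdot>\<^bsub>C\<^esub> g = Idn C (Cod C f))"

text \<open>All predicates on squares take the arrows in the order \<open>f : A \<rightarrow> B\<close>, \<open>g : A \<rightarrow> D\<close>,
  \<open>h : B \<rightarrow> E\<close>, \<open>k : D \<rightarrow> E\<close>.\<close>

definition comm_square :: "('o, 'm) mcat \<Rightarrow> 'm \<Rightarrow> 'm \<Rightarrow> 'm \<Rightarrow> 'm \<Rightarrow> bool" where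
  "comm_square C f g h k \<longleftrightarrow>
     f \<in> Arr C \<and> g \<in> Arr C \<and> h \<in> Arr C \<and> k \<in> Arr C \<and>
     Dom C f = Dom C g \<and> Cod C f = Dom C h \<and> Cod C g = Dom C k \<and> Cod C h = Cod C k \<and>
     h \<cdot>\<^bsub>C\<^esub> f = k \<cdot>\<^bsub>C\<^esub> g"

definition pushout :: "('o, 'm) mcat \<Rightarrow> 'm \<Rightarrow> 'm \<Rightarrow> 'm \<Rightarrow> 'm \<Rightarrow> bool" where
  "pushout C f g h k \<longleftrightarrow> comm_square C f g h k \<and>
     (\<forall>h' k'. comm_square C f g h' k' \<longrightarrow>
        (\<exists>!u. u \<in> arrows C (Cod C h) (Cod C h') \<and> u \<cdot>\<^bsub>C\<^esub> h = h' \<and> u \<cdot>\<^bsub>C\<^esub> k = k'))"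

definition pullback :: "('o, 'm) mcat \<Rightarrow> 'm \<Rightarrow> 'm \<Rightarrow> 'm \<Rightarrow> 'm \<Rightarrow> bool" where
  "pullback C f g h k \<longleftrightarrow> comm_square C f g h k \<and>
     (\<forall>f' g'. comm_square C f' g' h k \<longrightarrow>
        (\<exists>!u. u \<in> arrows C (Dom C f') (Dom C f) \<and> f \<cdot>\<^bsub>C\<^esub> u = f' \<and> g \<cdot>\<^bsub>C\<^esub> u = g'))"

text \<open>The \<open>\<M>\<close>-van Kampen property of a square \<open>(m, f, h, k)\<close>, as usual for cubes whose
  vertical arrows \<open>b, c, d\<close> are in \<open>\<M>\<close>; primed arrows form the top of the cube.\<close>

definition M_van_Kampen :: "('o, 'm) mcat \<Rightarrow> 'm \<Rightarrow> 'm \<Rightarrow> 'm \<Rightarrow> 'm \<Rightarrow> bool" where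
  "M_van_Kampen C m f h k \<longleftrightarrow>
     (\<forall>m' f' h' k' a b c d.
        comm_square C m' f' h' k' \<and>
        pullback C m' a b m \<and> pullback C f' a c f \<and>
        comm_square C h' b d h \<and> comm_square C k' c d k \<and>
        b \<in> MM C \<and> c \<in> MM C \<and> d \<in> MM C \<longrightarrow>
        (pushout C m' f' h' k' \<longleftrightarrow> pullback C h' b d h \<and> pullback C k' c d k))"

text \<open>\<open>(b, d)\<close> is a final pullback complement of \<open>a : A \<rightarrow> B\<close>, \<open>c : B \<rightarrow> C\<close>.\<close>

definition final_pullback_complement ::
  "('o, 'm) mcat \<Rightarrow> 'm \<Rightarrow> 'm \<Rightarrow> 'm \<Rightarrow> 'm \<Rightarrow> bool" where
  "final_pullback_complement C a c b d \<longleftrightarrow> pullback C a b c d \<and>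
     (\<forall>x y z w. pullback C x y c z \<and> w \<in> arrows C (Dom C x) (Dom C a) \<and> a \<cdot>\<^bsub>C\<^esub> w = x \<longrightarrow>
        (\<exists>!v. v \<in> arrows C (Dom C z) (Dom C d) \<and> d \<cdot>\<^bsub>C\<^esub> v = z \<and> v \<cdot>\<^bsub>C\<^esub> y = b \<cdot>\<^bsub>C\<^esub> w))"

text \<open>\<open>(g, k)\<close> is a pushout complement of \<open>f : A \<rightarrow> B\<close>, \<open>h : B \<rightarrow> E\<close>.\<close>

definition pushout_complement ::
  "('o, 'm) mcat \<Rightarrow> 'm \<Rightarrow> 'm \<Rightarrow> 'm \<Rightarrow> 'm \<Rightarrow> bool" where
  "pushout_complement C f h g k \<longleftrightarrow> pushout C f g h k"

definition strict_M_initial :: "('o, 'm) mcat \<Rightarrow> 'o \<Rightarrow> bool" where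
  "strict_M_initial C Z \<longleftrightarrow> Z \<in> Obj C \<and>
     (\<forall>A\<in>Obj C. \<exists>!i. i \<in> arrows C Z A) \<and>
     (\<forall>A\<in>Obj C. arrows C Z A \<subseteq> MM C) \<and>
     (\<forall>A\<in>Obj C. \<forall>f\<in>arrows C A Z. iso_arrow C f)"

locale mcategory =
  fixes C :: "('o, 'm) mcat" (structure)
  assumes Dom_Obj: "f \<in> Arr C \<Longrightarrow> Dom C f \<in> Obj C"
    and Cod_Obj: "f \<in> Arr C \<Longrightarrow> Cod C f \<in> Obj C"
    and Idn_arrows: "A \<in> Obj C \<Longrightarrow> Idn C A \<in> arrows C A A"
    and Comp_arrows: "f \<in> arrows C A B \<Longrightarrow> g \<in> arrows C B D \<Longrightarrow> g \<cdot> f \<in> arrows C A D"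
    and Comp_Idn: "f \<in> arrows C A B \<Longrightarrow> f \<cdot> Idn C A = f"
    and Idn_Comp: "f \<in> arrows C A B \<Longrightarrow> Idn C B \<cdot> f = f"
    and Comp_assoc: "f \<in> arrows C A B \<Longrightarrow> g \<in> arrows C B D \<Longrightarrow> h \<in> arrows C D E
       \<Longrightarrow> (h \<cdot> g) \<cdot> f = h \<cdot> (g \<cdot> f)"

locale M_adhesive_category = mcategory +
  assumes MM_monic: "f \<in> MM C \<Longrightarrow> monic C f"
    and iso_MM: "iso_arrow C f \<Longrightarrow> f \<in> MM C"
    and Comp_MM: "f \<in> MM C \<Longrightarrow> g \<in> MM C \<Longrightarrow> Cod C f = Dom C g \<Longrightarrow> g \<cdot> f \<in> MM C"
    and decomp_MM: "f \<in> Arr C \<Longrightarrow> g \<in> MM C \<Longrightarrow> Cod C f = Dom C g \<Longrightarrow> g \<cdot> f \<in> MM C \<Longrightarrow> f \<in> MM C"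
    and ex_pushout: "f \<in> MM C \<Longrightarrow> g \<in> Arr C \<Longrightarrow> Dom C f = Dom C g \<Longrightarrow> \<exists>h k. pushout C f g h k"
    and ex_pullback: "h \<in> MM C \<Longrightarrow> k \<in> Arr C \<Longrightarrow> Cod C h = Cod C k \<Longrightarrow> \<exists>f g. pullback C f g h k"
    and pushout_MM: "pushout C f g h k \<Longrightarrow> f \<in> MM C \<Longrightarrow> k \<in> MM C"
    and pullback_MM: "pullback C f g h k \<Longrightarrow> h \<in> MM C \<Longrightarrow> g \<in> MM C"
    and pushout_M_van_Kampen: "pushout C m f h k \<Longrightarrow> m \<in> MM C \<Longrightarrow> M_van_Kampen C m f h k"

text \<open>The standing assumptions for sesqui-pushout (SqPO) rewriting with conditions.\<close>

locale sqpo_category = M_adhesive_category +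
  assumes epi_M_factorization:
      "f \<in> Arr C \<Longrightarrow> \<exists>e m. epic C e \<and> m \<in> MM C \<and> Cod C e = Dom C m \<and> f = m \<cdot> e"
    and balanced: "monic C f \<Longrightarrow> epic C f \<Longrightarrow> iso_arrow C f"
    and ex_strict_M_initial: "\<exists>Z. strict_M_initial C Z"
    and M_effective_unions:
      "\<lbrakk>b' \<in> MM C; c' \<in> MM C; pushout C b' c' p q; b \<in> MM C; c \<in> MM C; pullback C b' c' b c;
        u \<in> arrows C (Cod C p) (Cod C b); u \<cdot> p = b; u \<cdot> q = c\<rbrakk> \<Longrightarrow> u \<in> MM C"
    and ex_FPC:
      "\<lbrakk>a \<in> MM C; c \<in> MM C; Cod C a = Dom C c\<rbrakk> \<Longrightarrow> \<exists>b d. final_pullback_complement C a c b d"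
    and FPC_MM:
      "\<lbrakk>a \<in> MM C; c \<in> MM C; final_pullback_complement C a c b d\<rbrakk> \<Longrightarrow> b \<in> MM C \<and> d \<in> MM C"

section \<open>Chosen universal constructions\<close>

text \<open>Each construction is determined only up to isomorphism. The following constants make an
  arbitrary choice, which is a solution whenever there is one.\<close>

definition the_pushout :: "('o, 'm) mcat \<Rightarrow> 'm \<Rightarrow> 'm \<Rightarrow> 'm \<times> 'm" where
  "the_pushout C f g = (SOME (h, k). pushout C f g h k)"

definition the_pullback :: "('o, 'm) mcat \<Rightarrow> 'm \<Rightarrow> 'm \<Rightarrow> 'm \<times> 'm" where
  "the_pullback C h k = (SOME (f, g). pullback C f g h k)"

definition the_pushout_complement :: "('o, 'm) mcat \<Rightarrow> 'm \<Rightarrow> 'm \<Rightarrow> 'm \<times> 'm" where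
  "the_pushout_complement C f h = (SOME (g, k). pushout_complement C f h g k)"

definition the_FPC :: "('o, 'm) mcat \<Rightarrow> 'm \<Rightarrow> 'm \<Rightarrow> 'm \<times> 'm" where
  "the_FPC C a c = (SOME (b, d). final_pullback_complement C a c b d)"

text \<open>Spans and cospans are given by their legs. They are classified up to isomorphism of the
  apex; the predicates \<open>span_rep\<close> and \<open>cospan_rep\<close> single out exactly one member of each
  isomorphism class, so that sets of isomorphism classes become sets of representatives.\<close>

definition M_span :: "('o, 'm) mcat \<Rightarrow> 'm \<times> 'm \<Rightarrow> bool" where
  "M_span C = (\<lambda>(f, g). f \<in> MM C \<and> g \<in> MM C \<and> Dom C f = Dom C g)"

definition span_iso :: "('o, 'm) mcat \<Rightarrow> 'm \<times> 'm \<Rightarrow> 'm \<times> 'm \<Rightarrow> bool" where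
  "span_iso C = (\<lambda>(f, g) (f', g'). f' \<in> Arr C \<and> g' \<in> Arr C \<and> Dom C f' = Dom C g' \<and>
     (\<exists>u. iso_arrow C u \<and> u \<in> arrows C (Dom C f) (Dom C f') \<and> f' \<cdot>\<^bsub>C\<^esub> u = f \<and> g' \<cdot>\<^bsub>C\<^esub> u = g))"

definition span_rep :: "('o, 'm) mcat \<Rightarrow> 'm \<times> 'm \<Rightarrow> bool" where
  "span_rep C s \<longleftrightarrow> s = (SOME s'. span_iso C s s')"

definition cospan_iso :: "('o, 'm) mcat \<Rightarrow> 'm \<times> 'm \<Rightarrow> 'm \<times> 'm \<Rightarrow> bool" where
  "cospan_iso C = (\<lambda>(f, g) (f', g'). f' \<in> Arr C \<and> g' \<in> Arr C \<and> Cod C f' = Cod C g' \<and>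
     (\<exists>u. iso_arrow C u \<and> u \<in> arrows C (Cod C f) (Cod C f') \<and> u \<cdot>\<^bsub>C\<^esub> f = f' \<and> u \<cdot>\<^bsub>C\<^esub> g = g'))"

definition cospan_rep :: "('o, 'm) mcat \<Rightarrow> 'm \<times> 'm \<Rightarrow> bool" where
  "cospan_rep C s \<longleftrightarrow> s = (SOME s'. cospan_iso C s s')"

section \<open>Nested conditions\<close>

text \<open>Conjunctions range over families indexed by a set of elements of a fixed index type. It
  contains an arbitrary type \<open>'i\<close>, hence families of any size, the natural numbers for
  finite conjunctions, and the cospans that index the disjunctions created by \<open>Shift\<close>.\<close>

datatype ('i, 'm) cond_index = Param 'i | Num nat | Cospan 'm 'm

datatype ('i, 'm) cond =
    CTrue
  | CEx 'm "('i, 'm) cond"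
  | CNot "('i, 'm) cond"
  | CConj "('i, 'm) cond_index set" "('i, 'm) cond_index \<Rightarrow> ('i, 'm) cond"

definition CFalse :: "('i, 'm) cond" where
  "CFalse = CNot CTrue"

definition CAnd :: "('i, 'm) cond \<Rightarrow> ('i, 'm) cond \<Rightarrow> ('i, 'm) cond" where
  "CAnd c c' = CConj {Num 0, Num 1} (\<lambda>j. if j = Num 0 then c else c')"

definition CDisj ::
  "('i, 'm) cond_index set \<Rightarrow> (('i, 'm) cond_index \<Rightarrow> ('i, 'm) cond) \<Rightarrow> ('i, 'm) cond" where
  "CDisj J F = CNot (CConj J (\<lambda>j. CNot (F j)))"

primrec cond_over :: "('o, 'm) mcat \<Rightarrow> ('i, 'm) cond \<Rightarrow> 'o \<Rightarrow> bool" where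
  "cond_over C CTrue P \<longleftrightarrow> P \<in> Obj C"
| "cond_over C (CEx a c) P \<longleftrightarrow> a \<in> MM C \<and> Dom C a = P \<and> cond_over C c (Cod C a)"
| "cond_over C (CNot c) P \<longleftrightarrow> cond_over C c P"
| "cond_over C (CConj J F) P \<longleftrightarrow> P \<in> Obj C \<and> (\<forall>j\<in>J. cond_over C (F j) P)"

primrec sat :: "('o, 'm) mcat \<Rightarrow> ('i, 'm) cond \<Rightarrow> 'm \<Rightarrow> bool" where
  "sat C CTrue p \<longleftrightarrow> True"
| "sat C (CEx a c) p \<longleftrightarrow> (\<exists>q\<in>MM C. Dom C q = Cod C a \<and> q \<cdot>\<^bsub>C\<^esub> a = p \<and> sat C c q)"
| "sat C (CNot c) p \<longleftrightarrow> \<not> sat C c p"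
| "sat C (CConj J F) p \<longleftrightarrow> (\<forall>j\<in>J. sat C (F j) p)"

text \<open>Equivalence of conditions over the same object \<open>P\<close>, and of a condition over the domain with
  a condition over the codomain of an isomorphism \<open>u\<close> along which these are identified.\<close>

definition cond_equiv ::
  "('o, 'm) mcat \<Rightarrow> 'o \<Rightarrow> ('i, 'm) cond \<Rightarrow> ('i, 'm) cond \<Rightarrow> bool" where
  "cond_equiv C P c c' \<longleftrightarrow> (\<forall>p\<in>MM C. Dom C p = P \<longrightarrow> (sat C c p \<longleftrightarrow> sat C c' p))"

definition cond_equiv_along ::
  "('o, 'm) mcat \<Rightarrow> 'm \<Rightarrow> ('i, 'm) cond \<Rightarrow> ('i, 'm) cond \<Rightarrow> bool" where
  "cond_equiv_along C u c c' \<longleftrightarrow>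
     (\<forall>p\<in>MM C. Dom C p = Cod C u \<longrightarrow> (sat C c (p \<cdot>\<^bsub>C\<^esub> u) \<longleftrightarrow> sat C c' p))"

text \<open>The cospans over which the disjunction in \<open>Shift(p, \<exists>(a, c))\<close> ranges, one from each
  isomorphism class.\<close>

definition shift_cospans :: "('o, 'm) mcat \<Rightarrow> 'm \<Rightarrow> 'm \<Rightarrow> ('m \<times> 'm) set" where
  "shift_cospans C p a = {(r, s). cospan_rep C (r, s) \<and>
     (\<exists>p'' a'' x. p'' \<in> MM C \<and> a'' \<in> MM C \<and> pushout C p'' a'' r s \<and>
        x \<in> MM C \<and> Dom C x = Dom C p \<and> Cod C x = Dom C p'' \<and>
        p'' \<cdot>\<^bsub>C\<^esub> x = p \<and> a'' \<cdot>\<^bsub>C\<^esub> x = a)}"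

primrec cshift :: "('o, 'm) mcat \<Rightarrow> 'm \<Rightarrow> ('i, 'm) cond \<Rightarrow> ('i, 'm) cond" where
  "cshift C p CTrue = CTrue"
| "cshift C p (CEx a c) =
     CDisj {Cospan r s |r s. (r, s) \<in> shift_cospans C p a}
       (\<lambda>j. case j of Cospan r s \<Rightarrow> CEx r (cshift C s c) | _ \<Rightarrow> CFalse)"
| "cshift C p (CNot c) = CNot (cshift C p c)"
| "cshift C p (CConj J F) = CConj J (\<lambda>j. cshift C p (F j))"

section \<open>Linear rules with conditions and their SqPO composition\<close>

text \<open>A linear rule \<open>O \<leftarrow> K \<rightarrow> I\<close> is the span \<open>(o, i)\<close> of its legs; the output
  comes first, and the condition is over the input \<open>I\<close>.\<close>

type_synonym ('i, 'm) cond_rule = "('m \<times> 'm) \<times> ('i, 'm) cond"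

definition linear_rule :: "('o, 'm) mcat \<Rightarrow> ('i, 'm) cond_rule \<Rightarrow> bool" where
  "linear_rule C = (\<lambda>((ro, ri), c). M_span C (ro, ri) \<and> cond_over C c (Cod C ri))"

primrec ctrans :: "('o, 'm) mcat \<Rightarrow> 'm \<times> 'm \<Rightarrow> ('i, 'm) cond \<Rightarrow> ('i, 'm) cond" where
  "ctrans C r CTrue = CTrue"
| "ctrans C r (CEx a c) =
     (if \<exists>k ro'. pushout_complement C (fst r) a k ro'
      then let (k, ro') = the_pushout_complement C (fst r) a;
               (a', ri') = the_pushout C (snd r) k
           in CEx a' (ctrans C (ro', ri') c)
      else CFalse)"
| "ctrans C r (CNot c) = CNot (ctrans C r c)"
| "ctrans C r (CConj J F) = CConj J (\<lambda>j. ctrans C r (F j))"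

text \<open>The composite of \<open>R\<^sub>2\<close> with \<open>R\<^sub>1\<close> along \<open>\<mu> = (m\<^sub>2 : M \<rightarrow> I\<^sub>2, m\<^sub>1 : M \<rightarrow> O\<^sub>1)\<close>,
  where the legs of \<open>N\<close> are \<open>n\<^sub>2 : I\<^sub>2 \<rightarrow> N\<close> and \<open>n\<^sub>1 : O\<^sub>1 \<rightarrow> N\<close>, and
  \<open>k\<^sub>j : K\<^sub>j \<rightarrow> K\<^sub>j'\<close>, \<open>d\<^sub>j : K\<^sub>j' \<rightarrow> N\<close>.\<close>

definition sq_compose ::
  "('o, 'm) mcat \<Rightarrow> ('i, 'm) cond_rule \<Rightarrow> 'm \<times> 'm \<Rightarrow> ('i, 'm) cond_rule \<Rightarrow> ('i, 'm) cond_rule" where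
  "sq_compose C R2 \<mu> R1 =
     (let ((o2, i2), c2) = R2;
          ((o1, i1), c1) = R1;
          (n2, n1) = the_pushout C (fst \<mu>) (snd \<mu>);
          (k2, d2) = the_FPC C i2 n2;
          (k1, d1) = the_pushout_complement C o1 n1;
          (p2, q2) = the_pushout C o2 k2;
          (q1, p1) = the_pushout C k1 i1;
          (l2, l1) = the_pullback C d2 d1
      in ((q2 \<cdot>\<^bsub>C\<^esub> l2, q1 \<cdot>\<^bsub>C\<^esub> l1), CAnd (cshift C p1 c1) (ctrans C (d1, q1) (cshift C n2 c2))))"

text \<open>The admissible matches of \<open>R\<^sub>2\<close> into \<open>R\<^sub>1\<close>, as a set of representatives of the isomorphism
  classes of spans. All constructions entering the composite exist by the standing assumptions,
  except for the pushout complement.\<close>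

definition sq_matches ::
  "('o, 'm) mcat \<Rightarrow> ('i, 'm) cond_rule \<Rightarrow> ('i, 'm) cond_rule \<Rightarrow> ('m \<times> 'm) set" where
  "sq_matches C R2 R1 =
     {\<mu>. M_span C \<mu> \<and> Cod C (fst \<mu>) = Cod C (snd (fst R2)) \<and> Cod C (snd \<mu>) = Cod C (fst (fst R1)) \<and>
         span_rep C \<mu> \<and>
         (\<exists>k d. pushout_complement C (fst (fst R1)) (snd (the_pushout C (fst \<mu>) (snd \<mu>))) k d) \<and>
         \<not> cond_equiv C (Cod C (snd (fst (sq_compose C R2 \<mu> R1))))
              (snd (sq_compose C R2 \<mu> R1)) CFalse}"

definition linear_rule_iso ::
  "('o, 'm) mcat \<Rightarrow> 'm \<times> 'm \<Rightarrow> 'm \<times> 'm \<Rightarrow> 'm \<Rightarrow> 'm \<Rightarrow> 'm \<Rightarrow> bool" where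
  "linear_rule_iso C = (\<lambda>(ro, ri) (ro', ri') uO uK uI.
     iso_arrow C uO \<and> uO \<in> arrows C (Cod C ro) (Cod C ro') \<and>
     iso_arrow C uK \<and> uK \<in> arrows C (Dom C ro) (Dom C ro') \<and>
     iso_arrow C uI \<and> uI \<in> arrows C (Cod C ri) (Cod C ri') \<and>
     uO \<cdot>\<^bsub>C\<^esub> ro = ro' \<cdot>\<^bsub>C\<^esub> uK \<and> uI \<cdot>\<^bsub>C\<^esub> ri = ri' \<cdot>\<^bsub>C\<^esub> uK)"

end

theory Submission
  imports Defs
begin

text \<open>
  All arrows involved are monic, so pushouts and final pullback complements can be computed in
  subobject lattices: a square of monos is a pushout iff it is a pullback whose legs cover the
  corner, and a final pullback complement is a relative pseudocomplement. Existence of the latter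
  makes the lattices distributive.

  A pair of matches in \<open>M\<^sub>A\<close> or \<open>M\<^sub>B\<close> amounts to a three-step derivation through states \<open>X1\<close>, \<open>X2\<close>,
  where the first rule has a pushout complement at \<open>O1 \<rightarrow> X1\<close> and \<open>L2\<close> is the final pullback complement
  of the second rule at \<open>I2 \<rightarrow> X1\<close>. For \<open>M\<^sub>A\<close> the states satisfy \<open>X1 = O1 \<union> I2 \<union> L2\<close> and
  \<open>X2 = O2 \<union> I3 \<union> (O1 \<inter> L2)\<close>, for \<open>M\<^sub>B\<close> they satisfy \<open>X1 = O1 \<union> I2 \<union> (I3 \<inter> L2)\<close>. By distributivity these
  requirements are equivalent. Semantically, \<open>Trans\<close> transports a match to the comatch of a
  derivation, so that both composite conditions say that the three rule conditions hold along the
  three-step derivation.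
\<close>

text \<open>The second rule leaves only a final pullback complement behind, so squares cannot be
  split freely as with double pushouts. For monos, finality is the adjunction
  \<open>U \<inter> img c \<subseteq> img (c \<cdot> a)\<close> iff
  \<open>U \<subseteq> img d\<close>; it replaces diagram chases with arbitrary test squares. Joins
  are never built as objects: \<open>pts X \<subseteq> cl X S\<close> says only that every subobject
  of \<open>X\<close> containing \<open>S\<close> is all of \<open>X\<close>, which suffices to
  recognise pushouts and is stable under intersection. The other obstacle is choice. Nested matches
  refer to composites assembled from constructions that are unique only up to isomorphism, so no
  explicit map between them is written down. Two nested matches are related when they come from a
  common triple. This relation is single-valued in both directions because monic comparison arrows
  between triples leave the pullback spans unchanged. Admissibility also demands that no composite
  condition be false; satisfiability of an outer composite implies that of the inner one, so related
  pairs are admissible together.\<close>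

context sqpo_category
begin

section \<open>Composition, identities and cancellation\<close>

lemma monoD:
  assumes "f \<in> MM C" shows "f \<in> Arr C"
  using MM_monic[OF assms] by (simp add: monic_def)

declare monoD [simp]

lemma comp_in_Arr [simp]:
  "f \<in> Arr C \<Longrightarrow> g \<in> Arr C \<Longrightarrow> Cod C f = Dom C g \<Longrightarrow> g \<cdot> f \<in> Arr C"
  "f \<in> Arr C \<Longrightarrow> g \<in> Arr C \<Longrightarrow> Cod C f = Dom C g \<Longrightarrow> Dom C (g \<cdot> f) = Dom C f"
  "f \<in> Arr C \<Longrightarrow> g \<in> Arr C \<Longrightarrow> Cod C f = Dom C g \<Longrightarrow> Cod C (g \<cdot> f) = Cod C g"
  using Comp_arrows[of f "Dom C f" "Cod C f" g "Cod C g"] by (auto simp: arrows_def)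

lemma comp_assoc [simp]:
  "f \<in> Arr C \<Longrightarrow> g \<in> Arr C \<Longrightarrow> h \<in> Arr C \<Longrightarrow> Cod C f = Dom C g \<Longrightarrow> Cod C g = Dom C h \<Longrightarrow>
    (h \<cdot> g) \<cdot> f = h \<cdot> (g \<cdot> f)"
  by (rule Comp_assoc[of f "Dom C f" "Cod C f" g "Cod C g" h "Cod C h"]) (auto simp: arrows_def)

lemma comp_in_MM [simp]: "f \<in> MM C \<Longrightarrow> g \<in> MM C \<Longrightarrow> Cod C f = Dom C g \<Longrightarrow> g \<cdot> f \<in> MM C"
  by (rule Comp_MM)

lemma Idn_Arr [simp]:
  assumes "A \<in> Obj C"
  shows "Idn C A \<in> Arr C" "Dom C (Idn C A) = A" "Cod C (Idn C A) = A"
  using Idn_arrows[OF assms] by (auto simp: arrows_def)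

lemma iso_Idn: "A \<in> Obj C \<Longrightarrow> iso_arrow C (Idn C A)"
  unfolding iso_arrow_def using Idn_arrows[of A] Comp_Idn[of "Idn C A" A A]
  by (intro conjI bexI[of _ "Idn C A"]) auto

lemma Idn_MM [simp]: "A \<in> Obj C \<Longrightarrow> Idn C A \<in> MM C"
  by (simp add: iso_Idn iso_MM)

lemma comp_Idn [simp]:
  "f \<in> Arr C \<Longrightarrow> Dom C f = A \<Longrightarrow> f \<cdot> Idn C A = f"
  "f \<in> Arr C \<Longrightarrow> Cod C f = A \<Longrightarrow> Idn C A \<cdot> f = f"
  using Comp_Idn[of f A "Cod C f"] Idn_Comp[of f "Dom C f" A] by (auto simp: arrows_def)

lemma Obj_DomCod [simp]: "f \<in> Arr C \<Longrightarrow> Dom C f \<in> Obj C" "f \<in> Arr C \<Longrightarrow> Cod C f \<in> Obj C"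
  by (auto intro: Dom_Obj Cod_Obj)

lemma cancel:
  "m \<in> MM C \<Longrightarrow> a \<in> Arr C \<Longrightarrow> b \<in> Arr C \<Longrightarrow> Cod C a = Dom C m \<Longrightarrow> Cod C b = Dom C m \<Longrightarrow>
    m \<cdot> a = m \<cdot> b \<longleftrightarrow> a = b"
proof
  assume *: "m \<in> MM C" "a \<in> Arr C" "b \<in> Arr C" "Cod C a = Dom C m" "Cod C b = Dom C m" "m \<cdot> a = m \<cdot> b"
  then have "Dom C a = Dom C b" by (metis comp_in_Arr(2) monoD)
  then show "a = b" using * MM_monic[of m] by (auto simp: monic_def)
qed simp

abbreviation mor :: "'b \<Rightarrow> 'a \<Rightarrow> 'a \<Rightarrow> bool" where
  "mor f A B \<equiv> f \<in> MM C \<and> Dom C f = A \<and> Cod C f = B"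

text \<open>The simplifier nests composites to the right, where the left side of an equation
  \<open>g \<cdot> f = h \<cdot> k\<close> no longer occurs. This form and the next apply such an
  equation inside a longer composite.\<close>

lemma reassoc:
  assumes "g \<cdot> f = h \<cdot> k" "f \<in> Arr C" "g \<in> Arr C" "h \<in> Arr C" "k \<in> Arr C" "z \<in> Arr C"
    "Cod C f = Dom C g" "Cod C k = Dom C h" "Cod C z = Dom C f"
  shows "g \<cdot> (f \<cdot> z) = h \<cdot> (k \<cdot> z)"
proof -
  have "Dom C f = Dom C k" using assms by (metis comp_in_Arr(2))
  then show ?thesis using assms by (metis comp_assoc)
qed

lemma reassoc1:
  assumes "g \<cdot> f = h" "f \<in> Arr C" "g \<in> Arr C" "z \<in> Arr C"
    "Cod C f = Dom C g" "Cod C z = Dom C f"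
  shows "g \<cdot> (f \<cdot> z) = h \<cdot> z"
  using assms by (metis comp_assoc)

lemma decomp:
  "g \<cdot> f \<in> MM C \<Longrightarrow> g \<in> MM C \<Longrightarrow> f \<in> Arr C \<Longrightarrow> Cod C f = Dom C g \<Longrightarrow> f \<in> MM C"
  by (rule decomp_MM)

subsection \<open>Subobjects as sets of generalized elements\<close>

text \<open>Subobjects of \<open>X\<close> are represented by their monic generalized elements, so that intersection is
  set intersection and composition with a mono is direct image. The join of a family is the
  closure \<open>cl X\<close> of its union.\<close>

definition pts :: "'a \<Rightarrow> 'b set" where
  "pts X = {z \<in> MM C. Cod C z = X}"

definition img :: "'b \<Rightarrow> 'b set" where
  "img f = {f \<cdot> z |z. z \<in> pts (Dom C f)}"

definition Sub :: "'a \<Rightarrow> 'b set set" where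
  "Sub X = {img f |f. f \<in> MM C \<and> Cod C f = X}"

definition cl :: "'a \<Rightarrow> 'b set \<Rightarrow> 'b set" where
  "cl X S = pts X \<inter> \<Inter>{T \<in> Sub X. S \<subseteq> T}"

lemma ptsI [simp, intro]: "z \<in> MM C \<Longrightarrow> Cod C z = X \<Longrightarrow> z \<in> pts X"
  by (simp add: pts_def)

lemma imgI [intro]: "z \<in> MM C \<Longrightarrow> Cod C z = Dom C f \<Longrightarrow> f \<cdot> z \<in> img f"
  by (auto simp: img_def)

lemma imgE [elim]:
  assumes "x \<in> img f" obtains z where "z \<in> MM C" "Cod C z = Dom C f" "x = f \<cdot> z"
  using assms by (auto simp: img_def pts_def)

lemma img_self [simp]: "f \<in> MM C \<Longrightarrow> f \<in> img f"
  using imgI[of "Idn C (Dom C f)" f] by simp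

lemma img_pts: "f \<in> MM C \<Longrightarrow> img f \<subseteq> pts (Cod C f)"
  by auto

lemma img_Sub [simp, intro]: "f \<in> MM C \<Longrightarrow> Cod C f = X \<Longrightarrow> img f \<in> Sub X"
  by (auto simp: Sub_def)

lemma SubE [elim]:
  assumes "U \<in> Sub X" obtains f where "f \<in> MM C" "Cod C f = X" "U = img f"
  using assms by (auto simp: Sub_def)

lemma Sub_pts: "U \<in> Sub X \<Longrightarrow> U \<subseteq> pts X"
  using img_pts by auto

lemma img_closed:
  assumes "x \<in> img f" "f \<in> MM C" "w \<in> MM C" "Cod C w = Dom C x" shows "x \<cdot> w \<in> img f"
  using assms by (auto intro!: imgI elim!: imgE)

text \<open>\<open>img f\<close> is the principal down-set of \<open>f\<close>, so an inclusion is
  tested at the generic point \<open>f\<close> alone.\<close>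

lemma img_subset_iff:
  assumes "f \<in> MM C" "m \<in> MM C"
  shows "img f \<subseteq> img m \<longleftrightarrow> f \<in> img m"
  using assms img_closed[of f m] by (auto elim!: imgE[of _ f])

lemma factor:
  assumes "f \<in> img m" "mor f A X" "mor m B X"
  obtains w where "mor w A B" "m \<cdot> w = f"
proof -
  obtain w where w: "w \<in> MM C" "Cod C w = Dom C m" "f = m \<cdot> w" using assms(1) by (rule imgE)
  then have "Dom C w = A" using comp_in_Arr(2)[of w m] assms by simp
  then show ?thesis using that[of w] w assms by blast
qed

lemma img_comp_sub: "f \<in> MM C \<Longrightarrow> g \<in> MM C \<Longrightarrow> Cod C f = Dom C g \<Longrightarrow> img (g \<cdot> f) \<subseteq> img g"
  by (subst img_subset_iff) auto

lemma img_comp_iff: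
  assumes "f \<in> MM C" "g \<in> MM C" "Cod C f = Dom C g" "z \<in> Arr C" "Cod C z = Dom C g"
  shows "g \<cdot> z \<in> img (g \<cdot> f) \<longleftrightarrow> z \<in> img f"
proof
  assume "g \<cdot> z \<in> img (g \<cdot> f)"
  then obtain w where "w \<in> MM C" "Cod C w = Dom C (g \<cdot> f)" "g \<cdot> z = (g \<cdot> f) \<cdot> w" by auto
  then show "z \<in> img f" using assms by (auto simp: cancel)
next
  assume "z \<in> img f"
  then obtain w where "w \<in> MM C" "Cod C w = Dom C f" "z = f \<cdot> w" by auto
  then show "g \<cdot> z \<in> img (g \<cdot> f)" using assms imgI[of w "g \<cdot> f"] by simp
qed

lemma img_comp:
  "f \<in> MM C \<Longrightarrow> g \<in> MM C \<Longrightarrow> Cod C f = Dom C g \<Longrightarrow> img (g \<cdot> f) = (\<cdot>) g ` img f"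
  unfolding img_def Setcompr_eq_image image_image by (rule image_cong) (auto simp: pts_def)

lemma iso_inverse:
  assumes "iso_arrow C u"
  obtains v where "iso_arrow C v" "mor v (Cod C u) (Dom C u)"
    "v \<cdot> u = Idn C (Dom C u)" "u \<cdot> v = Idn C (Cod C u)"
proof -
  obtain v where v: "v \<in> arrows C (Cod C u) (Dom C u)" "v \<cdot> u = Idn C (Dom C u)" "u \<cdot> v = Idn C (Cod C u)"
    using assms by (auto simp: iso_arrow_def)
  have "iso_arrow C v" using v assms by (auto simp: iso_arrow_def arrows_def)
  then show ?thesis using that v iso_MM by (auto simp: arrows_def)
qed

lemma isoI:
  assumes "u \<in> Arr C" "v \<in> Arr C" "Dom C v = Cod C u" "Cod C v = Dom C u"
    "v \<cdot> u = Idn C (Dom C u)" "u \<cdot> v = Idn C (Cod C u)"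
  shows "iso_arrow C u"
  using assms by (auto simp: iso_arrow_def arrows_def)

text \<open>A mono through which the identity factors has a section and is therefore invertible.
  This is how a subobject that turns out to be everything yields an isomorphism.\<close>

lemma iso_of_Idn_img:
  assumes "m \<in> MM C" "Idn C (Cod C m) \<in> img m"
  shows "iso_arrow C m"
proof -
  obtain v where v: "v \<in> MM C" "Cod C v = Dom C m" "m \<cdot> v = Idn C (Cod C m)"
    using assms by (auto elim!: imgE)
  then have d: "Dom C v = Cod C m" using assms comp_in_Arr(2)[of v m] by simp
  have "m \<cdot> (v \<cdot> m) = m \<cdot> Idn C (Dom C m)" using v d assms by (simp add: reassoc1[OF v(3)])
  then have "v \<cdot> m = Idn C (Dom C m)" using v d assms cancel[of m "v \<cdot> m" "Idn C (Dom C m)"] by simp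
  then show ?thesis using v d assms by (intro isoI[of _ v]) auto
qed

lemma img_iso: "iso_arrow C u \<Longrightarrow> img u = pts (Cod C u)"
proof (intro equalityI subsetI)
  fix z assume "iso_arrow C u" "z \<in> pts (Cod C u)"
  moreover from this obtain v where "iso_arrow C v" "mor v (Cod C u) (Dom C u)"
    "v \<cdot> u = Idn C (Dom C u)" and uv: "u \<cdot> v = Idn C (Cod C u)" using iso_inverse by blast
  ultimately have "u \<cdot> (v \<cdot> z) = z" "v \<cdot> z \<in> MM C" "Cod C (v \<cdot> z) = Dom C u"
    using iso_MM[of u] by (auto simp: pts_def reassoc1[OF uv])
  then show "z \<in> img u" using imgI[of "v \<cdot> z" u] by simp
next
  fix z assume "iso_arrow C u" "z \<in> img u" 
  then show "z \<in> pts (Cod C u)" using iso_MM[of u] by auto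
qed

text \<open>Turns an equality in the subobject lattice into an isomorphism: each mono factors
  through the other, and cancellation makes the two factors mutually inverse.\<close>

lemma same_img_iso:
  assumes "mor f A X" "mor g B X" "img f = img g"
  obtains u where "iso_arrow C u" "mor u A B" "g \<cdot> u = f"
proof -
  obtain u where u: "mor u A B" "g \<cdot> u = f" using assms factor[of f g] img_self[of f] by blast
  obtain v where v: "mor v B A" "f \<cdot> v = g" using assms factor[of g f] img_self[of g] by blast
  note [simp] = conjunct1[OF u(1)] conjunct2[OF u(1)] conjunct1[OF v(1)] conjunct2[OF v(1)]
    conjunct1[OF assms(1)] conjunct2[OF assms(1)] conjunct1[OF assms(2)] conjunct2[OF assms(2)]
  have [simp]: "A \<in> Obj C" "B \<in> Obj C"
    using Obj_DomCod(1)[of f] Obj_DomCod(1)[of g] by simp_all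
  have "g \<cdot> (u \<cdot> v) = g \<cdot> Idn C B" "f \<cdot> (v \<cdot> u) = f \<cdot> Idn C A"
    by (simp_all add: reassoc1[OF u(2)] reassoc1[OF v(2)] u(2) v(2))
  then have "u \<cdot> v = Idn C B" "v \<cdot> u = Idn C A"
    by (simp_all add: cancel del: comp_Idn)
  then have "iso_arrow C u" by (intro isoI[of u v]) simp_all
  then show ?thesis using u by (rule that)
qed

subsection \<open>Intersections, implication and closure\<close>

text \<open>Pullbacks of monos with the universal property tested on monic points only;
  \<open>pullback_pb\<close> and \<open>pb_pullback\<close> show that this loses nothing.\<close>

definition pb :: "'b \<Rightarrow> 'b \<Rightarrow> 'b \<Rightarrow> 'b \<Rightarrow> bool" where
  "pb f g h k \<longleftrightarrow> f \<in> MM C \<and> g \<in> MM C \<and> h \<in> MM C \<and> k \<in> MM C \<and>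
     Dom C f = Dom C g \<and> Cod C f = Dom C h \<and> Cod C g = Dom C k \<and> Cod C h = Cod C k \<and>
     h \<cdot> f = k \<cdot> g \<and> img h \<inter> img k \<subseteq> img (h \<cdot> f)"

lemma pullback_pb:
  assumes p: "pullback C f g h k" and h: "h \<in> MM C" and k: "k \<in> MM C"
  shows "pb f g h k"
proof -
  have c: "f \<in> Arr C" "g \<in> Arr C" "Dom C f = Dom C g" "Cod C f = Dom C h" "Cod C g = Dom C k"
    "Cod C h = Cod C k" "h \<cdot> f = k \<cdot> g"
    and un: "\<And>f' g'. comm_square C f' g' h k \<Longrightarrow>
        (\<exists>!u. u \<in> arrows C (Dom C f') (Dom C f) \<and> f \<cdot>\<^bsub>C\<^esub> u = f' \<and> g \<cdot>\<^bsub>C\<^esub> u = g')"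
    using p unfolding pullback_def comm_square_def by blast+
  have g: "g \<in> MM C" using p h pullback_MM by blast
  have f: "f \<in> MM C" using decomp[of h f] c g h k by simp
  have "img h \<inter> img k \<subseteq> img (h \<cdot> f)"
  proof
    fix z assume "z \<in> img h \<inter> img k"
    then obtain a b where ab: "a \<in> MM C" "Cod C a = Dom C h" "z = h \<cdot> a"
      "b \<in> MM C" "Cod C b = Dom C k" "z = k \<cdot> b" by blast
    have "comm_square C a b h k" using ab h k c
      by (auto simp: comm_square_def) (metis comp_in_Arr(2) monoD)
    from ex1_implies_ex[OF un[OF this]] obtain u where
      u: "u \<in> arrows C (Dom C a) (Dom C f)" "f \<cdot> u = a" by blast
    then have "z \<in> img (h \<cdot> f)" if "u \<in> MM C" using ab f h that imgI[of u "h \<cdot> f"] c(4)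
      by (simp add: arrows_def)
    then show "z \<in> img (h \<cdot> f)" using decomp[of f u] u ab f by (simp add: arrows_def)
  qed
  then show ?thesis using c f g h k by (simp add: pb_def)
qed

lemma pullback_ex:
  assumes "mor h B X" "mor k D X"
  obtains P f g where "pullback C f g h k" "mor f P B" "mor g P D"
proof -
  obtain f g where p: "pullback C f g h k" using ex_pullback[of h k] assms by auto
  have "pb f g h k" using pullback_pb[OF p] assms by blast
  then have "mor f (Dom C f) B" "mor g (Dom C f) D" using assms unfolding pb_def by simp_all
  then show ?thesis by (rule that[OF p])
qed

lemma pbD:
  assumes "pb f g h k"
  shows "f \<in> MM C" "g \<in> MM C" "h \<in> MM C" "k \<in> MM C"
     "Dom C f = Dom C g" "Cod C f = Dom C h" "Cod C g = Dom C k" "Cod C h = Cod C k"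
     "h \<cdot> f = k \<cdot> g" "img h \<inter> img k = img (h \<cdot> f)"
proof -
  note * = assms[unfolded pb_def]
  show "f \<in> MM C" "g \<in> MM C" "h \<in> MM C" "k \<in> MM C"
     "Dom C f = Dom C g" "Cod C f = Dom C h" "Cod C g = Dom C k" "Cod C h = Cod C k"
     "h \<cdot> f = k \<cdot> g" using * by auto
  then have "img (h \<cdot> f) \<subseteq> img h" "img (h \<cdot> f) \<subseteq> img k"
    using img_comp_sub[of f h] img_comp_sub[of g k] by auto
  then show "img h \<inter> img k = img (h \<cdot> f)" using * by blast
qed

lemma pb_ex:
  assumes "mor h B X" "mor k D X"
  obtains P f g where "pb f g h k" "mor f P B" "mor g P D"
proof -
  obtain P f g where "pullback C f g h k" "mor f P B" "mor g P D" using pullback_ex[OF assms] .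
  then show ?thesis using that pullback_pb[of f g h k] assms by blast
qed

lemma pullback_precomp_iso:
  assumes p: "pullback C f g h k" and u: "iso_arrow C u" "Cod C u = Dom C f"
  shows "pullback C (f \<cdot> u) (g \<cdot> u) h k"
proof -
  have c: "f \<in> Arr C" "g \<in> Arr C" "h \<in> Arr C" "k \<in> Arr C" "Dom C f = Dom C g" "Cod C f = Dom C h" "Cod C
      g = Dom C k"
    "Cod C h = Cod C k" "h \<cdot> f = k \<cdot> g"
    and un: "\<And>f' g'. comm_square C f' g' h k \<Longrightarrow>
        (\<exists>!u. u \<in> arrows C (Dom C f') (Dom C f) \<and> f \<cdot>\<^bsub>C\<^esub> u = f' \<and> g \<cdot>\<^bsub>C\<^esub> u = g')"
    using p unfolding pullback_def comm_square_def by blast+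
  obtain v where v: "mor v (Cod C u) (Dom C u)"
    "v \<cdot> u = Idn C (Dom C u)" "u \<cdot> v = Idn C (Cod C u)" using iso_inverse u by blast
  have um: "u \<in> MM C" using u iso_MM by blast
  have sq: "comm_square C (f \<cdot> u) (g \<cdot> u) h k"
    using c um u by (auto simp: comm_square_def reassoc[OF c(9)])
  show ?thesis unfolding pullback_def
  proof (intro conjI allI impI sq)
    fix f' g' assume s: "comm_square C f' g' h k"
    from ex1_implies_ex[OF un[OF s]] obtain w where
      w: "w \<in> arrows C (Dom C f') (Dom C f)" "f \<cdot> w = f'" "g \<cdot> w = g'" by blast
    show "\<exists>!w. w \<in> arrows C (Dom C f') (Dom C (f \<cdot> u)) \<and> f \<cdot> u \<cdot> w = f' \<and> g \<cdot> u \<cdot> w = g'"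
    proof (rule ex1I[of _ "v \<cdot> w"], intro conjI)
      show "v \<cdot> w \<in> arrows C (Dom C f') (Dom C (f \<cdot> u))" using v w u um c by (simp add: arrows_def)
      have "u \<cdot> (v \<cdot> w) = w" using v(1) w u um c by (simp add: arrows_def reassoc1[OF v(3)])
      then show "f \<cdot> u \<cdot> (v \<cdot> w) = f'" "g \<cdot> u \<cdot> (v \<cdot> w) = g'"
        using v w u um c by (simp_all add: arrows_def)
      fix y assume y: "y \<in> arrows C (Dom C f') (Dom C (f \<cdot> u)) \<and> f \<cdot> u \<cdot> y = f' \<and> g \<cdot> u \<cdot> y = g'"
      then have "u \<cdot> y \<in> arrows C (Dom C f') (Dom C f)" "f \<cdot> (u \<cdot> y) = f'" "g \<cdot> (u \<cdot> y) = g'"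
        using u um c by (auto simp: arrows_def)
      then have "u \<cdot> y = w" using un[OF s] w by blast
      then have "v \<cdot> w = v \<cdot> (u \<cdot> y)" by simp
      also have "\<dots> = y" using v(1) y u um c by (simp add: arrows_def reassoc1[OF v(2)])
      finally show "y = v \<cdot> w" by simp
    qed
  qed
qed

text \<open>The universal property against arbitrary arrows is borrowed from a pullback that exists
  anyway: it has the same image in the corner, so the given square differs from it by an
  isomorphism.\<close>

lemma pb_pullback:
  assumes "pb f g h k" shows "pullback C f g h k"
proof -
  note [simp] = pbD(1-8)[OF assms]
  obtain P f' g' where p: "pullback C f' g' h k" "mor f' P (Dom C h)" "mor g' P (Dom C k)"
    by (rule pullback_ex[of h "Dom C h" "Cod C h" k "Dom C k"]) (simp, simp, blast)
  have p': "pb f' g' h k" using p(1) by (rule pullback_pb) simp_all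
  have "img (h \<cdot> f) = img (h \<cdot> f')" using pbD(10)[OF p'] pbD(10)[OF assms] by simp
  note [simp] = conjunct1[OF p(2)] conjunct2[OF p(2)] conjunct1[OF p(3)] conjunct2[OF p(3)]
  obtain u where u: "iso_arrow C u" "mor u (Dom C f) P" "(h \<cdot> f') \<cdot> u = h \<cdot> f"
    by (rule same_img_iso[of "h \<cdot> f" "Dom C f" "Cod C h" "h \<cdot> f'" P])
      (simp, simp, rule \<open>img (h \<cdot> f) = img (h \<cdot> f')\<close>, blast)
  have e: "h \<cdot> f' = k \<cdot> g'" "h \<cdot> f = k \<cdot> g" using p' assms by (auto simp: pb_def)
  have "h \<cdot> (f' \<cdot> u) = h \<cdot> f" "k \<cdot> (g' \<cdot> u) = k \<cdot> g"
    using u(2,3) by (simp_all add: reassoc[OF e(1)] e(2))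
  then have "f' \<cdot> u = f" "g' \<cdot> u = g" using u(2) by (simp_all add: cancel)
  then show ?thesis using pullback_precomp_iso[OF p(1) u(1)] u(2) by simp
qed

text \<open>The order-theoretic content of \<open>(b, d)\<close> being a final pullback complement of \<open>a\<close>, \<open>c\<close>: the subobject
  \<open>d\<close> is the relative pseudocomplement \<open>c \<rightarrow> c \<cdot> a\<close>.\<close>

definition fp :: "'b \<Rightarrow> 'b \<Rightarrow> 'b \<Rightarrow> 'b \<Rightarrow> bool" where
  "fp a c b d \<longleftrightarrow> a \<in> MM C \<and> b \<in> MM C \<and> c \<in> MM C \<and> d \<in> MM C \<and>
     Dom C a = Dom C b \<and> Cod C a = Dom C c \<and> Cod C b = Dom C d \<and> Cod C c = Cod C d \<and>
     c \<cdot> a = d \<cdot> b \<and> (\<forall>U \<in> Sub (Cod C c). U \<inter> img c \<subseteq> img (c \<cdot> a) \<longleftrightarrow> U \<subseteq> img d)"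

text \<open>A subobject \<open>z\<close> with \<open>U = img z\<close> is tested by pulling it back
  along \<open>c\<close>. The assumption on \<open>U\<close> factors the pulled back arrow through
  \<open>a\<close>, and finality answers with a factorization of \<open>z\<close> through
  \<open>d\<close>.\<close>

lemma FPC_fp:
  assumes F: "final_pullback_complement C a c b d" and a: "a \<in> MM C" and c: "c \<in> MM C"
  shows "fp a c b d"
proof -
  have b: "b \<in> MM C" and d: "d \<in> MM C" using FPC_MM[OF a c F] by auto
  have pbk: "pullback C a b c d" and 
    un: "\<And>x y z w. pullback C x y c z \<Longrightarrow> w \<in> arrows C (Dom C x) (Dom C a) \<Longrightarrow> a \<cdot> w = x \<Longrightarrow>
      \<exists>v. v \<in> arrows C (Dom C z) (Dom C d) \<and> d \<cdot> v = z"
    using F unfolding final_pullback_complement_def by blast+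
  note p = pullback_pb[OF pbk c d]
  note [simp] = pbD(1-8)[OF p]
  have "U \<inter> img c \<subseteq> img (c \<cdot> a) \<longleftrightarrow> U \<subseteq> img d" if "U \<in> Sub (Cod C c)" for U
  proof
    assume "U \<subseteq> img d" then show "U \<inter> img c \<subseteq> img (c \<cdot> a)" using pbD(10)[OF p] by auto
  next
    assume U: "U \<inter> img c \<subseteq> img (c \<cdot> a)"
    obtain z where z: "z \<in> MM C" "Cod C z = Cod C c" "U = img z" using \<open>U \<in> Sub (Cod C c)\<close> by auto
    obtain P x y where xy: "pullback C x y c z" "mor x P (Dom C c)" "mor y P (Dom C z)"
      by (rule pullback_ex[of c "Dom C c" "Cod C c" z "Dom C z"]) (use z in \<open>simp, simp, blast\<close>)
    note [simp] = xy(2,3) z(1,2)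
    have "c \<cdot> x \<in> img z \<inter> img c"
      unfolding pbD(10)[OF pullback_pb[OF xy(1) c z(1)]] Int_commute[of "img z"] by simp
    then have "c \<cdot> x \<in> img (c \<cdot> a)" using U z(3) by blast
    then have "x \<in> img a" by (simp add: img_comp_iff)
    then obtain w where w: "mor w P (Dom C a)" "a \<cdot> w = x"
      by (rule factor[of x a P "Dom C c" "Dom C a"]) (simp, simp, blast)
    then have "w \<in> arrows C (Dom C x) (Dom C a)" by (simp add: arrows_def)
    then obtain v where v: "v \<in> arrows C (Dom C z) (Dom C d)" "d \<cdot> v = z"
      using un[OF xy(1) _ w(2)] by blast
    then have "v \<in> MM C" using decomp[of d v] by (simp add: arrows_def)
    then have "z \<in> img d" using v imgI[of v d] by (simp add: arrows_def)
    then show "U \<subseteq> img d" using z by (simp add: img_subset_iff)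
  qed
  then show ?thesis using pbD(9)[OF p] unfolding fp_def by simp
qed

lemma fp_ex:
  assumes "mor a A B" "mor c B X"
  obtains D b d where "fp a c b d" "mor b A D" "mor d D X"
proof -
  obtain b d where "final_pullback_complement C a c b d" using ex_FPC[of a c] assms by auto
  then have "fp a c b d" using FPC_fp assms by blast
  moreover from this have "mor b A (Dom C d)" "mor d (Dom C d) X" using assms by (auto simp: fp_def)
  ultimately show ?thesis using that by blast
qed

lemma fpD:
  assumes "fp a c b d"
  shows "a \<in> MM C" "b \<in> MM C" "c \<in> MM C" "d \<in> MM C"
     "Dom C a = Dom C b" "Cod C a = Dom C c" "Cod C b = Dom C d" "Cod C c = Cod C d"
     "c \<cdot> a = d \<cdot> b" "img d \<inter> img c = img (c \<cdot> a)"
proof -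
  note * = assms[unfolded fp_def]
  show "a \<in> MM C" "b \<in> MM C" "c \<in> MM C" "d \<in> MM C"
     "Dom C a = Dom C b" "Cod C a = Dom C c" "Cod C b = Dom C d" "Cod C c = Cod C d"
     "c \<cdot> a = d \<cdot> b" using * by auto
  then have "img (c \<cdot> a) \<subseteq> img c" "img (c \<cdot> a) \<subseteq> img d"
    using img_comp_sub[of a c] img_comp_sub[of b d] by auto
  moreover have "img d \<in> Sub (Cod C c)" using * by simp
  then have "img d \<inter> img c \<subseteq> img (c \<cdot> a)" using * by blast
  ultimately show "img d \<inter> img c = img (c \<cdot> a)" by blast
qed

lemma fp_iff: "fp a c b d \<Longrightarrow> U \<in> Sub (Cod C c) \<Longrightarrow> U \<inter> img c \<subseteq> img (c \<cdot> a) \<longleftrightarrow> U \<subseteq> img d"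
  unfolding fp_def by blast

lemma fpI:
  assumes "a \<in> MM C" "b \<in> MM C" "c \<in> MM C" "d \<in> MM C"
     "Dom C a = Dom C b" "Cod C a = Dom C c" "Cod C b = Dom C d" "Cod C c = Cod C d"
     "c \<cdot> a = d \<cdot> b" "img d \<inter> img c \<subseteq> img (c \<cdot> a)"
     "\<And>U. U \<in> Sub (Cod C c) \<Longrightarrow> U \<inter> img c \<subseteq> img (c \<cdot> a) \<Longrightarrow> U \<subseteq> img d"
  shows "fp a c b d"
  using assms unfolding fp_def by blast

text \<open>\<open>W\<close> is presented by \<open>c\<close> and \<open>W \<inter> T\<close> by
  \<open>c \<cdot> a\<close>, with \<open>a\<close> a pullback of \<open>T\<close> along
  \<open>c\<close>. The final pullback complement of \<open>a\<close> and \<open>c\<close> is then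
  the Heyting implication from \<open>W\<close> to \<open>T\<close>.\<close>

lemma implication:
  assumes "W \<in> Sub X" "T \<in> Sub X"
  obtains D where "D \<in> Sub X" "\<And>U. U \<in> Sub X \<Longrightarrow> U \<inter> W \<subseteq> T \<longleftrightarrow> U \<subseteq> D"
proof -
  obtain c t where c: "mor c (Dom C c) X" "W = img c" "mor t (Dom C t) X" "T = img t"
    using assms by (metis SubE)
  then obtain A a t' where a: "pb a t' c t" "mor a A (Dom C c)"
    using pb_ex[of c "Dom C c" X t "Dom C t"] by blast
  then obtain D b d where d: "fp a c b d" "mor d D X"
    using fp_ex[of a A "Dom C c" c X] c by blast
  have i: "img (c \<cdot> a) = W \<inter> T" using pbD(10)[OF a(1)] c by simp
  show ?thesis
  proof
    show "img d \<in> Sub X" using d(2) by simp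
    fix U assume "U \<in> Sub X"
    then have "U \<inter> img c \<subseteq> img (c \<cdot> a) \<longleftrightarrow> U \<subseteq> img d" using fp_iff[OF d(1), of U] c(1) by simp
    then show "U \<inter> W \<subseteq> T \<longleftrightarrow> U \<subseteq> img d" unfolding i c(2) by blast
  qed
qed

section \<open>Joins as closures, and distributivity\<close>

lemma cl_sup: "S \<subseteq> pts X \<Longrightarrow> S \<subseteq> cl X S"
  by (auto simp: cl_def)

lemma cl_least: "T \<in> Sub X \<Longrightarrow> S \<subseteq> T \<Longrightarrow> cl X S \<subseteq> T"
  by (auto simp: cl_def)

lemma cl_mono: "S \<subseteq> S' \<Longrightarrow> cl X S \<subseteq> cl X S'"
  by (auto simp: cl_def)

lemma cl_pts: "cl X S \<subseteq> pts X"
  by (auto simp: cl_def)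

lemma cl_trans: "S \<subseteq> cl X S' \<Longrightarrow> cl X S \<subseteq> cl X S'"
  unfolding cl_def by blast

text \<open>A union of two images need not be an image, but it remains closed under precomposition
  with monos. That is all distributivity requires of it.\<close>

definition sieve :: "'b set \<Rightarrow> bool" where
  "sieve S \<longleftrightarrow> (\<forall>s\<in>S. \<forall>w\<in>MM C. Cod C w = Dom C s \<longrightarrow> s \<cdot> w \<in> S)"

lemma sieve_img [simp, intro]: "f \<in> MM C \<Longrightarrow> sieve (img f)"
  by (auto simp: sieve_def intro: img_closed)

lemma sieve_Un [intro]: "sieve S \<Longrightarrow> sieve T \<Longrightarrow> sieve (S \<union> T)"
  and sieve_Int [intro]: "sieve S \<Longrightarrow> sieve T \<Longrightarrow> sieve (S \<inter> T)"
  by (auto simp: sieve_def)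

text \<open>Distributivity: intersecting with \<open>W\<close> has a right adjoint, given by final pullback
  complements.\<close>

lemma Int_cl:
  assumes W: "W \<in> Sub X" and S: "S \<subseteq> pts X" "sieve S"
  shows "W \<inter> cl X S \<subseteq> cl X (W \<inter> S)"
proof
  fix z assume z: "z \<in> W \<inter> cl X S"
  show "z \<in> cl X (W \<inter> S)"
    unfolding cl_def
  proof (intro IntI InterI)
    show "z \<in> pts X" using z cl_pts by auto
    fix T assume T: "T \<in> {T \<in> Sub X. W \<inter> S \<subseteq> T}"
    then obtain D where D: "D \<in> Sub X" "\<And>U. U \<in> Sub X \<Longrightarrow> U \<inter> W \<subseteq> T \<longleftrightarrow> U \<subseteq> D"
      using implication[OF W] by blast
    \<comment> \<open>The adjunction applies to subobjects only, so each \<open>s\<close> is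
      enlarged to \<open>img s\<close>, which stays inside \<open>S\<close> because \<open>S\<close>
      is a sieve.\<close>
    have "S \<subseteq> D"
    proof
      fix s assume s: "s \<in> S"
      then have sm: "s \<in> MM C" "Cod C s = X" using S by (auto simp: pts_def)
      have "img s \<subseteq> S" using s S(2) by (auto simp: sieve_def elim!: imgE)
      then have "img s \<inter> W \<subseteq> T" using T by blast
      then have "img s \<subseteq> D" using D(2) sm by auto
      then show "s \<in> D" using sm img_self by blast
    qed
    then have "z \<in> D" using cl_least[OF D(1)] z by blast
    then show "z \<in> T" using D(2)[OF D(1)] z by blast
  qed
qed

text \<open>Direct image along \<open>f\<close> is left adjoint to preimage, hence compatible with
  joins. The preimage of a competitor \<open>T\<close> is the pullback leg \<open>a\<close>.\<close>

lemma cl_image: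
  assumes f: "mor f A X" and S: "S \<subseteq> pts A"
  shows "(\<cdot>) f ` cl A S \<subseteq> cl X ((\<cdot>) f ` S)"
proof clarify
  fix z assume z: "z \<in> cl A S"
  then have zp: "z \<in> MM C" "Cod C z = A" using cl_pts by (auto simp: pts_def)
  show "f \<cdot> z \<in> cl X ((\<cdot>) f ` S)" unfolding cl_def
  proof (intro IntI InterI)
    show "f \<cdot> z \<in> pts X" using zp f by auto
    fix T assume T: "T \<in> {T \<in> Sub X. (\<cdot>) f ` S \<subseteq> T}"
    then obtain t where t: "mor t (Dom C t) X" "T = img t" by (metis (mono_tags, lifting) SubE mem_Collect_eq)
    obtain P a b where p: "pb a b f t" "mor a P A"
      using pb_ex[of f A X t "Dom C t"] f t by blast
    have iff: "f \<cdot> y \<in> T \<longleftrightarrow> y \<in> img a" if "y \<in> pts A" for y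
    proof -
      have "f \<cdot> y \<in> T \<longleftrightarrow> f \<cdot> y \<in> img f \<inter> img t" using that f t by (auto simp: pts_def)
      then show ?thesis using pbD(10)[OF p(1)] that f p img_comp_iff[of a f y] by (auto simp: pts_def)
    qed
    have "S \<subseteq> img a" using T S iff by (auto simp: image_subset_iff)
    then have "z \<in> img a" using z cl_least[of "img a" A S] p by auto
    then show "f \<cdot> z \<in> T" using iff zp by auto
  qed
qed

text \<open>Each competitor \<open>t\<close> in \<open>A\<close> gives the competitor
  \<open>f \<cdot> t\<close> in \<open>X\<close>, and \<open>f\<close> can be cancelled
  afterwards.\<close>

lemma cl_reflect:
  assumes f: "mor f A X" and S: "S \<subseteq> pts A" and z: "z \<in> pts A" "f \<cdot> z \<in> cl X ((\<cdot>) f ` S)"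
  shows "z \<in> cl A S"
  unfolding cl_def
proof (intro IntI InterI z(1))
  fix T assume T: "T \<in> {T \<in> Sub A. S \<subseteq> T}"
  then obtain t where t: "mor t (Dom C t) A" "T = img t" by (metis (mono_tags, lifting) SubE mem_Collect_eq)
  have "(\<cdot>) f ` S \<subseteq> img (f \<cdot> t)" using T t f by (auto simp: img_comp)
  then have "f \<cdot> z \<in> img (f \<cdot> t)" using z(2) cl_least[of "img (f \<cdot> t)" X] t f by auto
  then show "z \<in> T" using t f z(1) by (auto simp: img_comp_iff pts_def)
qed

lemma img_Idn [simp]: "A \<in> Obj C \<Longrightarrow> img (Idn C A) = pts A"
  using img_iso[OF iso_Idn, of A] by simp

section \<open>Pointwise handling of pullbacks, and covers\<close>

lemma pbI:
  assumes [simp]: "f \<in> MM C" "g \<in> MM C" "h \<in> MM C" "k \<in> MM C"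
    "Dom C f = Dom C g" "Cod C f = Dom C h" "Cod C g = Dom C k" "Cod C h = Cod C k"
    and eq: "h \<cdot> f = k \<cdot> g"
    and pt: "\<And>a b. a \<in> MM C \<Longrightarrow> b \<in> MM C \<Longrightarrow> Cod C a = Dom C h \<Longrightarrow> Cod C b = Dom C k \<Longrightarrow>
      h \<cdot> a = k \<cdot> b \<Longrightarrow> a \<in> img f"
  shows "pb f g h k"
proof -
  have "img h \<inter> img k \<subseteq> img (h \<cdot> f)"
  proof
    fix z assume z: "z \<in> img h \<inter> img k"
    obtain a where a: "a \<in> MM C" "Cod C a = Dom C h" "z = h \<cdot> a" using z by blast
    obtain b where b: "b \<in> MM C" "Cod C b = Dom C k" "z = k \<cdot> b" using z by blast
    have "a \<in> img f" using pt a b by simp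
    then show "z \<in> img (h \<cdot> f)" unfolding a(3) using a by (simp add: img_comp_iff)
  qed
  then show ?thesis unfolding pb_def using eq by simp
qed

lemma pb_point:
  assumes p: "pb f g h k" and a: "a \<in> MM C" "Cod C a = Dom C h" and b: "b \<in> MM C" "Cod C b = Dom C k"
    and eq: "h \<cdot> a = k \<cdot> b"
  obtains w where "w \<in> MM C" "Cod C w = Dom C f" "Dom C w = Dom C a" "a = f \<cdot> w" "b = g \<cdot> w"
proof -
  note [simp] = pbD(1-8)[OF p] a b
  have "h \<cdot> a \<in> img h \<inter> img k" unfolding eq[symmetric] using imgI[of a h] imgI[of b k] eq by simp
  then have "h \<cdot> a \<in> img (h \<cdot> f)" using pbD(10)[OF p] by simp
  then have "a \<in> img f" by (simp add: img_comp_iff)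
  then obtain w where w: "w \<in> MM C" "Cod C w = Dom C f" "a = f \<cdot> w" by blast
  have "k \<cdot> (g \<cdot> w) = k \<cdot> b" using w by (simp add: reassoc[OF pbD(9)[OF p], symmetric] eq[symmetric])
  then have "b = g \<cdot> w" using w(1,2) by (simp add: cancel)
  moreover have "Dom C w = Dom C a" using w by simp
  ultimately show ?thesis using that w by blast
qed

lemma pb_flip: "pb f g h k \<Longrightarrow> pb g f k h"
  unfolding pb_def by (auto simp: Int_commute)

lemma pb_iso:
  assumes p: "pb f g h k" and q: "pb f' g' h k"
  obtains u where "iso_arrow C u" "mor u (Dom C f') (Dom C f)" "f \<cdot> u = f'" "g \<cdot> u = g'"
proof -
  note [simp] = pbD(1-8)[OF p] pbD(1-3)[OF q]  pbD(5-8)[OF q]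
  have "img (h \<cdot> f') = img (h \<cdot> f)" using pbD(10)[OF p] pbD(10)[OF q] by simp
  then obtain u where u: "iso_arrow C u" "mor u (Dom C f') (Dom C f)" "(h \<cdot> f) \<cdot> u = h \<cdot> f'"
    by (rule same_img_iso[of "h \<cdot> f'" "Dom C f'" "Cod C h" "h \<cdot> f" "Dom C f", rotated 2]) (blast, simp, simp)
  note [simp] = u(2)
  have "h \<cdot> (f \<cdot> u) = h \<cdot> f'" using u(3) by simp
  moreover from this have "k \<cdot> (g \<cdot> u) = k \<cdot> g'"
    by (simp add: reassoc[OF pbD(9)[OF p], symmetric] pbD(9)[OF q])
  ultimately have "f \<cdot> u = f'" "g \<cdot> u = g'" by (simp_all add: cancel)
  then show ?thesis using that u by blast
qed

text \<open>Bicartesian squares. On squares of \<open>\<M>\<close>-morphisms they are the pushouts, by the van Kampen property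
  in one direction and by effective unions in the other.\<close>

definition bc :: "'b \<Rightarrow> 'b \<Rightarrow> 'b \<Rightarrow> 'b \<Rightarrow> bool" where
  "bc f g h k \<longleftrightarrow> pb f g h k \<and> pts (Cod C h) \<subseteq> cl (Cod C h) (img h \<union> img k)"

lemma bcD:
  assumes "bc f g h k"
  shows "f \<in> MM C" "g \<in> MM C" "h \<in> MM C" "k \<in> MM C"
     "Dom C f = Dom C g" "Cod C f = Dom C h" "Cod C g = Dom C k" "Cod C h = Cod C k"
     "h \<cdot> f = k \<cdot> g" "img h \<inter> img k = img (h \<cdot> f)" "pb f g h k"
     "pts (Cod C h) \<subseteq> cl (Cod C h) (img h \<union> img k)"
  using assms pbD[of f g h k] unfolding bc_def by blast+

lemma bc_flip: "bc f g h k \<Longrightarrow> bc g f k h"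
  unfolding bc_def using pb_flip[of f g h k] pbD(8)[of f g h k] by (auto simp: Un_commute)

lemma cover_img:
  assumes h: "mor h B X" "mor k D X" and c: "pts X \<subseteq> cl X (img h \<union> img k)" and z: "mor z X Y"
  shows "img z \<subseteq> cl Y (img (z \<cdot> h) \<union> img (z \<cdot> k))"
proof -
  note [simp] = h z
  have "img h \<union> img k \<subseteq> pts X" using img_pts[of h] img_pts[of k] by simp
  then have "(\<cdot>) z ` cl X (img h \<union> img k) \<subseteq> cl Y ((\<cdot>) z ` (img h \<union> img k))"
    using cl_image[OF z] by blast
  moreover have "img z \<subseteq> (\<cdot>) z ` cl X (img h \<union> img k)"
    using image_mono[OF c, of "(\<cdot>) z"] by (auto simp: img_def)
  moreover have "(\<cdot>) z ` (img h \<union> img k) = img (z \<cdot> h) \<union> img (z \<cdot> k)" by (simp add: img_comp image_Un)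
  ultimately show ?thesis by simp
qed

text \<open>The form in which distributivity is used from here on: a cover of \<open>W\<close> by
  two pieces restricts to a cover by their traces on \<open>W\<close>.\<close>

lemma cover_Int:
  assumes c: "W \<subseteq> cl X (S \<union> T)" and W: "W \<in> Sub X" and S: "S \<subseteq> pts X" "sieve S" "T \<subseteq> pts X" "sieve T"
  shows "W \<subseteq> cl X ((W \<inter> S) \<union> (W \<inter> T))"
proof -
  have "W \<inter> cl X (S \<union> T) \<subseteq> cl X (W \<inter> (S \<union> T))" using W S by (intro Int_cl sieve_Un) auto
  then show ?thesis using c by (auto simp: Int_Un_distrib)
qed

text \<open>Allows a cover of \<open>X\<close> to be established inside a larger object
  \<open>Y\<close>, where the relevant intersections are known.\<close>

lemma cover_reflect:
  assumes z: "mor z X Y" and h: "mor h B X" and k: "mor k D X"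
    and c: "img z \<subseteq> cl Y (img (z \<cdot> h) \<union> img (z \<cdot> k))"
  shows "pts X \<subseteq> cl X (img h \<union> img k)"
proof
  note [simp] = h k z
  fix x assume x: "x \<in> pts X"
  have S: "img h \<union> img k \<subseteq> pts X" using img_pts[of h] img_pts[of k] by simp
  have "(\<cdot>) z ` (img h \<union> img k) = img (z \<cdot> h) \<union> img (z \<cdot> k)" by (simp add: img_comp image_Un)
  moreover have "z \<cdot> x \<in> img z" using x by (auto simp: img_def)
  ultimately have "z \<cdot> x \<in> cl Y ((\<cdot>) z ` (img h \<union> img k))" using c by auto
  then show "x \<in> cl X (img h \<union> img k)" using cl_reflect[OF z S x] by blast
qed

lemma bc_cover_img: "bc f g h k \<Longrightarrow> mor z (Cod C h) Y \<Longrightarrow> img z \<subseteq> cl Y (img (z \<cdot> h) \<union> img (z \<cdot> k))"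
  using bcD(3,4,8,12)[of f g h k] by (intro cover_img[of h "Dom C h" "Cod C h" k "Dom C k"]) simp_all

lemma bc_cover_Int:
  assumes b: "bc f g h k" and W: "W \<in> Sub (Cod C h)"
  shows "W \<subseteq> cl (Cod C h) ((W \<inter> img h) \<union> (W \<inter> img k))"
proof (rule cover_Int[OF _ W])
  note [simp] = bcD(3,4,8)[OF b]
  show "W \<subseteq> cl (Cod C h) (img h \<union> img k)" using bcD(12)[OF b] Sub_pts[OF W] by blast
  show "img h \<subseteq> pts (Cod C h)" "img k \<subseteq> pts (Cod C h)" using img_pts[of h] img_pts[of k] by simp_all
  show "sieve (img h)" "sieve (img k)" by simp_all
qed

subsection \<open>Pushouts of monic spans\<close>

lemma pushout_sym:
  assumes "pushout C f g h k" shows "pushout C g f k h"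
proof -
  have s: "comm_square C g f x y \<longleftrightarrow> comm_square C f g y x" for x y
    unfolding comm_square_def by (auto simp: eq_commute)
  have c: "Cod C k = Cod C h" using assms by (auto simp: pushout_def comm_square_def)
  have c': "Cod C y = Cod C x" if "comm_square C f g x y" for x y using that by (auto simp: comm_square_def)
  show ?thesis using assms c' unfolding pushout_def s c by (metis (no_types, lifting))
qed

text \<open>The van Kampen property is applied to a cube over the given pushout whose top is the
  trivial pushout of \<open>g\<close> along an identity. Its back faces are pullbacks because
  \<open>f\<close> and the identity are monic, and one of its front faces is the square in
  question.\<close>

lemma pushout_pb:
  assumes P: "pushout C f g h k" and [simp]: "f \<in> MM C" "g \<in> MM C"
  shows "pb f g h k"
proof -
  have k [simp]: "k \<in> MM C" using pushout_MM P by simp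
  have h [simp]: "h \<in> MM C" using pushout_MM[OF pushout_sym[OF P]] by simp
  have [simp]: "Dom C f = Dom C g" "Cod C f = Dom C h" "Cod C g = Dom C k" "Cod C h = Cod C k"
    and eq: "h \<cdot> f = k \<cdot> g" using P by (auto simp: pushout_def comm_square_def)
  let ?i = "Idn C (Dom C g)" and ?j = "Idn C (Dom C k)"
  have 1: "pullback C ?i ?i f f"
    by (rule pb_pullback, rule pbI) (auto simp: cancel)
  have 2: "pullback C g ?i ?j g"
    by (rule pb_pullback, rule pbI) auto
  have 3: "comm_square C ?i g g ?j" by (simp add: comm_square_def)
  have 4: "comm_square C g f k h" "comm_square C ?j ?j k k" using eq by (simp_all add: comm_square_def)
  have 5: "pushout C ?i g g ?j"
    unfolding pushout_def
  proof (intro conjI 3 allI impI)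
    fix h' k' assume s: "comm_square C ?i g h' k'"
    then have [simp]: "k' \<in> Arr C" "Dom C k' = Dom C k" "h' \<in> Arr C" "Dom C h' = Dom C g"
      and c: "Cod C h' = Cod C k'" and e: "h' = k' \<cdot> g"
      by (auto simp: comm_square_def)
    show "\<exists>!u. u \<in> arrows C (Cod C g) (Cod C h') \<and> u \<cdot> g = h' \<and> u \<cdot> ?j = k'"
    proof (rule ex1I[of _ k'])
      show "k' \<in> arrows C (Cod C g) (Cod C h') \<and> k' \<cdot> g = h' \<and> k' \<cdot> ?j = k'"
        unfolding c by (simp add: arrows_def e)
      fix y assume "y \<in> arrows C (Cod C g) (Cod C h') \<and> y \<cdot> g = h' \<and> y \<cdot> ?j = k'"
      then have "y \<in> Arr C" "Dom C y = Dom C k" "y \<cdot> ?j = k'" by (simp_all add: arrows_def)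
      then show "y = k'" by simp
    qed
  qed
  have "M_van_Kampen C f g h k" using pushout_M_van_Kampen[OF P] by simp
  from this[unfolded M_van_Kampen_def, rule_format, of ?i g g ?j ?i f ?j k]
  have "pullback C g f k h" using 1 2 3 4 5 by simp
  then show ?thesis using pullback_pb[of g f k h] pb_flip by simp
qed

text \<open>If a subobject \<open>m\<close> contains both legs, these factor through
  \<open>m\<close> and the pushout induces an arrow \<open>u\<close> back. Joint epicity of the legs
  makes \<open>u\<close> a section of \<open>m\<close>, so \<open>m\<close> is everything.\<close>

lemma pushout_bc:
  assumes P: "pushout C f g h k" and [simp]: "f \<in> MM C" "g \<in> MM C"
  shows "bc f g h k"
proof -
  note p = pushout_pb[OF assms]
  note [simp] = pbD(3-8)[OF p]
  have "pts (Cod C h) \<subseteq> T" if T: "T \<in> Sub (Cod C h)" "img h \<union> img k \<subseteq> T" for T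
  proof -
    obtain m where m: "m \<in> MM C" "Cod C m = Cod C h" "T = img m" using T(1) by (metis SubE)
    note [simp] = m(1,2)
    obtain h1 where h1: "mor h1 (Dom C h) (Dom C m)" "m \<cdot> h1 = h"
      by (rule factor[of h m "Dom C h" "Cod C h" "Dom C m"])
        (use T(2) m(3) img_self[of h] in \<open>simp add: subset_iff\<close>, simp, simp, blast)
    obtain k1 where k1: "mor k1 (Dom C k) (Dom C m)" "m \<cdot> k1 = k"
      by (rule factor[of k m "Dom C k" "Cod C h" "Dom C m"])
        (use T(2) m(3) img_self[of k] in \<open>simp add: subset_iff\<close>, simp, simp, blast)
    note [simp] = h1(1) k1(1)
    have "m \<cdot> (h1 \<cdot> f) = m \<cdot> (k1 \<cdot> g)" by (simp add: reassoc1[OF h1(2)] reassoc1[OF k1(2)] pbD(9)[OF p])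
    then have "comm_square C f g h1 k1" by (simp add: cancel comm_square_def)
    then obtain u where u: "u \<in> arrows C (Cod C h) (Cod C h1)" "u \<cdot> h = h1" "u \<cdot> k = k1"
      using P unfolding pushout_def by blast
    have [simp]: "u \<in> Arr C" "Dom C u = Cod C k" "Cod C u = Dom C m" using u(1) by (simp_all add: arrows_def)
    have "comm_square C f g h k" using P by (simp add: pushout_def)
    then have "\<exists>!u. u \<in> arrows C (Cod C h) (Cod C h) \<and> u \<cdot> h = h \<and> u \<cdot> k = k"
      using P unfolding pushout_def by blast
    moreover have "m \<cdot> u \<in> arrows C (Cod C h) (Cod C h)" "(m \<cdot> u) \<cdot> h = h" "(m \<cdot> u) \<cdot> k = k"
      using u(2,3) h1(2) k1(2) by (simp_all add: arrows_def)
    moreover have "Idn C (Cod C h) \<in> arrows C (Cod C h) (Cod C h)" "Idn C (Cod C h) \<cdot> h = h"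
      "Idn C (Cod C h) \<cdot> k = k" by (simp_all add: arrows_def)
    ultimately have mu: "m \<cdot> u = Idn C (Cod C h)" by blast
    have "u \<in> MM C" using decomp[of m u] mu by simp
    show ?thesis
    proof
      fix x assume "x \<in> pts (Cod C h)"
      then have "m \<cdot> (u \<cdot> x) = x" "u \<cdot> x \<in> MM C" "Cod C (u \<cdot> x) = Dom C m"
        using \<open>u \<in> MM C\<close> by (simp_all add: pts_def reassoc1[OF mu])
      then show "x \<in> T" using imgI[of "u \<cdot> x" m] m(3) by simp
    qed
  qed
  then show ?thesis unfolding bc_def cl_def using p by blast
qed

lemma pushout_postcomp_iso:
  assumes P: "pushout C f g h k" and u: "iso_arrow C u" "Dom C u = Cod C h"
  shows "pushout C f g (u \<cdot> h) (u \<cdot> k)"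
proof -
  have [simp]: "f \<in> Arr C" "g \<in> Arr C" "h \<in> Arr C" "k \<in> Arr C" "Dom C f = Dom C g" "Cod C f = Dom C h"
    "Cod C g = Dom C k" "Cod C h = Cod C k" and eq: "h \<cdot> f = k \<cdot> g"
    using P by (auto simp: pushout_def comm_square_def)
  obtain v where v: "mor v (Cod C u) (Dom C u)" "v \<cdot> u = Idn C (Dom C u)" "u \<cdot> v = Idn C (Cod C u)"
    using iso_inverse u by blast
  note [simp] = v(1) u(2) iso_MM[OF u(1)]
  have sq: "comm_square C f g (u \<cdot> h) (u \<cdot> k)" using eq by (simp add: comm_square_def)
  show ?thesis unfolding pushout_def
  proof (intro conjI allI impI sq)
    fix h' k' assume s: "comm_square C f g h' k'"
    then have un: "\<exists>!w. w \<in> arrows C (Cod C h) (Cod C h') \<and> w \<cdot> h = h' \<and> w \<cdot> k = k'"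
      using P unfolding pushout_def by blast
    then obtain w where w: "w \<in> arrows C (Cod C h) (Cod C h')" "w \<cdot> h = h'" "w \<cdot> k = k'" by blast
    have [simp]: "w \<in> Arr C" "Dom C w = Cod C k" "Cod C w = Cod C h'" using w(1) by (simp_all add: arrows_def)
    show "\<exists>!w. w \<in> arrows C (Cod C (u \<cdot> h)) (Cod C h') \<and> w \<cdot> (u \<cdot> h) = h' \<and> w \<cdot> (u \<cdot> k) = k'"
    proof (rule ex1I[of _ "w \<cdot> v"], intro conjI)
      show "w \<cdot> v \<in> arrows C (Cod C (u \<cdot> h)) (Cod C h')" by (simp add: arrows_def)
      show "w \<cdot> v \<cdot> (u \<cdot> h) = h'" "w \<cdot> v \<cdot> (u \<cdot> k) = k'"
        by (simp_all add: reassoc1[OF v(2)] w(2,3))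
      fix y assume y: "y \<in> arrows C (Cod C (u \<cdot> h)) (Cod C h') \<and> y \<cdot> (u \<cdot> h) = h' \<and> y \<cdot> (u \<cdot> k) = k'"
      have [simp]: "y \<in> Arr C" "Dom C y = Cod C u" "Cod C y = Cod C h'" using y by (simp_all add: arrows_def)
      have "y \<cdot> u \<in> arrows C (Cod C h) (Cod C h')" "y \<cdot> u \<cdot> h = h'" "y \<cdot> u \<cdot> k = k'"
        using conjunct2[OF y] by (simp_all add: arrows_def)
      then have yu: "y \<cdot> u = w" using un w by blast
      show "y = w \<cdot> v" unfolding yu[symmetric] using v(3) by simp
    qed
  qed
qed

text \<open>A pushout of the span is compared with the given square. The comparison is monic by
  effective unions, and its image contains both legs, hence everything.\<close>

lemma bc_pushout:
  assumes b: "bc f g h k" shows "pushout C f g h k"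
proof -
  note [simp] = bcD(1-8)[OF b]
  obtain p q where P: "pushout C f g p q" using ex_pushout[of f g] by auto
  note pb = pushout_bc[OF P bcD(1,2)[OF b]]
  note [simp] = bcD(3,4)[OF pb] bcD(6,7,8)[OF pb, symmetric]
  have "comm_square C f g h k" using bcD(9)[OF b] by (simp add: comm_square_def)
  then obtain u where u: "u \<in> arrows C (Cod C p) (Cod C h)" "u \<cdot> p = h" "u \<cdot> q = k"
    using P unfolding pushout_def by blast
  have um: "u \<in> MM C"
    using M_effective_unions[OF bcD(1,2)[OF b] P bcD(3,4)[OF b] pb_pullback[OF bcD(11)[OF b]] u] .
  have [simp]: "u \<in> MM C" "Dom C u = Cod C p" "Cod C u = Cod C k" using u(1) um by (simp_all add: arrows_def)
  have "img h \<subseteq> img u" "img k \<subseteq> img u"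
    using img_comp_sub[of p u] img_comp_sub[of q u] by (simp_all add: u(2,3))
  then have "cl (Cod C h) (img h \<union> img k) \<subseteq> img u" by (intro cl_least) simp_all
  then have "pts (Cod C h) \<subseteq> img u" using bcD(12)[OF b] by blast
  moreover have "Idn C (Cod C u) \<in> pts (Cod C h)" by simp
  ultimately have "Idn C (Cod C u) \<in> img u" by blast
  then have "iso_arrow C u" by (rule iso_of_Idn_img[OF um])
  from pushout_postcomp_iso[OF P this] show ?thesis using u(2,3) by simp
qed

lemma bc_ex:
  assumes "mor f A B" "mor g A D"
  obtains X h k where "bc f g h k" "mor h B X" "mor k D X"
proof -
  note [simp] = assms
  obtain h k where "pushout C f g h k" using ex_pushout[of f g] by auto
  then have b: "bc f g h k" by (rule pushout_bc) simp_all
  note [simp] = bcD(3)[OF b] bcD(4)[OF b] bcD(6)[OF b, symmetric] bcD(7)[OF b, symmetric] bcD(8)[OF b]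
  have "mor h B (Cod C k)" "mor k D (Cod C k)" by simp_all
  then show ?thesis using that b by blast
qed

text \<open>Ordinary pushouts only give some arrow \<open>u\<close>. The extra intersection
  hypothesis makes the target square a pullback, and effective unions then make \<open>u\<close>
  monic, so the construction stays among subobjects.\<close>

lemma bc_univ:
  assumes b: "bc f g h k" and h': "mor h' (Dom C h) Y" and k': "mor k' (Dom C k) Y"
    and eq: "h' \<cdot> f = k' \<cdot> g" and sub: "img h' \<inter> img k' \<subseteq> img (h' \<cdot> f)"
  obtains u where "mor u (Cod C h) Y" "u \<cdot> h = h'" "u \<cdot> k = k'"
proof -
  note [simp] = bcD(1-8)[OF b] h' k'
  have pb: "pb f g h' k'" unfolding pb_def using eq sub by simp
  have "comm_square C f g h' k'" using eq by (simp add: comm_square_def)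
  then obtain u where u: "u \<in> arrows C (Cod C h) (Cod C h')" "u \<cdot> h = h'" "u \<cdot> k = k'"
    using bc_pushout[OF b] unfolding pushout_def by blast
  have "u \<in> MM C"
    using M_effective_unions[OF bcD(1,2)[OF b] bc_pushout[OF b] pbD(3,4)[OF pb] pb_pullback[OF pb] u] .
  then have "mor u (Cod C h) Y" using u(1) by (simp add: arrows_def)
  then show ?thesis using that u by blast
qed

lemma bc_joint:
  assumes b: "bc f g h k" and s: "s \<in> Arr C" "Dom C s = Cod C h" and t: "t \<in> Arr C" "Dom C t = Cod C h"
    and e: "s \<cdot> h = t \<cdot> h" "s \<cdot> k = t \<cdot> k"
  shows "s = t"
proof -
  note [simp] = bcD(1-8)[OF b] s(1) t(1)
  have [simp]: "Dom C s = Cod C k" "Dom C t = Cod C k" using s(2) t(2) by simp_all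
  have c: "Cod C s = Cod C t" using arg_cong[OF e(1), of "Cod C"] by simp
  have "comm_square C f g (t \<cdot> h) (t \<cdot> k)" using bcD(9)[OF b] by (simp add: comm_square_def)
  then have "\<exists>!u. u \<in> arrows C (Cod C h) (Cod C (t \<cdot> h)) \<and> u \<cdot> h = t \<cdot> h \<and> u \<cdot> k = t \<cdot> k"
    using bc_pushout[OF b] unfolding pushout_def by blast
  moreover have "s \<in> arrows C (Cod C h) (Cod C (t \<cdot> h))" "t \<in> arrows C (Cod C h) (Cod C (t \<cdot> h))"
    using c by (simp_all add: arrows_def)
  ultimately show ?thesis using e by blast
qed

lemma bc_postcomp_iso: "bc f g h k \<Longrightarrow> iso_arrow C u \<Longrightarrow> Dom C u = Cod C h \<Longrightarrow> bc f g (u \<cdot> h) (u \<cdot> k)"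
  by (rule pushout_bc[OF pushout_postcomp_iso[OF bc_pushout]]) (auto dest: bcD)

lemma bc_unique:
  assumes "bc f g h k" "bc f g h' k'"
  obtains u where "iso_arrow C u" "mor u (Cod C h) (Cod C h')" "u \<cdot> h = h'" "u \<cdot> k = k'"
proof -
  note b = assms(1) and b' = assms(2)
  have d: "Dom C h' = Dom C h" "Dom C k' = Dom C k"
    by (simp_all add: bcD(6,7)[OF b', symmetric] bcD(6,7)[OF b])
  have t: "mor h' (Dom C h) (Cod C h')" "mor k' (Dom C k) (Cod C h')" "mor h (Dom C h') (Cod C h)"
      "mor k (Dom C k') (Cod C h)"
    by (simp_all add: bcD(3,4)[OF b] bcD(3,4)[OF b'] bcD(8)[OF b, symmetric] bcD(8)[OF b', symmetric] d)
  obtain u where u: "mor u (Cod C h) (Cod C h')" "u \<cdot> h = h'" "u \<cdot> k = k'"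
    by (rule bc_univ[OF b t(1,2) bcD(9)[OF b'] equalityD1[OF bcD(10)[OF b']]]) blast
  obtain v where v: "mor v (Cod C h') (Cod C h)" "v \<cdot> h' = h" "v \<cdot> k' = k"
    by (rule bc_univ[OF b' t(3,4) bcD(9)[OF b] equalityD1[OF bcD(10)[OF b]]]) blast
  note [simp] = u(1) v(1) d bcD(3,4)[OF b] bcD(3,4)[OF b'] bcD(8)[OF b, symmetric] bcD(8)[OF b', symmetric]
  have "v \<cdot> u = Idn C (Cod C h)"
    by (rule bc_joint[OF b]) (simp_all add: u(2,3) v(2,3))
  moreover have "u \<cdot> v = Idn C (Cod C h')"
    by (rule bc_joint[OF b']) (simp_all add: u(2,3) v(2,3))
  ultimately have "iso_arrow C u" by (intro isoI[of u v]) simp_all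
  then show ?thesis using that u by blast
qed

section \<open>Pasting, splitting and restricting squares\<close>

lemma bc_paste:
  assumes b: "bc f g h k" and b': "bc x h y z"
  shows "bc (x \<cdot> f) g y (z \<cdot> k)"
proof -
  note [simp] = bcD(1-4)[OF b] bcD(5)[OF b, symmetric] bcD(6,7)[OF b] bcD(8)[OF b, symmetric]
    bcD(1,3,4)[OF b'] bcD(5,6)[OF b'] bcD(7,8)[OF b', symmetric]
  have "pb (x \<cdot> f) g y (z \<cdot> k)"
  proof (rule pbI)
    show "y \<cdot> (x \<cdot> f) = z \<cdot> k \<cdot> g"
      by (simp add: reassoc[OF bcD(9)[OF b']] bcD(9)[OF b])
    fix a c assume ac: "a \<in> MM C" "c \<in> MM C" "Cod C a = Dom C y" "Cod C c = Dom C (z \<cdot> k)" "y \<cdot> a = (z \<cdot>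
        k) \<cdot> c"
    note [simp] = ac(1,2,3) ac(4)[simplified]
    obtain w where w: "w \<in> MM C" "Cod C w = Dom C x" "a = x \<cdot> w" "k \<cdot> c = h \<cdot> w"
      by (rule pb_point[OF bcD(11)[OF b'], of a "k \<cdot> c"]) (use ac(5) in simp_all)
    note [simp] = w(1) w(2)[simplified]
    obtain v where v: "v \<in> MM C" "Cod C v = Dom C f" "w = f \<cdot> v"
      by (rule pb_point[OF bcD(11)[OF b], of w c]) (use w(4) in simp_all)
    have "a = (x \<cdot> f) \<cdot> v" using v by (simp add: w(3))
    then show "a \<in> img (x \<cdot> f)" using imgI[of v "x \<cdot> f"] v(1,2) by simp
  qed simp_all
  moreover have "pts (Cod C y) \<subseteq> cl (Cod C y) (img y \<union> img (z \<cdot> k))"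
  proof -
    have "img z \<subseteq> cl (Cod C y) (img (z \<cdot> h) \<union> img (z \<cdot> k))" by (rule bc_cover_img[OF b]) simp
    also have "\<dots> \<subseteq> cl (Cod C y) (img y \<union> img (z \<cdot> k))"
      using img_comp_sub[of x y] by (intro cl_mono) (auto simp: bcD(9)[OF b'] simp del: img_comp)
    finally have z: "img z \<subseteq> cl (Cod C y) (img y \<union> img (z \<cdot> k))" .
    have "img y \<union> img (z \<cdot> k) \<subseteq> pts (Cod C y)" using img_pts[of y] img_pts[of "z \<cdot> k"] by simp
    from cl_sup[OF this] z have "img y \<union> img z \<subseteq> cl (Cod C y) (img y \<union> img (z \<cdot> k))" by blast
    from cl_trans[OF this] show ?thesis using bcD(12)[OF b'] by blast
  qed
  ultimately show ?thesis unfolding bc_def by blast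
qed

text \<open>The arrow \<open>z\<close> is the union of \<open>y \<cdot> x\<close> and
  \<open>s\<close>. By distributivity \<open>y\<close> meets it in the union of
  \<open>y \<cdot> x\<close> with the intersection of \<open>y\<close> and \<open>s\<close>, and the
  latter is already contained in \<open>y \<cdot> x\<close>.\<close>

lemma bc_split:
  assumes b: "bc f g h k" and b': "bc (x \<cdot> f) g y s" and x: "x \<in> MM C" "Dom C x = Cod C f"
  obtains z where "mor z (Cod C h) (Cod C y)" "z \<cdot> k = s" "z \<cdot> h = y \<cdot> x" "bc x h y z"
proof -
  note [simp] = bcD(1-4)[OF b] bcD(5)[OF b, symmetric] bcD(6,7)[OF b] bcD(8)[OF b, symmetric] x(1)
      x(2)[unfolded bcD(6)[OF b]]
    bcD(3,4)[OF b']
  have [simp]: "Dom C y = Cod C x" using bcD(6)[OF b'] by simp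
  have [simp]: "Dom C s = Dom C k" using bcD(7)[OF b'] by simp
  have [simp]: "Cod C s = Cod C y" using bcD(8)[OF b'] by simp
  obtain z where z: "mor z (Cod C h) (Cod C y)" "z \<cdot> h = y \<cdot> x" "z \<cdot> k = s"
  proof (rule bc_univ[OF b])
    show "mor (y \<cdot> x) (Dom C h) (Cod C y)" "mor s (Dom C k) (Cod C y)" by simp_all
    show "y \<cdot> x \<cdot> f = s \<cdot> g" using bcD(9)[OF b'] by simp
    show "img (y \<cdot> x) \<inter> img s \<subseteq> img (y \<cdot> x \<cdot> f)"
      using bcD(10)[OF b'] img_comp_sub[of x y] by auto
  qed blast
  note [simp] = z(1)
  have ys: "img y \<inter> img s \<subseteq> img (y \<cdot> x)"
    using bcD(10)[OF b'] img_comp_sub[of f "y \<cdot> x"] by simp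
  have "img z \<subseteq> cl (Cod C y) (img (y \<cdot> x) \<union> img s)"
    using bc_cover_img[OF b z(1)] unfolding z(2,3) .
  then have "img y \<inter> img z \<subseteq> img y \<inter> cl (Cod C y) (img (y \<cdot> x) \<union> img s)" by blast
  also have "\<dots> \<subseteq> cl (Cod C y) (img y \<inter> (img (y \<cdot> x) \<union> img s))"
    using img_pts[of "y \<cdot> x"] img_pts[of s] by (intro Int_cl sieve_Un) simp_all
  also have "\<dots> \<subseteq> img (y \<cdot> x)"
    using ys by (intro cl_least) auto
  finally have "pb x h y z" unfolding pb_def using z(2) by simp
  moreover have "pts (Cod C y) \<subseteq> cl (Cod C y) (img y \<union> img z)"
  proof -
    have "img s \<subseteq> img z" using img_comp_sub[of k z] z(3) by simp
    then show ?thesis using bcD(12)[OF b'] cl_mono[of "img y \<union> img s" "img y \<union> img z"] by blast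
  qed
  ultimately have "bc x h y z" unfolding bc_def by blast
  then show ?thesis using that z by blast
qed

text \<open>Any \<open>U\<close> is covered by its traces on \<open>h\<close> and \<open>k\<close>.
  If the trace on \<open>h\<close> lies in the diagonal, both lie in \<open>k\<close>. Pushout
  complements thereby inherit uniqueness and restriction from final pullback complements.\<close>

lemma bc_fp:
  assumes b: "bc f g h k" shows "fp f h g k"
proof (rule fpI)
  note [simp] = bcD(1-8)[OF b]
  show "f \<in> MM C" "g \<in> MM C" "h \<in> MM C" "k \<in> MM C" "Dom C f = Dom C g" "Cod C f = Dom C h"
    "Cod C g = Dom C k" "Cod C h = Cod C k" by simp_all
  show eq: "h \<cdot> f = k \<cdot> g" by (rule bcD[OF b])
  show "img k \<inter> img h \<subseteq> img (h \<cdot> f)" using bcD(10)[OF b] by blast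
  fix U assume U: "U \<in> Sub (Cod C h)" "U \<inter> img h \<subseteq> img (h \<cdot> f)"
  have "img (h \<cdot> f) \<subseteq> img k" unfolding eq by (rule img_comp_sub) simp_all
  then have *: "(U \<inter> img h) \<union> (U \<inter> img k) \<subseteq> img k" using U(2) by blast
  have "U \<subseteq> cl (Cod C h) ((U \<inter> img h) \<union> (U \<inter> img k))" by (rule bc_cover_Int[OF b U(1)])
  also have "\<dots> \<subseteq> img k"
    by (rule cl_least[OF _ *]) simp
  finally show "U \<subseteq> img k" .
qed

text \<open>Relative pseudocomplements restrict to a subobject \<open>j\<close> that contains
  \<open>c\<close>: over the smaller object the complement is the intersection of \<open>d\<close>
  with \<open>j\<close>. Both inclusions come from the adjunction, applied once in each
  object.\<close>

lemma fp_restrict: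
  assumes F: "fp a c' b d" and F': "fp a c b' d'" and j: "mor j (Cod C c) (Cod C c')" and c': "c' = j \<cdot> c"
  obtains t where "mor t (Dom C d') (Dom C d)" "d \<cdot> t = j \<cdot> d'" "t \<cdot> b' = b" "pb d' t j d"
proof -
  note [simp] = fpD(1-4)[OF F'] fpD(5)[OF F', symmetric] fpD(6,7)[OF F'] fpD(8)[OF F', symmetric]
    j fpD(2-4)[OF F] fpD(5)[OF F, symmetric] fpD(7)[OF F] fpD(8)[OF F, symmetric]
  have [simp]: "Dom C c' = Dom C c" by (simp add: c')
  have "img (j \<cdot> d') \<subseteq> img d"
  proof (subst fp_iff[OF F, symmetric])
    show "img (j \<cdot> d') \<inter> img c' \<subseteq> img (c' \<cdot> a)"
    proof
      fix z assume z: "z \<in> img (j \<cdot> d') \<inter> img c'"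
      obtain u where u: "u \<in> MM C" "Cod C u = Dom C d'" "z = j \<cdot> (d' \<cdot> u)" using z by auto
      obtain v where v: "v \<in> MM C" "Cod C v = Dom C c" "z = j \<cdot> (c \<cdot> v)" using z by (auto simp: c')
      have "d' \<cdot> u = c \<cdot> v" using u v by (simp add: cancel)
      then have "d' \<cdot> u \<in> img d' \<inter> img c" using u(1,2) v(1,2) imgI[of u d'] imgI[of v c] by simp
      then have "d' \<cdot> u \<in> img (c \<cdot> a)" using fpD(10)[OF F'] by simp
      then have "z \<in> img (j \<cdot> (c \<cdot> a))" unfolding u(3) using u(1,2) by (simp add: img_comp_iff)
      then show "z \<in> img (c' \<cdot> a)" by (simp add: c')
    qed
  qed simp
  then have "j \<cdot> d' \<in> img d" by (simp add: img_subset_iff)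
  then obtain t where t: "mor t (Dom C d') (Dom C d)" "d \<cdot> t = j \<cdot> d'"
    by (rule factor[of "j \<cdot> d'" d "Dom C d'" "Cod C c'" "Dom C d"]) (simp, simp, blast)
  note [simp] = t(1)
  have "d \<cdot> (t \<cdot> b') = d \<cdot> b"
    using fpD(9)[OF F'] fpD(9)[OF F] by (simp add: reassoc[OF t(2)] c')
  then have tb: "t \<cdot> b' = b" by (simp add: cancel)
  have "pb d' t j d"
  proof (rule pbI)
    show "j \<cdot> d' = d \<cdot> t" using t(2) by simp
    fix x y assume x: "x \<in> MM C" "y \<in> MM C" "Cod C x = Dom C j" "Cod C y = Dom C d" "j \<cdot> x = d \<cdot> y"
    note [simp] = x(1,2) x(3)[simplified] x(4)
    have "img x \<subseteq> img d'"
    proof (subst fp_iff[OF F', symmetric])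
      show "img x \<inter> img c \<subseteq> img (c \<cdot> a)"
      proof
        fix z assume z: "z \<in> img x \<inter> img c"
        obtain u where u: "u \<in> MM C" "Cod C u = Dom C x" "z = x \<cdot> u" using z by auto
        obtain v where v: "v \<in> MM C" "Cod C v = Dom C c" "z = c \<cdot> v" using z by auto
        have "d \<cdot> (y \<cdot> u) = c' \<cdot> v"
          using u v by (simp add: reassoc[OF x(5), symmetric] c')
        then have "c' \<cdot> v \<in> img d \<inter> img c'" using u(1,2) v(1,2) imgI[of "y \<cdot> u" d] imgI[of v c'] 
          arg_cong[OF x(5), of "Dom C"] by simp
        then have "c' \<cdot> v \<in> img (c' \<cdot> a)" using fpD(10)[OF F] by simp
        then have "j \<cdot> (c \<cdot> v) \<in> img (j \<cdot> (c \<cdot> a))" using v(1,2) by (simp add: c')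
        then show "z \<in> img (c \<cdot> a)" unfolding v(3) using v(1,2) by (simp add: img_comp_iff)
      qed
    qed simp
    then show "x \<in> img d'" by (simp add: img_subset_iff)
  qed simp_all
  then show ?thesis using that t tb by blast
qed

text \<open>For \<open>U\<close> in the big object, the part inside \<open>c'\<close> is tested
  against the first complement and lands in \<open>d\<close>; then the second complement applies to
  \<open>U\<close> itself.\<close>

lemma fp_paste:
  assumes F: "fp a c b d" and F': "fp d c' b' d'"
  shows "fp a (c' \<cdot> c) (b' \<cdot> b) d'"
proof -
  note [simp] = fpD(1-4)[OF F] fpD(5)[OF F, symmetric] fpD(6,7)[OF F] fpD(8)[OF F, symmetric]
    fpD(2-4)[OF F'] fpD(5)[OF F', symmetric] fpD(7)[OF F'] fpD(8)[OF F', symmetric]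
    trans[OF fpD(6)[OF F', symmetric] fpD(8)[OF F, symmetric]]
  show ?thesis
  proof (rule fpI)
    show eq: "(c' \<cdot> c) \<cdot> a = d' \<cdot> (b' \<cdot> b)"
      by (simp add: fpD(9)[OF F] reassoc[OF fpD(9)[OF F', symmetric]])
    show "img d' \<inter> img (c' \<cdot> c) \<subseteq> img (c' \<cdot> c \<cdot> a)"
    proof
      fix z assume z: "z \<in> img d' \<inter> img (c' \<cdot> c)"
      obtain v where v: "v \<in> MM C" "Cod C v = Dom C c" "z = c' \<cdot> (c \<cdot> v)" using z by auto
      have "z \<in> img d' \<inter> img c'" using z img_comp_sub[of c c'] by auto
      then have "c' \<cdot> (c \<cdot> v) \<in> img (c' \<cdot> d)" using fpD(10)[OF F'] v by simp
      then have "c \<cdot> v \<in> img d \<inter> img c" using v(1,2) imgI[of v c] by (simp add: img_comp_iff)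
      then have "c \<cdot> v \<in> img (c \<cdot> a)" using fpD(10)[OF F] by simp
      then show "z \<in> img (c' \<cdot> c \<cdot> a)" unfolding v(3) using v(1,2) by (simp add: img_comp_iff)
    qed
    fix U assume U: "U \<in> Sub (Cod C (c' \<cdot> c))" "U \<inter> img (c' \<cdot> c) \<subseteq> img (c' \<cdot> c \<cdot> a)"
    have U1 [simp]: "U \<in> Sub (Cod C c')" using U(1) by simp
    obtain u where u: "u \<in> MM C" "Cod C u = Cod C c'" "U = img u" using U1 by (metis SubE)
    obtain P x y where xy: "pb x y c' u" "mor x P (Cod C c)" "mor y P (Dom C u)"
      by (rule pb_ex[of c' "Cod C c" "Cod C c'" u "Dom C u"]) (use u(1,2) in \<open>simp, simp, blast\<close>)
    note [simp] = xy(2,3)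
    have "img x \<subseteq> img d"
    proof (subst fp_iff[OF F, symmetric])
      show "img x \<inter> img c \<subseteq> img (c \<cdot> a)"
      proof
        fix z assume z: "z \<in> img x \<inter> img c"
        obtain t where t: "t \<in> MM C" "Cod C t = Dom C x" "z = x \<cdot> t" using z by blast
        obtain v where v: "v \<in> MM C" "Cod C v = Dom C c" "z = c \<cdot> v" using z by blast
        have "c' \<cdot> z \<in> img (c' \<cdot> x)" using t by (simp add: img_comp_iff imgI)
        then have "c' \<cdot> z \<in> U" using pbD(10)[OF xy(1)] u(3) by blast
        moreover have "c' \<cdot> z \<in> img (c' \<cdot> c)" using v by (simp add: img_comp_iff imgI)
        ultimately have "c' \<cdot> z \<in> img (c' \<cdot> (c \<cdot> a))" using U(2) by auto
        then show "z \<in> img (c \<cdot> a)" using v(1,2) unfolding v(3) by (simp add: img_comp_iff)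
      qed
    qed simp
    then have xd: "img (c' \<cdot> x) \<subseteq> img (c' \<cdot> d)"
      using image_mono[of "img x" "img d" "(\<cdot>) c'"] by (simp add: img_comp)
    show "U \<subseteq> img d'"
    proof (subst fp_iff[OF F' U1, symmetric])
      show "U \<inter> img c' \<subseteq> img (c' \<cdot> d)" using xd pbD(10)[OF xy(1)] u(3) by blast
    qed
  qed simp_all
qed

lemma fp_same:
  assumes F: "fp a c b d" and d2: "mor d2 D2 (Cod C c)" and i: "img d2 = img d"
  obtains b2 where "mor b2 (Dom C a) D2" "fp a c b2 d2"
proof -
  note [simp] = fpD(1-4)[OF F] fpD(5)[OF F, symmetric] fpD(6,7)[OF F] fpD(8)[OF F, symmetric] d2
  have "c \<cdot> a \<in> img d2" unfolding i fpD(9)[OF F] by (simp add: imgI)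
  then obtain b2 where b2: "mor b2 (Dom C a) D2" "d2 \<cdot> b2 = c \<cdot> a"
    by (rule factor[of "c \<cdot> a" d2 "Dom C a" "Cod C c" D2]) (simp, simp, blast)
  note [simp] = b2(1)
  have "fp a c b2 d2"
    by (rule fpI) (use fpD(10)[OF F] fp_iff[OF F] b2(2) in \<open>simp_all add: i\<close>)
  then show ?thesis using that b2 by blast
qed

lemma fp_image_unique: "fp a c b d \<Longrightarrow> fp a c b' d' \<Longrightarrow> img d' = img d"
  using fp_iff[of a c b d "img d'"] fp_iff[of a c b' d' "img d"] fpD[of a c b d] fpD[of a c b' d']
  by (metis img_Sub Int_commute set_eq_subset)

text \<open>A pushout complement at a match survives in every smaller object through which the match
  factors: intersect the old complement with that object, and distributivity preserves the cover.
  This supplies most of the existence claims for pushout complements below.\<close>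

lemma bc_restrict:
  assumes b: "bc f g h k" and h: "h = j \<cdot> n" and j: "mor j (Cod C n) (Cod C h)" and n: "mor n (Dom C h) N"
    and p: "pb d a j k"
  obtains g' where "mor g' (Dom C f) (Dom C d)" "a \<cdot> g' = g" "bc f g' n d"
proof -
  note [simp] = bcD(1-4)[OF b] bcD(5)[OF b, symmetric] bcD(6,7)[OF b] bcD(8)[OF b, symmetric]
    j n pbD(1,2)[OF p] pbD(5)[OF p, symmetric] pbD(7)[OF p]
  have [simp]: "Cod C d = N" using pbD(6)[OF p] by simp
  have e: "j \<cdot> (n \<cdot> f) = k \<cdot> g" by (simp add: reassoc1[OF h[symmetric]] bcD(9)[OF b])
  obtain g' where g': "g' \<in> MM C" "Cod C g' = Dom C d" "Dom C g' = Dom C (n \<cdot> f)" "n \<cdot> f = d \<cdot> g'" "g = a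
      \<cdot> g'"
    by (rule pb_point[OF p, of "n \<cdot> f" g]) (simp, simp, simp, simp, simp add: e, blast)
  have [simp]: "Dom C g' = Dom C f" using g'(3) by simp
  note [simp] = g'(1,2)
  have "pb f g' n d"
  proof (rule pbI)
    show "n \<cdot> f = d \<cdot> g'" by (rule g')
    fix x y assume x: "x \<in> MM C" "y \<in> MM C" "Cod C x = Dom C n" "Cod C y = Dom C d" "n \<cdot> x = d \<cdot> y"
    note [simp] = x(1,2) x(3)[simplified] x(4)
    have "j \<cdot> (n \<cdot> x) = k \<cdot> (a \<cdot> y)"
      by (simp add: x(5) reassoc[OF pbD(9)[OF p]])
    then have "h \<cdot> x = k \<cdot> (a \<cdot> y)" by (simp add: reassoc1[OF h[symmetric]])
    then obtain w where "w \<in> MM C" "Cod C w = Dom C f" "x = f \<cdot> w"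
      by (rule pb_point[OF bcD(11)[OF b], of x "a \<cdot> y", rotated 4]) (blast, simp_all)
    then show "x \<in> img f" by blast
  qed simp_all
  moreover have "pts (Cod C n) \<subseteq> cl (Cod C n) (img n \<union> img d)"
  proof (rule cover_reflect)
    show "mor j (Cod C n) (Cod C h)" "mor n (Dom C h) (Cod C n)" "mor d (Dom C d) (Cod C n)" by simp_all
    have "img j \<subseteq> cl (Cod C h) ((img j \<inter> img h) \<union> (img j \<inter> img k))"
      by (rule bc_cover_Int[OF b]) simp
    also have "\<dots> \<subseteq> cl (Cod C h) (img (j \<cdot> n) \<union> img (j \<cdot> d))"
      using pbD(10)[OF p] unfolding h by (intro cl_mono) blast
    finally show "img j \<subseteq> cl (Cod C h) (img (j \<cdot> n) \<union> img (j \<cdot> d))" .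
  qed
  ultimately have "bc f g' n d" unfolding bc_def by blast
  then show ?thesis using that[of g'] g'(5) by simp
qed

text \<open>Companion of the preceding lemma when the smaller complement is already given; as a
  final pullback complement it must be the intersection.\<close>

lemma poc_restrict:
  assumes b: "bc f g h k" and h: "h = j \<cdot> n" and j: "mor j (Cod C n) (Cod C h)" and b': "bc f g' n d"
  obtains a where "mor a (Dom C d) (Dom C k)" "k \<cdot> a = j \<cdot> d" "a \<cdot> g' = g" "pb d a j k"
  by (rule fp_restrict[OF bc_fp[OF b] bc_fp[OF b'] j h]) (rule that)

subsection \<open>Direct derivations\<close>

text \<open>\<open>n\<close> is a comatch of the sesqui-pushout derivation with rule \<open>(ro, ri)\<close> at the match \<open>p\<close>.\<close>

definition deriv :: "'b \<Rightarrow> 'b \<Rightarrow> 'b \<Rightarrow> 'b \<Rightarrow> bool" where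
  "deriv ro ri p n \<longleftrightarrow> (\<exists>k d q. fp ri p k d \<and> bc ro k n q)"

lemma deriv_ex:
  assumes "mor ro K L" "mor ri K I" "mor p I X"
  obtains Y n where "mor n L Y" "deriv ro ri p n"
proof -
  obtain D k d where F: "fp ri p k d" "mor k K D" by (rule fp_ex[OF assms(2,3)]) blast
  obtain Y n q where "bc ro k n q" "mor n L Y" by (rule bc_ex[OF assms(1) F(2)]) blast
  then show ?thesis using that F(1) unfolding deriv_def by blast
qed

lemma deriv_types:
  assumes "deriv ro ri p n"
  shows "p \<in> MM C" "n \<in> MM C" "Dom C n = Cod C ro" "Dom C p = Cod C ri"
  using assms fpD(3,6) bcD(3,6) unfolding deriv_def by metis+

text \<open>\<open>(ro', ri')\<close> is the result of applying \<open>(ro, ri)\<close> at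
  \<open>y\<close> with context \<open>k\<close>. Pasting shows that every further derivation by the
  result is one by the original rule.\<close>

lemma deriv_comp:
  assumes b: "bc ro k x ro'" and b': "fp ri y k ri'" and D: "deriv ro' ri' p n"
  shows "deriv ro ri (p \<cdot> y) (n \<cdot> x)"
proof -
  obtain kk d q where F: "fp ri' p kk d" and B: "bc ro' kk n q" using D unfolding deriv_def by blast
  have "fp ri (p \<cdot> y) (kk \<cdot> k) d" by (rule fp_paste[OF b' F])
  moreover have "bc ro (kk \<cdot> k) (n \<cdot> x) q"
    using bc_flip[OF bc_paste[OF bc_flip[OF b] bc_flip[OF B]]] .
  ultimately show ?thesis unfolding deriv_def by blast
qed

lemma derivE:
  assumes D: "deriv ro ri p n" and t: "mor ro K L" "mor p I X" "mor n L Y"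
  obtains E k d q where "mor k K E" "mor d E X" "mor q E Y" "fp ri p k d" "bc ro k n q"
proof -
  obtain k d q where F: "fp ri p k d" and B: "bc ro k n q" using D unfolding deriv_def by blast
  have "mor k K (Dom C d)" using bcD(2,5)[OF B] fpD(7)[OF F] t(1) by simp
  moreover have "d \<in> MM C" "Cod C d = X" using fpD(4,8)[OF F] t(2) by simp_all
  moreover have "q \<in> MM C" "Cod C q = Y" "Dom C q = Dom C d" using bcD(4,7,8)[OF B] fpD(7)[OF F] t(3) by
      simp_all
  ultimately show ?thesis using that[of k "Dom C d" d q] F B by blast
qed

text \<open>Two consecutive derivations amount to one derivation by the composite span. Its context
  is the intersection \<open>E\<close> of the two contexts in the intermediate object
  \<open>Y1\<close>.\<close>

lemma deriv_seq:
  assumes D1: "deriv e1 g1 p n" and D2: "deriv q2 d2 n n2" and P: "pb b1 z e1 d2"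
    and t [simp]: "mor e1 K1 X1" "mor g1 K1 X0" "mor p X0 Y0" "mor n X1 Y1" "mor d2 K2 X1" "mor q2 K2 X2"
      "mor n2 X2 Y2" "mor b1 Z K1" "mor z Z K2"
  shows "deriv (q2 \<cdot> z) (g1 \<cdot> b1) p n2"
proof -
  obtain E1 k1 c1 w1 where t1: "mor k1 K1 E1" "mor c1 E1 Y0" "mor w1 E1 Y1" and F1: "fp g1 p k1 c1" and
      B1: "bc e1 k1 n w1"
    by (rule derivE[OF D1 t(1,3,4)])
  obtain E2 k2 c2 w2 where t2: "mor k2 K2 E2" "mor c2 E2 Y1" "mor w2 E2 Y2" and F2: "fp d2 n k2 c2" and
      B2: "bc q2 k2 n2 w2"
    by (rule derivE[OF D2 t(6,4,7)])
  note [simp] = t1 t2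
  obtain E s1 s2 where S: "pb s1 s2 w1 c2" and ts: "mor s1 E E1" "mor s2 E E2"
    by (rule pb_ex[OF t1(3) t2(2)])
  note [simp] = ts
  note e1 = bcD(9)[OF B1] and f1 = fpD(9)[OF F1] and f2 = fpD(9)[OF F2] and e2 = bcD(9)[OF B2]
    and pe = pbD(9)[OF P] and se = pbD(9)[OF S]
  have "w1 \<cdot> (k1 \<cdot> b1) = c2 \<cdot> (k2 \<cdot> z)"
    by (simp add: reassoc[OF e1[symmetric]] reassoc[OF f2[symmetric]] pe)
  then obtain g where g: "g \<in> MM C" "Cod C g = Dom C s1" "Dom C g = Dom C (k1 \<cdot> b1)" "k1 \<cdot> b1 = s1 \<cdot> g"
      "k2 \<cdot> z = s2 \<cdot> g"
    by (rule pb_point[OF S, of "k1 \<cdot> b1" "k2 \<cdot> z", rotated 4]) (blast, simp_all)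
  have [simp]: "g \<in> MM C" "Cod C g = E" "Dom C g = Z" using g(1-3) by simp_all
  \<comment> \<open>This is the first derivation's pushout intersected with the second context
    \<open>E2\<close>; composing it with the second pushout gives the right half of the
    derivation.\<close>
  have B: "bc z g k2 s2" unfolding bc_def
  proof
    show "pb z g k2 s2"
    proof (rule pbI)
      show "k2 \<cdot> z = s2 \<cdot> g" by (rule g(5))
      fix a b assume ab: "a \<in> MM C" "b \<in> MM C" "Cod C a = Dom C k2" "Cod C b = Dom C s2" "k2 \<cdot> a = s2 \<cdot> b"
      note [simp] = ab(1,2) ab(3,4)[simplified]
      have "n \<cdot> (d2 \<cdot> a) = w1 \<cdot> (s1 \<cdot> b)"
        by (simp add: reassoc[OF f2] ab(5) reassoc[OF se])
      then obtain v where v: "v \<in> MM C" "Cod C v = Dom C e1" "d2 \<cdot> a = e1 \<cdot> v"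
        by (rule pb_point[OF bcD(11)[OF B1], of "d2 \<cdot> a" "s1 \<cdot> b", rotated 4]) (blast, simp_all)
      obtain w where w: "w \<in> MM C" "Cod C w = Dom C b1" "v = b1 \<cdot> w" "a = z \<cdot> w"
        by (rule pb_point[OF P, of v a]) (use v in simp_all)
      then show "a \<in> img z" by (auto simp: imgI)
    qed simp_all
    have "pts E2 \<subseteq> cl E2 (img k2 \<union> img s2)"
    proof (rule cover_reflect[OF t2(2,1) ts(2)])
      have "img c2 \<subseteq> cl Y1 ((img c2 \<inter> img n) \<union> (img c2 \<inter> img w1))"
        using bc_cover_Int[OF B1, of "img c2"] by simp
      also have "\<dots> \<subseteq> cl Y1 (img (c2 \<cdot> k2) \<union> img (c2 \<cdot> s2))"
        using fpD(10)[OF F2] pbD(10)[OF S] unfolding f2 se by (intro cl_mono) blast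
      finally show "img c2 \<subseteq> cl Y1 (img (c2 \<cdot> k2) \<union> img (c2 \<cdot> s2))" .
    qed
    then show "pts (Cod C k2) \<subseteq> cl (Cod C k2) (img k2 \<union> img s2)" by simp
  qed
  have "bc (q2 \<cdot> z) g n2 (w2 \<cdot> s2)" by (rule bc_paste[OF B B2])
  moreover have "fp (g1 \<cdot> b1) p g (c1 \<cdot> s1)"
  proof (rule fpI)
    show eq: "p \<cdot> (g1 \<cdot> b1) = c1 \<cdot> s1 \<cdot> g"
      by (simp add: reassoc[OF f1] g(4))
    show "img (c1 \<cdot> s1) \<inter> img p \<subseteq> img (p \<cdot> (g1 \<cdot> b1))"
    proof
      fix x assume x: "x \<in> img (c1 \<cdot> s1) \<inter> img p"
      obtain t where t: "t \<in> MM C" "Cod C t = E" "x = c1 \<cdot> (s1 \<cdot> t)" using x by auto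
      note [simp] = t(1,2)
      have "x \<in> img c1 \<inter> img p" using x img_comp_sub[of s1 c1] by auto
      then have "x \<in> img (p \<cdot> g1)" using fpD(10)[OF F1] by blast
      then obtain r where r: "r \<in> MM C" "Cod C r = K1" "x = p \<cdot> (g1 \<cdot> r)" by auto
      note [simp] = r(1,2)
      have "c1 \<cdot> (s1 \<cdot> t) = c1 \<cdot> (k1 \<cdot> r)" using r(3) t(3) by (simp add: reassoc[OF f1])
      then have "s1 \<cdot> t = k1 \<cdot> r" by (simp add: cancel)
      then have "c2 \<cdot> (s2 \<cdot> t) = n \<cdot> (e1 \<cdot> r)"
        by (simp add: reassoc[OF se[symmetric]] reassoc[OF e1])
      then have "n \<cdot> (e1 \<cdot> r) \<in> img c2 \<inter> img n" using imgI[of "s2 \<cdot> t" c2] imgI[of "e1 \<cdot> r" n] by simp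
      then have "n \<cdot> (e1 \<cdot> r) \<in> img (n \<cdot> d2)" using fpD(10)[OF F2] by blast
      then have "e1 \<cdot> r \<in> img d2" by (simp add: img_comp_iff)
      then obtain r' where r': "r' \<in> MM C" "Cod C r' = K2" "e1 \<cdot> r = d2 \<cdot> r'" by auto
      obtain w where w: "w \<in> MM C" "Cod C w = Dom C b1" "r = b1 \<cdot> w"
        by (rule pb_point[OF P, of r r']) (use r' in simp_all)
      have "x = (p \<cdot> (g1 \<cdot> b1)) \<cdot> w" using w(1,2) unfolding r(3) w(3) by simp
      then show "x \<in> img (p \<cdot> (g1 \<cdot> b1))" using imgI[of w "p \<cdot> (g1 \<cdot> b1)"] w by simp
    qed
    fix U assume U: "U \<in> Sub (Cod C p)" "U \<inter> img p \<subseteq> img (p \<cdot> (g1 \<cdot> b1))"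
    \<comment> \<open>Finality is used twice: the first complement puts \<open>U\<close> inside
      \<open>E1\<close>, which carries it to \<open>Y1\<close>; there the second complement puts it
      inside \<open>E2\<close>, hence inside \<open>E\<close>.\<close>
    have "img (p \<cdot> (g1 \<cdot> b1)) \<subseteq> img (p \<cdot> g1)" using img_comp_sub[of b1 "p \<cdot> g1"] by simp
    then have "U \<subseteq> img c1" using fp_iff[OF F1 U(1)] U(2) by blast
    moreover obtain u where u: "u \<in> MM C" "Cod C u = Cod C p" "U = img u" using U(1) by (metis SubE)
    ultimately have "u \<in> img c1" by (simp add: img_subset_iff)
    then obtain v where v: "mor v (Dom C u) E1" "c1 \<cdot> v = u"
      by (rule factor[of u c1 "Dom C u" Y0 E1]) (use u(1,2) in \<open>simp, simp, blast\<close>)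
    note [simp] = v(1)
    have "img (w1 \<cdot> v) \<subseteq> img c2"
    proof (subst fp_iff[OF F2, symmetric])
      show "img (w1 \<cdot> v) \<inter> img n \<subseteq> img (n \<cdot> d2)"
      proof
        fix x assume x: "x \<in> img (w1 \<cdot> v) \<inter> img n"
        obtain a where a: "a \<in> MM C" "Cod C a = Dom C u" "x = w1 \<cdot> (v \<cdot> a)" using x by auto
        note [simp] = a(1,2)
        obtain b where b: "b \<in> MM C" "Cod C b = X1" "x = n \<cdot> b" using x by auto
        note [simp] = b(1,2)
        obtain t where t: "t \<in> MM C" "Cod C t = Dom C e1" "b = e1 \<cdot> t" "v \<cdot> a = k1 \<cdot> t"
          by (rule pb_point[OF bcD(11)[OF B1], of b "v \<cdot> a"]) (use a(3) b(3) in simp_all)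
        have [simp]: "t \<in> MM C" "Cod C t = K1" using t by simp_all
        have "c1 \<cdot> (v \<cdot> a) = p \<cdot> (g1 \<cdot> t)" by (simp add: t(4) reassoc[OF f1])
        moreover have "c1 \<cdot> (v \<cdot> a) = u \<cdot> a" using v(2) u(1,2) by (simp add: reassoc1[OF v(2)])
        ultimately have "p \<cdot> (g1 \<cdot> t) \<in> U \<inter> img p"
          using imgI[of a u] imgI[of "g1 \<cdot> t" p] by (simp add: u(3))
        then have "p \<cdot> (g1 \<cdot> t) \<in> img (p \<cdot> (g1 \<cdot> b1))" using U(2) by blast
        then have "t \<in> img b1" by (simp add: img_comp_iff)
        then obtain w where w: "w \<in> MM C" "Cod C w = Z" "t = b1 \<cdot> w" by auto
        have "x = (n \<cdot> d2) \<cdot> (z \<cdot> w)" using w(1,2) unfolding b(3) t(3) w(3)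
          by (simp add: reassoc[OF pe])
        then show "x \<in> img (n \<cdot> d2)" using imgI[of "z \<cdot> w" "n \<cdot> d2"] w(1,2) by simp
      qed
    qed simp
    then have "w1 \<cdot> v \<in> img c2" by (simp add: img_subset_iff)
    then have "w1 \<cdot> v \<in> img w1 \<inter> img c2" by (simp add: imgI)
    then have "w1 \<cdot> v \<in> img (w1 \<cdot> s1)" using pbD(10)[OF S] by blast
    then have "v \<in> img s1" by (simp add: img_comp_iff)
    then have "u \<in> img (c1 \<cdot> s1)" unfolding v(2)[symmetric] by (simp add: img_comp_iff)
    then show "U \<subseteq> img (c1 \<cdot> s1)" unfolding u(3) using u(1) by (simp add: img_subset_iff)
  qed simp_all
  ultimately show ?thesis unfolding deriv_def by blast
qed

subsection \<open>Isomorphism classes of spans and cospans\<close>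

lemma iso_comp:
  assumes "iso_arrow C u" "iso_arrow C v" "Cod C u = Dom C v" shows "iso_arrow C (v \<cdot> u)"
proof -
  obtain u' where u: "mor u' (Cod C u) (Dom C u)" "u' \<cdot> u = Idn C (Dom C u)" "u \<cdot> u' = Idn C (Cod C u)"
    using iso_inverse assms(1) by blast
  obtain v' where v: "mor v' (Cod C v) (Dom C v)" "v' \<cdot> v = Idn C (Dom C v)" "v \<cdot> v' = Idn C (Cod C v)"
    using iso_inverse assms(2) by blast
  note [simp] = u(1) v(1) iso_MM[OF assms(1)] iso_MM[OF assms(2)] assms(3)
  show ?thesis
    by (rule isoI[of _ "u' \<cdot> v'"])
      (simp_all add: reassoc1[OF v(2)] reassoc1[OF u(3)[unfolded assms(3)]] u(2) v(3))
qed

lemma cospan_iso_iff: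
  "cospan_iso C (f, g) (f', g') \<longleftrightarrow> f' \<in> Arr C \<and> g' \<in> Arr C \<and> Cod C f' = Cod C g' \<and>
     (\<exists>u. iso_arrow C u \<and> u \<in> arrows C (Cod C f) (Cod C f') \<and> u \<cdot> f = f' \<and> u \<cdot> g = g')"
  by (simp add: cospan_iso_def)

lemma span_iso_iff:
  "span_iso C (f, g) (f', g') \<longleftrightarrow> f' \<in> Arr C \<and> g' \<in> Arr C \<and> Dom C f' = Dom C g' \<and>
     (\<exists>u. iso_arrow C u \<and> u \<in> arrows C (Dom C f) (Dom C f') \<and> f' \<cdot> u = f \<and> g' \<cdot> u = g)"
  by (simp add: span_iso_def)

lemma cospan_iso_sym:
  assumes "cospan_iso C (f, g) (f', g')" "f \<in> Arr C" "g \<in> Arr C" "Cod C f = Cod C g"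
  shows "cospan_iso C (f', g') (f, g)"
proof -
  obtain u where u: "iso_arrow C u" "u \<in> arrows C (Cod C f) (Cod C f')" "u \<cdot> f = f'" "u \<cdot> g = g'"
    using assms(1) unfolding cospan_iso_iff by blast
  obtain v where v: "iso_arrow C v" "mor v (Cod C u) (Dom C u)" "v \<cdot> u = Idn C (Dom C u)"
    using iso_inverse u(1) by blast
  have d: "Dom C u = Cod C f" "Cod C u = Cod C f'" "u \<in> Arr C" using u(2) by (simp_all add: arrows_def)
  have "v \<cdot> (u \<cdot> f) = f" "v \<cdot> (u \<cdot> g) = g"
    using v(2) d(1,3) assms(2-4) by (simp_all add: reassoc1[OF v(3)])
  then have "v \<cdot> f' = f" "v \<cdot> g' = g" unfolding u(3,4) .
  moreover have "v \<in> arrows C (Cod C f') (Cod C f)" using v(2) d by (simp add: arrows_def)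
  ultimately show ?thesis using v(1) assms(2-4) unfolding cospan_iso_iff by blast
qed

lemma cospan_iso_trans:
  assumes "cospan_iso C (f, g) (f', g')" "cospan_iso C (f', g') (f'', g'')" "f \<in> Arr C" "g \<in> Arr C" "Cod
      C f = Cod C g"
  shows "cospan_iso C (f, g) (f'', g'')"
proof -
  obtain u where u: "iso_arrow C u" "u \<in> arrows C (Cod C f) (Cod C f')" "u \<cdot> f = f'" "u \<cdot> g = g'"
    using assms(1) unfolding cospan_iso_iff by blast
  obtain v where v: "iso_arrow C v" "v \<in> arrows C (Cod C f') (Cod C f'')" "v \<cdot> f' = f''" "v \<cdot> g' = g''"
    and t: "f'' \<in> Arr C" "g'' \<in> Arr C" "Cod C f'' = Cod C g''"
    using assms(2) unfolding cospan_iso_iff by blast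
  have d: "Dom C u = Cod C f" "Cod C u = Cod C f'" "u \<in> Arr C" "Dom C v = Cod C f'" "Cod C v = Cod C f''"
      "v \<in> Arr C"
    using u(2) v(2) by (simp_all add: arrows_def)
  have "iso_arrow C (v \<cdot> u)" using u v d by (simp add: iso_comp)
  moreover have "v \<cdot> u \<in> arrows C (Cod C f) (Cod C f'')" using d by (simp add: arrows_def)
  moreover have "v \<cdot> u \<cdot> f = f''" "v \<cdot> u \<cdot> g = g''"
    using d assms(3-5) u(3,4) v(3,4) by simp_all
  ultimately show ?thesis using t unfolding cospan_iso_iff by blast
qed

text \<open>Isomorphic cospans have the same isomorphism predicate, so choice returns the same
  member for both. The chosen member is therefore its own representative.\<close>

lemma cospan_rep_ex:
  assumes rs [simp]: "r \<in> Arr C" "s \<in> Arr C" and c: "Cod C r = Cod C s"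
  obtains u where "iso_arrow C u" "Dom C u = Cod C r" "cospan_rep C (u \<cdot> r, u \<cdot> s)"
proof -
  have "cospan_iso C (r, s) (r, s)"
    unfolding cospan_iso_iff using c iso_Idn[of "Cod C r"]
    by (auto simp: arrows_def intro!: exI[of _ "Idn C (Cod C s)"])
  then have R: "cospan_iso C (r, s) (SOME x. cospan_iso C (r, s) x)" by (rule someI)
  obtain r' s' where e: "(SOME x. cospan_iso C (r, s) x) = (r', s')" by fastforce
  note R = R[unfolded e]
  have t: "r' \<in> Arr C" "s' \<in> Arr C" "Cod C r' = Cod C s'" using R unfolding cospan_iso_iff by blast+
  have "cospan_iso C (r', s') = cospan_iso C (r, s)"
    using cospan_iso_trans[OF R] cospan_iso_trans[OF cospan_iso_sym[OF R]] rs c t by fastforce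
  then have rep: "cospan_rep C (r', s')" unfolding cospan_rep_def using e by simp
  obtain u where "iso_arrow C u" "u \<in> arrows C (Cod C r) (Cod C r')" "u \<cdot> r = r'" "u \<cdot> s = s'"
    using R unfolding cospan_iso_iff by blast
  then show ?thesis using that[of u] rep by (simp add: arrows_def)
qed

lemma span_iso_sym:
  assumes "span_iso C (f, g) (f', g')" "f \<in> Arr C" "g \<in> Arr C" "Dom C f = Dom C g"
  shows "span_iso C (f', g') (f, g)"
proof -
  obtain u where u: "iso_arrow C u" "u \<in> arrows C (Dom C f) (Dom C f')" "f' \<cdot> u = f" "g' \<cdot> u = g"
    and t: "f' \<in> Arr C" "g' \<in> Arr C" "Dom C f' = Dom C g'"
    using assms(1) unfolding span_iso_iff by blast
  obtain v where v: "iso_arrow C v" "mor v (Cod C u) (Dom C u)" "u \<cdot> v = Idn C (Cod C u)"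
    using iso_inverse u(1) by blast
  have d: "Dom C u = Dom C f" "Cod C u = Dom C f'" "u \<in> Arr C" using u(2) by (simp_all add: arrows_def)
  have "(f' \<cdot> u) \<cdot> v = f'" "(g' \<cdot> u) \<cdot> v = g'"
    using v(2) d(2,3) t by (simp_all add: v(3))
  then have "f \<cdot> v = f'" "g \<cdot> v = g'" unfolding u(3,4) .
  moreover have "v \<in> arrows C (Dom C f') (Dom C f)" using v(2) d by (simp add: arrows_def)
  ultimately show ?thesis using v(1) assms(2-4) unfolding span_iso_iff by blast
qed

lemma span_iso_trans:
  assumes "span_iso C (f, g) (f', g')" "span_iso C (f', g') (f'', g'')" "f \<in> Arr C" "g \<in> Arr C" "Dom C f
      = Dom C g"
  shows "span_iso C (f, g) (f'', g'')"
proof -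
  obtain u where u: "iso_arrow C u" "u \<in> arrows C (Dom C f) (Dom C f')" "f' \<cdot> u = f" "g' \<cdot> u = g"
    using assms(1) unfolding span_iso_iff by blast
  obtain v where v: "iso_arrow C v" "v \<in> arrows C (Dom C f') (Dom C f'')" "f'' \<cdot> v = f'" "g'' \<cdot> v = g'"
    and t: "f'' \<in> Arr C" "g'' \<in> Arr C" "Dom C f'' = Dom C g''"
    using assms(2) unfolding span_iso_iff by blast
  have d: "Dom C u = Dom C f" "Cod C u = Dom C f'" "u \<in> Arr C" "Dom C v = Dom C f'" "Cod C v = Dom C f''"
      "v \<in> Arr C"
    using u(2) v(2) by (simp_all add: arrows_def)
  have "iso_arrow C (v \<cdot> u)" using u v d by (simp add: iso_comp)
  moreover have "v \<cdot> u \<in> arrows C (Dom C f) (Dom C f'')" using d by (simp add: arrows_def)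
  moreover have "f'' \<cdot> (v \<cdot> u) = f" "g'' \<cdot> (v \<cdot> u) = g"
    using d t by (simp_all add: reassoc1[OF v(3)] reassoc1[OF v(4)] u(3,4))
  ultimately show ?thesis using t unfolding span_iso_iff by blast
qed

lemma span_iso_eq:
  assumes R: "span_iso C (f, g) (f', g')" and t: "f \<in> Arr C" "g \<in> Arr C" "Dom C f = Dom C g"
  shows "span_iso C (f', g') = span_iso C (f, g)"
proof -
  have t': "f' \<in> Arr C" "g' \<in> Arr C" "Dom C f' = Dom C g'" using R unfolding span_iso_iff by blast+
  show ?thesis
    using span_iso_trans[OF R] span_iso_trans[OF span_iso_sym[OF R]] t t' by fastforce
qed

lemma span_rep_unique:
  assumes "span_iso C (f, g) (f', g')" "f \<in> Arr C" "g \<in> Arr C" "Dom C f = Dom C g"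
    "span_rep C (f, g)" "span_rep C (f', g')"
  shows "(f, g) = (f', g')"
  using span_iso_eq[OF assms(1-4)] assms(5,6) unfolding span_rep_def by simp

lemma span_rep_ex:
  assumes rs [simp]: "r \<in> Arr C" "s \<in> Arr C" and c: "Dom C r = Dom C s"
  obtains u where "iso_arrow C u" "Cod C u = Dom C r" "span_rep C (r \<cdot> u, s \<cdot> u)"
proof -
  have "span_iso C (r, s) (r, s)"
    unfolding span_iso_iff using c iso_Idn[of "Dom C r"]
    by (auto simp: arrows_def intro!: exI[of _ "Idn C (Dom C s)"])
  then have R: "span_iso C (r, s) (SOME x. span_iso C (r, s) x)" by (rule someI)
  obtain r' s' where e: "(SOME x. span_iso C (r, s) x) = (r', s')" by fastforce
  note R = R[unfolded e]
  have "span_iso C (r', s') = span_iso C (r, s)" using span_iso_eq[OF R] c by simp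
  then have rep: "span_rep C (r', s')" unfolding span_rep_def using e by simp
  obtain u where "iso_arrow C u" "u \<in> arrows C (Dom C r') (Dom C r)" "r \<cdot> u = r'" "s \<cdot> u = s'"
    using span_iso_sym[OF R rs c] unfolding span_iso_iff by blast
  then show ?thesis using that[of u] rep by (simp add: arrows_def)
qed

subsection \<open>Semantics of conditions\<close>

lemma shift_cospansD:
  assumes "(r, s) \<in> shift_cospans C p a" "mor p P Q" "mor a P A"
  obtains E where "mor r Q E" "mor s A E" "r \<cdot> p = s \<cdot> a"
proof -
  obtain p'' a'' x where t: "p'' \<in> MM C" "a'' \<in> MM C" and po: "pushout C p'' a'' r s"
    and x: "x \<in> MM C" "Dom C x = Dom C p" "Cod C x = Dom C p''" "p'' \<cdot> x = p" "a'' \<cdot> x = a"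
    using assms(1) unfolding shift_cospans_def by blast
  note b = pushout_bc[OF po t]
  note [simp] = t x(1,3) bcD(3,4)[OF b] bcD(5)[OF b, symmetric] bcD(6,7)[OF b] bcD(8)[OF b, symmetric]
  have "Cod C p'' = Q" "Cod C a'' = A" using arg_cong[OF x(4), of "Cod C"] arg_cong[OF x(5), of "Cod C"]
      assms(2,3) by simp_all
  then have "mor r Q (Cod C r)" "mor s A (Cod C r)" by simp_all
  moreover have "r \<cdot> p = s \<cdot> a" unfolding x(4)[symmetric] x(5)[symmetric] by (simp add: reassoc[OF
      bcD(9)[OF b]])
  ultimately show ?thesis using that by blast
qed

lemma Obj_mor: "mor f A B \<Longrightarrow> A \<in> Obj C \<and> B \<in> Obj C"
  by (metis Obj_DomCod monoD)

lemma cond_over_cshift: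
  "cond_over C c P \<Longrightarrow> mor p P Q \<Longrightarrow> cond_over C (cshift C p c) Q"
proof (induction c arbitrary: p P Q)
  case CTrue then show ?case using Obj_mor[of p P Q] by simp
next
  case (CEx a c)
  have "cond_over C (CEx r (cshift C s c)) Q" if rs: "(r, s) \<in> shift_cospans C p a" for r s
  proof -
    obtain E where "mor r Q E" "mor s (Cod C a) E"
      by (rule shift_cospansD[OF rs CEx.prems(2), of "Cod C a"]) (use CEx.prems(1) in auto)
    then show ?thesis using CEx.IH[of "Cod C a" s E] CEx.prems(1) by simp
  qed
  then show ?case using Obj_mor[OF CEx.prems(2)] by (auto simp: CDisj_def)
next
  case (CConj J F) then show ?case using Obj_mor[OF CConj.prems(2)] by auto
qed auto

lemma sat_CDisj: "sat C (CDisj J F) t \<longleftrightarrow> (\<exists>j\<in>J. sat C (F j) t)"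
  by (simp add: CDisj_def)

lemma sat_CEx_cshift:
  "sat C (cshift C p (CEx a c)) t \<longleftrightarrow>
    (\<exists>r s. (r, s) \<in> shift_cospans C p a \<and> (\<exists>q\<in>MM C. Dom C q = Cod C r \<and> q \<cdot> r = t \<and> sat C (cshift C s c) q))"
proof -
  have *: "(\<exists>j\<in>{f r s |r s. P r s}. Q j) \<longleftrightarrow> (\<exists>r s. P r s \<and> Q (f r s))" for f P Q
    by blast
  show ?thesis unfolding cshift.simps sat_CDisj * cond_index.case sat.simps ..
qed

text \<open>A disjunct records how \<open>Q\<close> and \<open>A\<close> overlap inside a given
  target. Conversely the overlap is read off from \<open>t\<close> and \<open>q\<close> by a
  pullback, and effective unions make the arrow out of its pushout monic, as satisfaction
  demands.\<close>

lemma sat_cshift: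
  "cond_over C c P \<Longrightarrow> mor p P Q \<Longrightarrow> mor t Q Y \<Longrightarrow> sat C (cshift C p c) t \<longleftrightarrow> sat C c (t \<cdot> p)"
proof (induction c arbitrary: p P Q t)
  case (CEx a c)
  note [simp] = CEx.prems(2,3)
  have a [simp]: "a \<in> MM C" "Dom C a = P" and c: "cond_over C c (Cod C a)" using CEx.prems(1) by auto
  show ?case
  proof
    assume "sat C (cshift C p (CEx a c)) t"
    then obtain r s q where rs: "(r, s) \<in> shift_cospans C p a" and q: "q \<in> MM C" "Dom C q = Cod C r" "q \<cdot>
        r = t"
      and S: "sat C (cshift C s c) q" unfolding sat_CEx_cshift by blast
    obtain E where E: "mor r Q E" "mor s (Cod C a) E" "r \<cdot> p = s \<cdot> a"
      by (rule shift_cospansD[OF rs CEx.prems(2), of "Cod C a"]) (simp, blast)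
    have "Dom C q = E" using q(2) E(1) by simp
    moreover from this have "Cod C q = Y" using arg_cong[OF q(3), of "Cod C"] q(1) E(1) by simp
    ultimately have qY: "mor q E Y" using q(1) by simp
    have "sat C c (q \<cdot> s)" using CEx.IH[OF c E(2) qY] S by simp
    moreover have "(q \<cdot> s) \<cdot> a = t \<cdot> p"
      using qY E(1,2) by (simp add: E(3)[symmetric] reassoc1[OF q(3)])
    ultimately show "sat C (CEx a c) (t \<cdot> p)"
      using qY E(1,2) by (auto intro!: bexI[of _ "q \<cdot> s"])
  next
    assume "sat C (CEx a c) (t \<cdot> p)"
    then obtain q where q: "q \<in> MM C" "Dom C q = Cod C a" "q \<cdot> a = t \<cdot> p" and S: "sat C c q" by auto
    note [simp] = q(1,2)
    have [simp]: "Cod C q = Y" using arg_cong[OF q(3), of "Cod C"] by simp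
    \<comment> \<open>The overlap of \<open>Q\<close> and the target of \<open>a\<close> inside
      \<open>Y\<close>. It contains \<open>P\<close> because
      \<open>q \<cdot> a = t \<cdot> p\<close>, which provides the \<open>x\<close> required by the
      definition.\<close>
    obtain X0 p'' a'' where pb: "pb p'' a'' t q" and tt: "mor p'' X0 Q" "mor a'' X0 (Cod C a)"
      by (rule pb_ex[of t Q Y q "Cod C a"]) (simp, simp, blast)
    obtain x where x: "x \<in> MM C" "Cod C x = Dom C p''" "Dom C x = Dom C p" "p = p'' \<cdot> x" "a = a'' \<cdot> x"
      by (rule pb_point[OF pb, of p a, rotated 4]) (simp add: q(3), blast, simp_all)
    obtain E r s where b: "bc p'' a'' r s" and rs: "mor r Q E" "mor s (Cod C a) E"
      by (rule bc_ex[OF tt])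
    obtain w where w: "mor w E Y" "w \<cdot> r = t" "w \<cdot> s = q"
      by (rule bc_univ[OF b _ _ pbD(9)[OF pb] equalityD1[OF pbD(10)[OF pb]], of Y]) (use rs in \<open>simp,
          simp, simp\<close>)
    note [simp] = w(1) rs
    \<comment> \<open>The disjunction lists representatives only, so the apex is moved along
      \<open>u\<close> and the witness becomes \<open>w \<cdot> v\<close>.\<close>
    obtain u where u: "iso_arrow C u" "Dom C u = Cod C r" "cospan_rep C (u \<cdot> r, u \<cdot> s)"
      by (rule cospan_rep_ex[of r s]) (simp, simp, simp, blast)
    obtain v where v: "mor v (Cod C u) (Dom C u)" "v \<cdot> u = Idn C (Dom C u)"
      using iso_inverse u(1) by blast
    have [simp]: "u \<in> MM C" "Dom C u = E" "mor v (Cod C u) E" using u(1,2) v(1) by (simp_all add: iso_MM)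
    have "pushout C p'' a'' (u \<cdot> r) (u \<cdot> s)" by (rule pushout_postcomp_iso[OF bc_pushout[OF b] u(1,2)])
    then have "(u \<cdot> r, u \<cdot> s) \<in> shift_cospans C p a"
      unfolding shift_cospans_def mem_Collect_eq prod.case
      using u(3) tt x(1-3) x(4,5)[symmetric] by blast
    moreover have vu: "v \<cdot> u = Idn C E" using v(2) by simp
    moreover have "(w \<cdot> v) \<cdot> (u \<cdot> r) = t" "(w \<cdot> v) \<cdot> (u \<cdot> s) = q"
      by (simp_all add: reassoc1[OF vu] w(2,3))
    moreover have "sat C (cshift C (u \<cdot> s) c) (w \<cdot> v) \<longleftrightarrow> sat C c ((w \<cdot> v) \<cdot> (u \<cdot> s))"
      by (rule CEx.IH[OF c, of _ "Cod C u"]) simp_all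
    moreover have "w \<cdot> v \<in> MM C" "Dom C (w \<cdot> v) = Cod C (u \<cdot> r)" by simp_all
    ultimately show "sat C (cshift C p (CEx a c)) t" unfolding sat_CEx_cshift using S by metis
  qed
qed auto

section \<open>Chosen constructions and transport of conditions\<close>

lemma poc_bc:
  assumes P: "pushout C f g h k" and [simp]: "f \<in> MM C" "h \<in> MM C"
  shows "bc f g h k"
proof -
  have k [simp]: "k \<in> MM C" using pushout_MM P by simp
  have [simp]: "g \<in> Arr C" "Dom C f = Dom C g" "Cod C f = Dom C h" "Cod C g = Dom C k" "Cod C h = Cod C k"
    and eq: "h \<cdot> f = k \<cdot> g" using P unfolding pushout_def comm_square_def by blast+
  have "k \<cdot> g \<in> MM C" unfolding eq[symmetric] by simp
  then have "g \<in> MM C" by (rule decomp) simp_all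
  then show ?thesis using pushout_bc[OF P] by simp
qed

lemma the_pushout_bc:
  assumes "f \<in> MM C" "g \<in> MM C" "Dom C f = Dom C g" "the_pushout C f g = (h, k)"
  shows "bc f g h k"
proof -
  have "\<exists>x. (\<lambda>(h, k). pushout C f g h k) x" using ex_pushout[of f g] assms by auto
  from someI_ex[OF this] have "pushout C f g h k" using assms(4) unfolding the_pushout_def by simp
  then show ?thesis using pushout_bc assms by blast
qed

lemma the_pullback_pb:
  assumes "h \<in> MM C" "k \<in> MM C" "Cod C h = Cod C k" "the_pullback C h k = (f, g)"
  shows "pb f g h k"
proof -
  have "\<exists>x. (\<lambda>(f, g). pullback C f g h k) x" using ex_pullback[of h k] assms by auto
  from someI_ex[OF this] have "pullback C f g h k" using assms(4) unfolding the_pullback_def by simp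
  then show ?thesis using pullback_pb assms by blast
qed

lemma the_FPC_fp:
  assumes "a \<in> MM C" "c \<in> MM C" "Cod C a = Dom C c" "the_FPC C a c = (b, d)"
  shows "fp a c b d"
proof -
  have "\<exists>x. (\<lambda>(b, d). final_pullback_complement C a c b d) x" using ex_FPC[of a c] assms by auto
  from someI_ex[OF this] have "final_pullback_complement C a c b d" using assms(4) unfolding the_FPC_def
      by simp
  then show ?thesis using FPC_fp assms by blast
qed

lemma the_poc_bc:
  assumes "f \<in> MM C" "h \<in> MM C" "\<exists>g k. pushout_complement C f h g k" "the_pushout_complement C f h = (g, k)"
  shows "bc f g h k"
proof -
  have "\<exists>x. (\<lambda>(g, k). pushout_complement C f h g k) x" using assms(3) by auto
  from someI_ex[OF this] have "pushout C f g h k"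
    using assms(4) unfolding the_pushout_complement_def pushout_complement_def by simp
  then show ?thesis using poc_bc assms by blast
qed

text \<open>Turns the existence side condition in \<open>ctrans\<close> and
  \<open>sq_matches\<close> into one about squares of monos.\<close>

lemma poc_iff:
  "f \<in> MM C \<Longrightarrow> h \<in> MM C \<Longrightarrow> (\<exists>g k. pushout_complement C f h g k) \<longleftrightarrow> (\<exists>g k. bc f g h k)"
  unfolding pushout_complement_def using poc_bc bc_pushout by blast

lemma bc_mor:
  assumes b: "bc f g h k" and t: "mor f A B" "mor h B X"
  shows "mor g A (Dom C k)" "mor k (Dom C k) X"
proof -
  show "mor g A (Dom C k)" using bcD(2)[OF b] bcD(5)[OF b, symmetric] bcD(7)[OF b] t(1) by simp
  show "mor k (Dom C k) X" using bcD(4)[OF b] bcD(8)[OF b, symmetric] t(2) by simp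
qed

lemma bc_mor':
  assumes b: "bc f g h k" and t: "mor f A B" "mor g A D"
  shows "mor h B (Cod C h)" "mor k D (Cod C h)"
proof -
  show "mor h B (Cod C h)" using bcD(3)[OF b] bcD(6)[OF b, symmetric] t(1) by simp
  show "mor k D (Cod C h)" using bcD(4)[OF b] bcD(7)[OF b, symmetric] bcD(8)[OF b, symmetric] t(2) by simp
qed

lemma ctrans_CEx:
  assumes t: "mor ro K L" "mor ri K I" "mor a L L'" and ex: "\<exists>g k. bc ro g a k"
  obtains k ro' a' ri' K' I' where "bc ro k a ro'" "bc ri k a' ri'" "mor k K K'" "mor ro' K' L'"
    "mor a' I I'" "mor ri' K' I'" "ctrans C (ro, ri) (CEx a c) = CEx a' (ctrans C (ro', ri') c)"
proof -
  note [simp] = t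
  have ex': "\<exists>k ro'. pushout_complement C ro a k ro'" using ex poc_iff[of ro a] by simp
  obtain k ro' where kr: "the_pushout_complement C ro a = (k, ro')" by fastforce
  have b: "bc ro k a ro'" by (rule the_poc_bc[OF _ _ ex' kr]) simp_all
  note t1 = bc_mor[OF b t(1,3)]
  obtain a' ri' where ar: "the_pushout C ri k = (a', ri')" by fastforce
  have b': "bc ri k a' ri'" by (rule the_pushout_bc[OF _ _ _ ar]) (simp_all add: t1(1))
  note t2 = bc_mor'[OF b' t(2) t1(1)]
  have "ctrans C (ro, ri) (CEx a c) = CEx a' (ctrans C (ro', ri') c)"
    using ex' kr ar by simp
  then show ?thesis using that b b' t1 t2 by blast
qed

lemma ctrans_CEx_False:
  assumes "ro \<in> MM C" "a \<in> MM C" "\<not> (\<exists>g k. bc ro g a k)"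
  shows "ctrans C (ro, ri) (CEx a c) = CFalse"
  using assms poc_iff[of ro a] by simp

lemma cond_over_ctrans:
  "cond_over C c L \<Longrightarrow> mor ro K L \<Longrightarrow> mor ri K I \<Longrightarrow> cond_over C (ctrans C (ro, ri) c) I"
proof (induction c arbitrary: ro ri K L I)
  case CTrue then show ?case using Obj_mor[of ri K I] by simp
next
  case (CEx a c)
  have a: "mor a L (Cod C a)" and c: "cond_over C c (Cod C a)" using CEx.prems(1) by simp_all
  show ?case
  proof (cases "\<exists>g k. bc ro g a k")
    case True
    obtain k ro' a' ri' K' I' where x: "mor ro' K' (Cod C a)" "mor a' I I'" "mor ri' K' I'"
      "ctrans C (ro, ri) (CEx a c) = CEx a' (ctrans C (ro', ri') c)"
      by (rule ctrans_CEx[OF CEx.prems(2,3) a True]) blast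
    show ?thesis using CEx.IH[OF c x(1,3)] x(2) unfolding x(4) by simp
  next
    case False
    then have "ctrans C (ro, ri) (CEx a c) = CFalse" using ctrans_CEx_False a CEx.prems(2) by blast
    then show ?thesis using Obj_mor[OF CEx.prems(3)] by (simp add: CFalse_def)
  qed
next
  case (CConj J F) then show ?case using Obj_mor[OF CConj.prems(3)] by auto
qed auto

text \<open>\<open>n\<close> may be any comatch of the derivation at \<open>p\<close>. In the
  existential case, extensions \<open>q\<close> of \<open>p\<close> by \<open>a'\<close> and
  extensions \<open>z\<close> of \<open>n\<close> by \<open>a\<close> are converted into each other
  so that \<open>z\<close> is again a comatch at \<open>q\<close>, to which the induction hypothesis
  applies.\<close>

lemma sat_ctrans:
  "cond_over C c L \<Longrightarrow> mor ro K L \<Longrightarrow> mor ri K I \<Longrightarrow> deriv ro ri p n \<Longrightarrow>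
    sat C (ctrans C (ro, ri) c) p \<longleftrightarrow> sat C c n"
proof (induction c arbitrary: ro ri K L I p n)
  case (CEx a c)
  define L' where "L' = Cod C a"
  have a: "mor a L L'" and c: "cond_over C c (Cod C a)" using CEx.prems(1) by (simp_all add: L'_def)
  note tro = CEx.prems(2) and derivation_triple = CEx.prems(3) and D = CEx.prems(4)
  define X Y where "X = Cod C p" and "Y = Cod C n"
  have tp: "mor p I X" and tn: "mor n L Y"
    using deriv_types[OF D] tro derivation_triple unfolding X_def Y_def by simp_all
  obtain E kk d qq where t: "mor kk K E" "mor d E X" "mor qq E Y" and F: "fp ri p kk d" and B: "bc ro kk n qq"
    by (rule derivE[OF D tro tp tn])
  note [simp] = a tro derivation_triple tp tn t
  show ?case
  proof
    assume S: "sat C (ctrans C (ro, ri) (CEx a c)) p"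
    have ex: "\<exists>g k. bc ro g a k"
    proof (rule ccontr)
      assume "\<not> (\<exists>g k. bc ro g a k)"
      then have "ctrans C (ro, ri) (CEx a c) = CFalse" using ctrans_CEx_False[of ro a ri c] by simp
      then show False using S by (simp add: CFalse_def)
    qed
    obtain k ro' a' ri' K' I' where b: "bc ro k a ro'" "bc ri k a' ri'" and t': "mor k K K'" "mor ro' K' L'"
      "mor a' I I'" "mor ri' K' I'" and e: "ctrans C (ro, ri) (CEx a c) = CEx a' (ctrans C (ro', ri') c)"
      by (rule ctrans_CEx[OF tro derivation_triple a ex])
    note [simp] = t'
    obtain q where q: "q \<in> MM C" "Dom C q = Cod C a'" "q \<cdot> a' = p" and Sq: "sat C (ctrans C (ro', ri') c) q"
      using S unfolding e sat.simps by blast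
    have [simp]: "q \<in> MM C" "Dom C q = I'" "Cod C q = X"
      using q(1,2) arg_cong[OF q(3), of "Cod C"] by simp_all
    obtain E' k2 d2 where F2: "fp ri' q k2 d2" and t2: "mor k2 K' E'" "mor d2 E' X"
      by (rule fp_ex[of ri' K' I' q X]) (simp, simp, blast)
    \<comment> \<open>The pushout defining \<open>a'\<close> is also a final pullback complement, so
      the context of \<open>q\<close> serves as a context of \<open>p\<close> and has image
      \<open>d\<close>. The old context can therefore be kept, and only the arrow \<open>m\<close>
      into it is new.\<close>
    have "fp ri p (k2 \<cdot> k) d2" using fp_paste[OF bc_fp[OF b(2)] F2] unfolding q(3) .
    then have "img d = img d2" using F by (rule fp_image_unique)
    then obtain m where "mor m (Dom C ri') E" and m2: "fp ri' q m d"
      by (rule fp_same[OF F2, of d E, rotated]) (blast, simp)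
    then have m: "mor m K' E" by simp
    note [simp] = m
    have "d \<cdot> (m \<cdot> k) = d \<cdot> kk"
      by (simp add: reassoc[OF fpD(9)[OF m2, symmetric]] bcD(9)[OF b(2), symmetric] reassoc1[OF q(3)]
          fpD(9)[OF F])
    then have mk: "m \<cdot> k = kk" by (simp add: cancel)
    obtain z where z: "mor z (Cod C ro') (Cod C qq)" "z \<cdot> a = n" "z \<cdot> ro' = qq \<cdot> m" "bc m ro' qq z"
      by (rule bc_split[OF bc_flip[OF b(1)], of m qq n]) (use bc_flip[OF B] in \<open>simp_all add: mk\<close>)
    have "deriv ro' ri' q z" unfolding deriv_def using m2 bc_flip[OF z(4)] by blast
    from CEx.IH[OF c t'(2)[unfolded L'_def] t'(4) this] have "sat C c z" using Sq by blast
    moreover have "z \<in> MM C" "Dom C z = Cod C a" using z(1) by simp_all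
    ultimately show "sat C (CEx a c) n" using z(2) unfolding sat.simps by blast
  next
    assume "sat C (CEx a c) n"
    then obtain z where z: "z \<in> MM C" "Dom C z = L'" "z \<cdot> a = n" and Sz: "sat C c z"
      unfolding L'_def sat.simps by blast
    have zt [simp]: "z \<in> MM C" "Dom C z = L'" "Cod C z = Y"
      using z(1,2) arg_cong[OF z(3), of "Cod C"] by simp_all
    \<comment> \<open>Intersecting the context with \<open>z\<close> yields a pushout complement of
      \<open>ro\<close> and \<open>a\<close>, so \<open>ctrans\<close> is in its nontrivial
      branch.\<close>
    obtain W d1 a1 where pb: "pb d1 a1 z qq" and t1: "mor d1 W L'" "mor a1 W E"
      by (rule pb_ex[of z L' Y qq E]) (simp, simp, blast)
    obtain g' where "bc ro g' a d1"
      by (rule bc_restrict[OF B z(3)[symmetric] _ _ pb]) (simp, simp, blast)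
    then have ex: "\<exists>g k. bc ro g a k" by blast
    obtain k ro' a' ri' K' I' where b: "bc ro k a ro'" "bc ri k a' ri'" and t': "mor k K K'" "mor ro' K' L'"
      "mor a' I I'" "mor ri' K' I'" and e: "ctrans C (ro, ri) (CEx a c) = CEx a' (ctrans C (ro', ri') c)"
      by (rule ctrans_CEx[OF tro derivation_triple a ex])
    note [simp] = t'
    obtain m where m: "mor m K' E" "qq \<cdot> m = z \<cdot> ro'" "m \<cdot> k = kk"
      by (rule poc_restrict[OF B z(3)[symmetric] _ b(1)]) (simp, simp)
    note [simp] = m(1)
    have eq: "p \<cdot> ri = (d \<cdot> m) \<cdot> k" using fpD(9)[OF F] m(3) by simp
    have sub: "img p \<inter> img (d \<cdot> m) \<subseteq> img (p \<cdot> ri)"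
      using fpD(10)[OF F] img_comp_sub[of m d] by auto
    obtain q where q: "mor q I' X" "q \<cdot> a' = p" "q \<cdot> ri' = d \<cdot> m"
      by (rule bc_univ[OF b(2) _ _ eq sub, of X]) (simp, simp, simp)
    note [simp] = q(1)
    \<comment> \<open>\<open>q\<close> is the union of \<open>p\<close> and
      \<open>q \<cdot> ri'\<close>. The context \<open>d\<close> meets each of them inside
      \<open>q \<cdot> ri'\<close>, hence also meets \<open>q\<close> there; finality is inherited
      from the match \<open>p\<close>.\<close>
    have "fp ri' q m d"
    proof (rule fpI)
      show "q \<cdot> ri' = d \<cdot> m" by (rule q)
      have s: "img (p \<cdot> ri) \<subseteq> img (q \<cdot> ri')" using img_comp_sub[of k "d \<cdot> m"] unfolding eq q(3) by simp
      have "img d \<inter> img q \<subseteq> img d \<inter> cl X (img p \<union> img (q \<cdot> ri'))"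
        using bc_cover_img[OF b(2), of q X] q(2) by auto
      also have "\<dots> \<subseteq> cl X (img d \<inter> (img p \<union> img (q \<cdot> ri')))"
        using img_pts[of p] img_pts[of "q \<cdot> ri'"] by (intro Int_cl sieve_Un) simp_all
      also have "\<dots> \<subseteq> img (q \<cdot> ri')"
        by (rule cl_least) (use s fpD(10)[OF F] in auto)
      finally show "img d \<inter> img q \<subseteq> img (q \<cdot> ri')" .
      fix U assume U: "U \<in> Sub (Cod C q)" "U \<inter> img q \<subseteq> img (q \<cdot> ri')"
      have "img p \<subseteq> img q" using img_comp_sub[of a' q] q(2) by simp
      then have "U \<inter> img p \<subseteq> img (d \<cdot> m) \<inter> img p" using U(2) unfolding q(3) by blast
      also have "\<dots> \<subseteq> img (p \<cdot> ri)" using sub by blast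
      finally show "U \<subseteq> img d" using fp_iff[OF F, of U] U(1) by simp
    qed simp_all
    moreover have "bc ro' m z qq"
    proof -
      obtain z' where z': "mor z' (Cod C ro') (Cod C qq)" "z' \<cdot> a = n" "z' \<cdot> ro' = qq \<cdot> m" "bc m ro' qq z'"
        by (rule bc_split[OF bc_flip[OF b(1)], of m qq n]) (use bc_flip[OF B] in \<open>simp_all add: m(3)\<close>)
      have "z' = z"
        by (rule bc_joint[OF b(1)]) (use z'(1) in \<open>simp_all add: z'(2,3) z(3) m(2)\<close>)
      then show ?thesis using bc_flip[OF z'(4)] by simp
    qed
    ultimately have "deriv ro' ri' q z" unfolding deriv_def by blast
    from CEx.IH[OF c t'(2)[unfolded L'_def] t'(4) this] have "sat C (ctrans C (ro', ri') c) q"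
      using Sz by blast
    then show "sat C (ctrans C (ro, ri) (CEx a c)) p" unfolding e sat.simps using q(1,2) t'(3) by metis
  qed
qed auto

lemma bc_Idn: "f \<in> MM C \<Longrightarrow> bc f (Idn C (Dom C f)) (Idn C (Cod C f)) f"
  unfolding bc_def
proof
  assume [simp]: "f \<in> MM C"
  show "pb f (Idn C (Dom C f)) (Idn C (Cod C f)) f"
    by (rule pbI) (simp_all add: imgI)
  show "pts (Cod C (Idn C (Cod C f))) \<subseteq> cl (Cod C (Idn C (Cod C f))) (img (Idn C (Cod C f)) \<union> img f)"
    using cl_sup[of "img (Idn C (Cod C f)) \<union> img f" "Cod C f"] img_pts[of f] by simp
qed

lemma pb_postcomp:
  assumes p: "pb f g h k" and u: "mor u (Cod C h) Y" shows "pb f g (u \<cdot> h) (u \<cdot> k)"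
proof (rule pbI)
  note [simp] = pbD(1-4)[OF p] pbD(5)[OF p, symmetric] pbD(6,7)[OF p] pbD(8)[OF p, symmetric] u
  show "f \<in> MM C" "g \<in> MM C" "u \<cdot> h \<in> MM C" "u \<cdot> k \<in> MM C" "Dom C f = Dom C g" "Cod C f = Dom C (u \<cdot> h)"
    "Cod C g = Dom C (u \<cdot> k)" "Cod C (u \<cdot> h) = Cod C (u \<cdot> k)" by simp_all
  show "u \<cdot> h \<cdot> f = u \<cdot> k \<cdot> g" by (simp add: pbD(9)[OF p])
  fix a b assume ab: "a \<in> MM C" "b \<in> MM C" "Cod C a = Dom C (u \<cdot> h)" "Cod C b = Dom C (u \<cdot> k)" "(u \<cdot> h) \<cdot>
      a = (u \<cdot> k) \<cdot> b"
  have [simp]: "a \<in> MM C" "b \<in> MM C" "Cod C a = Dom C h" "Cod C b = Dom C k" using ab(1-4) by simp_all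
  have "h \<cdot> a = k \<cdot> b" using ab(5) by (simp add: cancel)
  then obtain w where "w \<in> MM C" "Cod C w = Dom C f" "a = f \<cdot> w"
    by (rule pb_point[OF p, of a b, rotated 4]) (blast, simp_all)
  then show "a \<in> img f" by blast
qed

text \<open>A complement over the isomorphic object exists, and restricting it along
  \<open>u\<close> returns \<open>d\<close>; its image is thus that of
  \<open>u \<cdot> d\<close>.\<close>

lemma fp_postcomp_iso:
  assumes F: "fp a c b d" and u: "iso_arrow C u" "Dom C u = Cod C c"
  shows "fp a (u \<cdot> c) b (u \<cdot> d)"
proof -
  note [simp] = fpD(1-4)[OF F] fpD(5)[OF F, symmetric] fpD(6,7)[OF F] fpD(8)[OF F, symmetric] iso_MM[OF
      u(1)] u(2)
  obtain D b2 d2 where F2: "fp a (u \<cdot> c) b2 d2" and t: "mor d2 D (Cod C u)"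
    by (rule fp_ex[of a "Dom C a" "Dom C c" "u \<cdot> c" "Cod C u"]) (simp, simp, blast)
  obtain t where "pb d t u d2"
    by (rule fp_restrict[OF F2 F _ refl]) (simp)
  from pbD(10)[OF this] have "img (u \<cdot> d) = img d2"
    using img_iso[OF u(1)] img_pts[of d2] t by auto
  then obtain m where "fp a (u \<cdot> c) m (u \<cdot> d)" and m [simp]: "m \<in> MM C" "Cod C m = Dom C d"
    by (rule fp_same[OF F2, of "u \<cdot> d" "Dom C d", rotated]) (blast, simp)
  moreover have "(u \<cdot> d) \<cdot> m = (u \<cdot> d) \<cdot> b" using fpD(9)[OF calculation(1)] fpD(9)[OF F] by simp
  then have "m = b" by (simp add: cancel)
  ultimately show ?thesis by simp
qed

subsection \<open>Composites of two rules\<close>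

text \<open>The data of a composite over an arbitrary cospan \<open>(n2, n1)\<close> isomorphic to the chosen one, with its
  condition described semantically.\<close>

definition composite_data ::
  "('i, 'b) cond_rule \<Rightarrow> 'b \<times> 'b \<Rightarrow> ('i, 'b) cond_rule \<Rightarrow>
    'b \<times> 'b \<times> 'b \<times> 'b \<times> 'b \<times> 'b \<times> 'b \<times> 'b \<times> 'b \<times> 'b \<times> 'b \<times> 'b \<Rightarrow> bool" where
  "composite_data = (\<lambda>((o2, i2), c2) (m2, m1) ((o1, i1), c1) (n2, n1, k2, d2, k1, d1, p2, q2, q1, p1, l2, l1).
     bc m2 m1 n2 n1 \<and> fp i2 n2 k2 d2 \<and> bc o1 k1 n1 d1 \<and> bc o2 k2 p2 q2 \<and> bc k1 i1 q1 p1 \<and> pb l2 l1 d2 d1 \<and>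
     fst (sq_compose C ((o2, i2), c2) (m2, m1) ((o1, i1), c1)) = (q2 \<cdot> l2, q1 \<cdot> l1) \<and>
     cond_over C (snd (sq_compose C ((o2, i2), c2) (m2, m1) ((o1, i1), c1))) (Cod C q1) \<and>
     (\<forall>p n. deriv d1 q1 p n \<longrightarrow>
        (sat C (snd (sq_compose C ((o2, i2), c2) (m2, m1) ((o1, i1), c1))) p \<longleftrightarrow>
          sat C c1 (p \<cdot> p1) \<and> sat C c2 (n \<cdot> n2))))"

lemma composite_dataD:
  assumes "composite_data ((o2, i2), c2) (m2, m1) ((o1, i1), c1) (n2, n1, k2, d2, k1, d1, p2, q2, q1, p1,
      l2, l1)"
  shows "bc m2 m1 n2 n1" "fp i2 n2 k2 d2" "bc o1 k1 n1 d1" "bc o2 k2 p2 q2" "bc k1 i1 q1 p1" "pb l2 l1 d2 d1"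
     "fst (sq_compose C ((o2, i2), c2) (m2, m1) ((o1, i1), c1)) = (q2 \<cdot> l2, q1 \<cdot> l1)"
     "cond_over C (snd (sq_compose C ((o2, i2), c2) (m2, m1) ((o1, i1), c1))) (Cod C q1)"
     "\<And>p n. deriv d1 q1 p n \<Longrightarrow>
        (sat C (snd (sq_compose C ((o2, i2), c2) (m2, m1) ((o1, i1), c1))) p \<longleftrightarrow>
          sat C c1 (p \<cdot> p1) \<and> sat C c2 (n \<cdot> n2))"
  using assms unfolding composite_data_def prod.case by blast+

text \<open>Frees the data from the chosen pushout: a match obtained elsewhere comes with its own
  cospan, such as one into a state of a derivation triple, and the composite is wanted over that
  one.\<close>

lemma composite_data_ex:
  assumes R2: "mor o2 K2 O2" "mor i2 K2 I2" "cond_over C c2 I2"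
    and R1: "mor o1 K1 O1" "mor i1 K1 I1" "cond_over C c1 I1"
    and b: "bc m2 m1 n2 n1" and m: "mor m2 M I2" "mor m1 M O1" and ex: "bc o1 k n1 d"
  obtains k2 d2 k1 d1 p2 q2 q1 p1 l2 l1 where
    "composite_data ((o2, i2), c2) (m2, m1) ((o1, i1), c1) (n2, n1, k2, d2, k1, d1, p2, q2, q1, p1, l2, l1)"
proof -
  note [simp] = R2(1,2) R1(1,2) m
  obtain N where tn: "mor n2 I2 N" "mor n1 O1 N" using bc_mor'[OF b m] by blast
  obtain n2' n1' where n: "the_pushout C m2 m1 = (n2', n1')" by fastforce
  have b': "bc m2 m1 n2' n1'" by (rule the_pushout_bc[OF _ _ _ n]) simp_all
  obtain N' where tn': "mor n2' I2 N'" "mor n1' O1 N'" using bc_mor'[OF b' m] by blast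
  note [simp] = tn tn'
  obtain g where g: "iso_arrow C g" "mor g N' N" "g \<cdot> n2' = n2" "g \<cdot> n1' = n1"
    by (rule bc_unique[OF b' b]) simp
  obtain g' where g': "iso_arrow C g'" "mor g' N N'" "g' \<cdot> g = Idn C N'"
    using iso_inverse[OF g(1)] g(2) by metis
  note [simp] = g(2) g'(2)
  have "g' \<cdot> n1 = n1'" by (simp add: g(4)[symmetric] reassoc1[OF g'(3)] del: tn)
  then have "bc o1 k n1' (g' \<cdot> d)" using bc_postcomp_iso[OF ex g'(1)] by simp
  then have ex': "\<exists>k d. pushout_complement C o1 n1' k d" using poc_iff[of o1 n1'] by auto
  obtain k2 d2 where kd2: "the_FPC C i2 n2' = (k2, d2)" by fastforce
  have F: "fp i2 n2' k2 d2" by (rule the_FPC_fp[OF _ _ _ kd2]) simp_all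
  obtain K2' where t2: "mor k2 K2 K2'" "mor d2 K2' N'"
    using fpD(2,4)[OF F] fpD(5,8)[OF F, symmetric] fpD(7)[OF F] by simp
  obtain k1 d1 where kd1: "the_pushout_complement C o1 n1' = (k1, d1)" by fastforce
  have B1: "bc o1 k1 n1' d1" by (rule the_poc_bc[OF _ _ ex' kd1]) simp_all
  obtain K1' where t1: "mor k1 K1 K1'" "mor d1 K1' N'" using bc_mor[OF B1 R1(1) tn'(2)] by blast
  note [simp] = t2 t1
  obtain p2 q2 where pq2: "the_pushout C o2 k2 = (p2, q2)" by fastforce
  have B2: "bc o2 k2 p2 q2" by (rule the_pushout_bc[OF _ _ _ pq2]) simp_all
  obtain q1 p1 where pq1: "the_pushout C k1 i1 = (q1, p1)" by fastforce
  have B3: "bc k1 i1 q1 p1" by (rule the_pushout_bc[OF _ _ _ pq1]) simp_all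
  obtain l2 l1 where l: "the_pullback C d2 d1 = (l2, l1)" by fastforce
  have L: "pb l2 l1 d2 d1" by (rule the_pullback_pb[OF _ _ _ l]) simp_all
  obtain I21 where t3: "mor q1 K1' I21" "mor p1 I1 I21" using bc_mor'[OF B3 t1(1) R1(2)] by blast
  note [simp] = t3
  have e: "sq_compose C ((o2, i2), c2) (m2, m1) ((o1, i1), c1) =
    ((q2 \<cdot> l2, q1 \<cdot> l1), CAnd (cshift C p1 c1) (ctrans C (d1, q1) (cshift C n2' c2)))"
    unfolding sq_compose_def by (simp add: n kd2 kd1 pq2 pq1 l)
  note c1 = cond_over_cshift[OF R1(3) t3(2)] and c2 = cond_over_cshift[OF R2(3) tn'(1)]
  note c3 = cond_over_ctrans[OF c2 t1(2) t3(1)]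
  \<comment> \<open>Only arrows into the corner are moved along \<open>g\<close>. The legs of the
    composite rule stay literally those of \<open>sq_compose\<close>.\<close>
  have "composite_data ((o2, i2), c2) (m2, m1) ((o1, i1), c1) (n2, n1, k2, g \<cdot> d2, k1, g \<cdot> d1, p2, q2,
      q1, p1, l2, l1)"
    unfolding composite_data_def prod.case e fst_conv snd_conv
  proof (intro conjI allI impI refl b B2 B3)
    show "fp i2 n2 k2 (g \<cdot> d2)" using fp_postcomp_iso[OF F g(1)] g(3) by simp
    show "bc o1 k1 n1 (g \<cdot> d1)" using bc_postcomp_iso[OF B1 g(1)] g(4) by simp
    show "pb l2 l1 (g \<cdot> d2) (g \<cdot> d1)" by (rule pb_postcomp[OF L]) simp
    have [simp]: "I21 \<in> Obj C" "N' \<in> Obj C" using Obj_mor[OF t3(1)] Obj_mor[OF tn'(1)] by blast+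
    show "cond_over C (CAnd (cshift C p1 c1) (ctrans C (d1, q1) (cshift C n2' c2))) (Cod C q1)"
      using c1 c3 by (simp add: CAnd_def)
    fix p nn assume D: "deriv (g \<cdot> d1) q1 p nn"
    have tp: "mor p I21 (Cod C p)" "mor nn N (Cod C nn)" using deriv_types[OF D] by simp_all
    \<comment> \<open>The condition was built with \<open>d1\<close> while the derivation uses
      \<open>g \<cdot> d1\<close>. Pasting with a square along the isomorphism \<open>g\<close>
      converts the derivation, at the price of the comatch \<open>nn \<cdot> g\<close>.\<close>
    have "bc d1 (Idn C K1') g (g \<cdot> d1)"
      using bc_postcomp_iso[OF bc_Idn[of d1] g(1)] by simp
    moreover have "fp q1 (Idn C I21) (Idn C K1') q1" using bc_fp[OF bc_Idn[of q1]] by simp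
    ultimately have "deriv d1 q1 (p \<cdot> Idn C I21) (nn \<cdot> g)" using D by (rule deriv_comp)
    moreover have "p \<cdot> Idn C I21 = p" using tp(1) by (intro comp_Idn(1)) (blast intro: monoD)+
    ultimately have D': "deriv d1 q1 p (nn \<cdot> g)" by simp
    have tng: "mor (nn \<cdot> g) N' (Cod C nn)" using tp(2) g(2) comp_in_Arr(2,3)[of g nn] comp_in_MM[of g nn]
        by auto
    have eqn: "(nn \<cdot> g) \<cdot> n2' = nn \<cdot> n2"
      unfolding g(3)[symmetric] using tp(2) g(2) tn'(1) by (intro comp_assoc) auto
    have "sat C (cshift C p1 c1) p \<longleftrightarrow> sat C c1 (p \<cdot> p1)"
      by (rule sat_cshift[OF R1(3) t3(2) tp(1)])
    moreover have "sat C (ctrans C (d1, q1) (cshift C n2' c2)) p \<longleftrightarrow> sat C c2 (nn \<cdot> n2)"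
      using sat_ctrans[OF c2 t1(2) t3(1) D'] sat_cshift[OF R2(3) tn'(1) tng] eqn by simp
    ultimately show "sat C (CAnd (cshift C p1 c1) (ctrans C (d1, q1) (cshift C n2' c2))) p \<longleftrightarrow>
      sat C c1 (p \<cdot> p1) \<and> sat C c2 (nn \<cdot> n2)" by (auto simp: CAnd_def)
  qed
  then show ?thesis by (rule that)
qed

text \<open>Existence of the pushout complement does not depend on which pushout was chosen, and not
  being equivalent to false means being satisfied by some mono.\<close>

lemma sq_matches_iff:
  assumes R2: "mor o2 K2 O2" "mor i2 K2 I2" and R1: "mor o1 K1 O1" "mor i1 K1 I1"
  shows "(m2, m1) \<in> sq_matches C ((o2, i2), c2) ((o1, i1), c1) \<longleftrightarrow>
    mor m2 (Dom C m1) I2 \<and> mor m1 (Dom C m1) O1 \<and> span_rep C (m2, m1) \<and>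
    (\<exists>n2 n1 k d. bc m2 m1 n2 n1 \<and> bc o1 k n1 d) \<and>
    (\<exists>p\<in>MM C. Dom C p = Cod C (snd (fst (sq_compose C ((o2, i2), c2) (m2, m1) ((o1, i1), c1)))) \<and>
       sat C (snd (sq_compose C ((o2, i2), c2) (m2, m1) ((o1, i1), c1))) p)"
proof -
  have "(\<exists>k d. pushout_complement C o1 (snd (the_pushout C m2 m1)) k d) \<longleftrightarrow>
    (\<exists>n2 n1 k d. bc m2 m1 n2 n1 \<and> bc o1 k n1 d)" if m: "mor m2 (Dom C m1) I2" "mor m1 (Dom C m1) O1"
  proof -
    obtain n2' n1' where n: "the_pushout C m2 m1 = (n2', n1')" by fastforce
    have b': "bc m2 m1 n2' n1'" using m by (intro the_pushout_bc[OF _ _ _ n]) simp_all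
    have n1': "n1' \<in> MM C" by (rule bcD[OF b'])
    have "(\<exists>k d. pushout_complement C o1 n1' k d) \<longleftrightarrow> (\<exists>k d. bc o1 k n1' d)"
      using R1(1) n1' by (intro poc_iff) auto
    moreover have "\<exists>k d. bc o1 k n1' d" if b: "bc m2 m1 n2 n1" and k: "bc o1 k n1 d" for n2 n1 k d
    proof -
      obtain g where g: "iso_arrow C g" "mor g (Cod C n2) (Cod C n2')" "g \<cdot> n1 = n1'"
        by (rule bc_unique[OF b b']) blast
      have "Dom C g = Cod C n1" using g(2) bcD(8)[OF b] by simp
      from bc_postcomp_iso[OF k g(1) this] show ?thesis unfolding g(3) by blast
    qed
    ultimately show ?thesis using b' unfolding n snd_conv by blast
  qed
  moreover have "M_span C (m2, m1) \<and> Cod C m2 = I2 \<and> Cod C m1 = O1 \<longleftrightarrow>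
    mor m2 (Dom C m1) I2 \<and> mor m1 (Dom C m1) O1" by (auto simp: M_span_def)
  ultimately show ?thesis
    using R1 R2 unfolding sq_matches_def cond_equiv_def CFalse_def by (simp add: Bex_def) blast
qed

text \<open>Pulling back the pushout \<open>(f, g, h, k)\<close> along \<open>d\<close>.\<close>

lemma bc_cube:
  assumes b: "bc f g h k" and p: "pb b' b d h" and q: "pb c' c d k" and l: "pb l m b f"
    and t [simp]: "mor f A B" "mor g A D" "mor h B X" "mor k D X" "mor d L X" "mor b' B' L" "mor b B' B"
      "mor c' D' L" "mor c D' D" "mor l A' B'" "mor m A' A"
  obtains \<kappa> where "mor \<kappa> A' D'" "b' \<cdot> l = c' \<cdot> \<kappa>" "g \<cdot> m = c \<cdot> \<kappa>" "bc l \<kappa> b' c'"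
proof -
  note pe = pbD(9)[OF p] and qe = pbD(9)[OF q] and be = bcD(9)[OF b] and le = pbD(9)[OF l]
  have "d \<cdot> (b' \<cdot> l) = k \<cdot> (g \<cdot> m)" by (simp add: reassoc[OF pe] le reassoc[OF be])
  then obtain \<kappa> where k: "\<kappa> \<in> MM C" "Cod C \<kappa> = Dom C c'" "Dom C \<kappa> = Dom C (b' \<cdot> l)" "b' \<cdot> l = c' \<cdot> \<kappa>" "g
      \<cdot> m = c \<cdot> \<kappa>"
    by (rule pb_point[OF q, of "b' \<cdot> l" "g \<cdot> m", rotated 4]) (blast, simp_all)
  have [simp]: "\<kappa> \<in> MM C" "Cod C \<kappa> = D'" "Dom C \<kappa> = A'" using k(1-3) by simp_all
  have "pb l \<kappa> b' c'"
  proof (rule pbI)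
    show "b' \<cdot> l = c' \<cdot> \<kappa>" by (rule k)
    fix x y assume x: "x \<in> MM C" "y \<in> MM C" "Cod C x = Dom C b'" "Cod C y = Dom C c'" "b' \<cdot> x = c' \<cdot> y"
    note [simp] = x(1,2) x(3,4)[simplified]
    have "h \<cdot> (b \<cdot> x) = k \<cdot> (c \<cdot> y)"
      by (simp add: reassoc[OF pe[symmetric]] x(5) reassoc[OF qe])
    then obtain w where w: "w \<in> MM C" "Cod C w = Dom C f" "b \<cdot> x = f \<cdot> w"
      by (rule pb_point[OF bcD(11)[OF b], of "b \<cdot> x" "c \<cdot> y", rotated 4]) (blast, simp_all)
    obtain v where v: "v \<in> MM C" "Cod C v = Dom C l" "x = l \<cdot> v"
      by (rule pb_point[OF l, of x w]) (use w in simp_all)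
    then show "x \<in> img l" by blast
  qed simp_all
  \<comment> \<open>Stability of the union under intersection with \<open>d\<close>, computed in
    \<open>X\<close> by distributivity and reflected back to \<open>L\<close>.\<close>
  moreover have "pts L \<subseteq> cl L (img b' \<union> img c')"
  proof (rule cover_reflect[OF t(5,6,8)])
    have "img d \<subseteq> cl X ((img d \<inter> img h) \<union> (img d \<inter> img k))"
      using bc_cover_Int[OF b, of "img d"] by simp
    also have "\<dots> \<subseteq> cl X (img (d \<cdot> b') \<union> img (d \<cdot> c'))"
      using pbD(10)[OF p] pbD(10)[OF q] by (intro cl_mono) blast
    finally show "img d \<subseteq> cl X (img (d \<cdot> b') \<union> img (d \<cdot> c'))" .
  qed
  ultimately have "bc l \<kappa> b' c'" unfolding bc_def by simp
  then show ?thesis using that[of \<kappa>] k(4,5) by simp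
qed

lemma cover_bcI:
  assumes p: "pb f g h k" and X: "Cod C h = X" and S: "pts X \<subseteq> cl X S" "S \<subseteq> cl X (img h \<union> img k)"
  shows "bc f g h k"
  unfolding bc_def X using p cl_trans[OF S(2)] S(1) by blast

lemma cl_supI: "f \<in> MM C \<Longrightarrow> Cod C f = X \<Longrightarrow> img f \<subseteq> S \<Longrightarrow> img f \<subseteq> cl X S"
  using img_pts[of f] unfolding cl_def by blast

lemma img_sub_cl:
  assumes "mor a A B" "mor b B X" "b \<cdot> a = c" "img b \<subseteq> S" shows "img c \<subseteq> cl X S"
proof -
  note [simp] = assms(1,2)
  have "img (b \<cdot> a) \<subseteq> cl X S" using img_comp_sub[of a b] assms(4) by (intro cl_supI) auto
  then show ?thesis unfolding assms(3) .
qed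

end

locale three_rules = sqpo_category C for C :: "('o, 'm) mcat" (structure) +
  fixes O1 K1 I1 O2 K2 I2 O3 K3 I3 :: 'o and o1 i1 o2 i2 o3 i3 :: 'm
  assumes rules [simp]: "mor o1 K1 O1" "mor i1 K1 I1" "mor o2 K2 O2" "mor i2 K2 I2" "mor o3 K3 O3" "mor
      i3 K3 I3"

section \<open>Derivation triples\<close>

text \<open>Both nested composites are encoded by one object \<open>X1\<close>, the state between the first and the second
  rule, and one object \<open>X2\<close>, the state between the second and the third. The second rule turns \<open>X1\<close> into
  \<open>X2\<close> along the common subobject \<open>L2\<close>; the minimality condition says that \<open>X1\<close> is the union of \<open>O1\<close>,
  \<open>I2\<close> and the part \<open>Z\<close> of \<open>I3\<close> that the second rule leaves alone.\<close>

locale derivation_triple = three_rules +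
  fixes X1 X2 L1 L2 Z and x1 x2 f1 e1 f2 e2 y2 g2 x3 z3 z2
  assumes tri_mor [simp]: "mor x1 O1 X1" "mor x2 I2 X1" "mor f1 K1 L1" "mor e1 L1 X1" "mor f2 K2 L2" "mor
      e2 L2 X1"
      "mor y2 O2 X2" "mor g2 L2 X2" "mor x3 I3 X2" "mor z3 Z I3" "mor z2 Z L2"
    and X1_left: "bc o1 f1 x1 e1" and X1_right: "fp i2 x2 f2 e2" and X2_left: "bc o2 f2 y2 g2"
    and Z_pb: "pb z3 z2 x3 g2"
    and X1_cover: "pts X1 \<subseteq> cl X1 (img x1 \<union> img x2 \<union> img (e2 \<cdot> z2))"

text \<open>Here \<open>M2\<close> and \<open>M1\<close> are the two contexts inside
  \<open>N\<close>, a final pullback complement and a pushout complement, and \<open>W\<close> is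
  the apex of the composite rule.\<close>

locale composite21 = three_rules +
  fixes N M2 M1 O21 I21 W and n2 n1 k2 d2 k1 d1 p2 q2 q1 p1 l2 l1
  assumes composite21_mor [simp]: "mor n2 I2 N" "mor n1 O1 N" "mor k2 K2 M2" "mor d2 M2 N" "mor k1 K1 M1"
      "mor d1 M1 N"
      "mor p2 O2 O21" "mor q2 M2 O21" "mor q1 M1 I21" "mor p1 I1 I21" "mor l2 W M2" "mor l1 W M1"
    and N_cover: "pts N \<subseteq> cl N (img n2 \<union> img n1)"
    and N_right: "fp i2 n2 k2 d2" and N_left: "bc o1 k1 n1 d1" and O21_bc: "bc o2 k2 p2 q2"
    and I21_bc: "bc k1 i1 q1 p1" and W_pb: "pb l2 l1 d2 d1"

text \<open>\<open>P3\<close> is the final pullback complement belonging to the third rule and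
  \<open>P2\<close> the pushout complement belonging to the second. The second rule thus plays the
  opposite part from the one it has in \<open>composite21\<close>.\<close>

locale composite32 = three_rules +
  fixes N' P3 P2 O32 I32 W' and n3 nb k3 d3 kb db p3 q3 qb rb m3 mb
  assumes composite32_mor [simp]: "mor n3 I3 N'" "mor nb O2 N'" "mor k3 K3 P3" "mor d3 P3 N'" "mor kb K2
      P2" "mor db P2 N'"
      "mor p3 O3 O32" "mor q3 P3 O32" "mor qb P2 I32" "mor rb I2 I32" "mor m3 W' P3" "mor mb W' P2"
    and N'_cover: "pts N' \<subseteq> cl N' (img n3 \<union> img nb)"
    and N'_right: "fp i3 n3 k3 d3" and N'_left: "bc o2 kb nb db" and O32_bc: "bc o3 k3 p3 q3"
    and I32_bc: "bc kb i2 qb rb" and W'_pb: "pb m3 mb d3 db"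

text \<open>The composite of the first two rules sits inside the triple, with \<open>N \<subseteq> X1\<close>, \<open>M2 \<subseteq> L2\<close> and \<open>O21 \<subseteq> X2\<close>; a
  match of the third rule into it becomes the cospan \<open>(x3, h)\<close>. Likewise the composite of the last two
  rules has \<open>N' \<subseteq> X2\<close>, \<open>P2 \<subseteq> L2\<close> and \<open>I32 \<subseteq> X1\<close>, and its match into the first rule becomes \<open>(l, x1)\<close>.\<close>

locale triA = derivation_triple + composite21 +
  fixes j a2 h
  assumes triA_mor [simp]: "mor j N X1" "mor a2 M2 L2" "mor h O21 X2"
    and j_n2: "j \<cdot> n2 = x2" and j_n1: "j \<cdot> n1 = x1" and e2_a2: "e2 \<cdot> a2 = j \<cdot> d2"
    and h_p2: "h \<cdot> p2 = y2" and h_q2: "h \<cdot> q2 = g2 \<cdot> a2"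

locale triB = derivation_triple + composite32 +
  fixes jj c l
  assumes triB_mor [simp]: "mor jj N' X2" "mor c P2 L2" "mor l I32 X1"
    and jj_n3: "jj \<cdot> n3 = x3" and jj_nb: "jj \<cdot> nb = y2" and g2_c: "g2 \<cdot> c = jj \<cdot> db"
    and l_rb: "l \<cdot> rb = x2" and l_qb: "l \<cdot> qb = e2 \<cdot> c"

section \<open>The first two rules composed inside a triple\<close>

context triA
begin

lemma a2_k2: "a2 \<cdot> k2 = f2"
proof -
  have "e2 \<cdot> (a2 \<cdot> k2) = e2 \<cdot> f2"
    by (simp add: reassoc[OF e2_a2] fpD(9)[OF N_right, symmetric] fpD(9)[OF X1_right, symmetric]
        reassoc1[OF j_n2])
  then show ?thesis by (simp add: cancel)
qed

text \<open>Complements restrict: \<open>M2\<close> is the intersection of \<open>L2\<close> with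
  \<open>N\<close> inside \<open>X1\<close>.\<close>

lemma M2_pb: "pb d2 a2 j e2"
proof -
  obtain t where t: "mor t (Dom C d2) (Dom C e2)" "e2 \<cdot> t = j \<cdot> d2" "pb d2 t j e2"
    by (rule fp_restrict[OF X1_right N_right _ j_n2[symmetric]]) (simp, blast)
  have "e2 \<cdot> t = e2 \<cdot> a2" using t(2) e2_a2 by simp
  then have "t = a2" using t(1) by (simp add: cancel)
  then show ?thesis using t(3) by simp
qed

lemma img_x_j: "img x1 \<subseteq> img j" "img x2 \<subseteq> img j"
  using img_comp_sub[of n1 j] img_comp_sub[of n2 j] by (simp_all add: j_n1 j_n2)

text \<open>\<open>X1\<close> is covered by \<open>N\<close>, which contains \<open>O1\<close> and
  \<open>I2\<close>, together with \<open>L2\<close>, which contains \<open>Z\<close>.\<close>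

lemma X1_right_bc: "bc d2 a2 j e2"
proof (rule cover_bcI[OF M2_pb _ X1_cover])
  have "img (e2 \<cdot> z2) \<subseteq> img e2" by (rule img_comp_sub) simp_all
  then show "img x1 \<union> img x2 \<union> img (e2 \<cdot> z2) \<subseteq> cl X1 (img j \<union> img e2)"
    using cl_supI[of j X1 "img j \<union> img e2"] cl_supI[of e2 X1 "img j \<union> img e2"] img_x_j by auto
qed simp

lemma M1_ex:
  obtains a1 where "mor a1 M1 L1" "e1 \<cdot> a1 = j \<cdot> d1" "a1 \<cdot> k1 = f1" "pb d1 a1 j e1" "bc d1 a1 j e1"
proof -
  obtain a1 where a1: "mor a1 M1 L1" "e1 \<cdot> a1 = j \<cdot> d1" "a1 \<cdot> k1 = f1" "pb d1 a1 j e1"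
    by (rule poc_restrict[OF X1_left j_n1[symmetric] _ N_left]) (simp, simp)
  have "bc d1 a1 j e1"
  proof (rule cover_bcI[OF a1(4) _ bcD(12)[OF X1_left, simplified]])
    show "img x1 \<union> img e1 \<subseteq> cl X1 (img j \<union> img e1)"
      using cl_supI[of j X1 "img j \<union> img e1"] cl_supI[of e1 X1 "img j \<union> img e1"] img_x_j by auto
  qed simp
  then show ?thesis using that a1 by blast
qed

lemma h_bc: "bc q2 a2 h g2"
proof -
  obtain z where z: "mor z (Cod C q2) (Cod C g2)" "z \<cdot> p2 = y2" "z \<cdot> q2 = g2 \<cdot> a2" "bc a2 q2 g2 z"
    by (rule bc_split[OF bc_flip[OF O21_bc], of a2 g2 y2]) (use bc_flip[OF X2_left] in \<open>simp_all add: a2_k2\<close>)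
  have "z = h"
    by (rule bc_joint[OF O21_bc]) (use z(1) in \<open>simp_all add: z(2,3) h_p2 h_q2\<close>)
  then show ?thesis using bc_flip[OF z(4)] by simp
qed

text \<open>\<open>V\<close> is the intersection of \<open>L1\<close> and \<open>L2\<close> in
  \<open>X1\<close>. The pushout over \<open>h\<close> exhibits it as the pushout complement that a
  match of the third rule into the composite of the first two requires.\<close>

lemma V_ex:
  obtains a1 V b1 b2 t where "mor a1 M1 L1" "mor b1 V L1" "mor b2 V L2" "mor t W V"
    "e1 \<cdot> a1 = j \<cdot> d1" "a1 \<cdot> k1 = f1" "bc d1 a1 j e1" "pb b1 b2 e1 e2"
    "bc l2 t a2 b2" "bc l1 t a1 b1" "bc (q2 \<cdot> l2) t h (g2 \<cdot> b2)" "bc (d2 \<cdot> l2) t j (e2 \<cdot> b2)"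
proof -
  obtain a1 where a1: "mor a1 M1 L1" "e1 \<cdot> a1 = j \<cdot> d1" "a1 \<cdot> k1 = f1" "pb d1 a1 j e1" "bc d1 a1 j e1"
    by (rule M1_ex)
  obtain V b1 b2 where V: "pb b1 b2 e1 e2" and b: "mor b1 V L1" "mor b2 V L2"
    by (rule pb_ex[of e1 L1 X1 e2 L2]) (simp, simp, blast)
  note [simp] = a1(1) b
  \<comment> \<open>Two cubes: the union of \<open>N\<close> and \<open>L1\<close> is intersected
    with \<open>L2\<close>, and next the union of \<open>N\<close> and \<open>L2\<close> with
    \<open>L1\<close>. Both have \<open>W\<close> and \<open>V\<close> as an edge.\<close>
  obtain t where t: "mor t W V" "a2 \<cdot> l2 = b2 \<cdot> t" "a1 \<cdot> l1 = b1 \<cdot> t" "bc l2 t a2 b2"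
    by (rule bc_cube[OF a1(5) pb_flip[OF M2_pb] pb_flip[OF V] W_pb]) (simp, simp, simp, simp, simp, simp,
        simp, simp, simp, simp, simp)
  obtain s where s: "mor s W V" "a1 \<cdot> l1 = b1 \<cdot> s" "bc l1 s a1 b1"
    by (rule bc_cube[OF X1_right_bc pb_flip[OF a1(4)] V pb_flip[OF W_pb]]) (simp, simp, simp, simp, simp,
        simp, simp, simp, simp, simp, simp)
  have "b1 \<cdot> s = b1 \<cdot> t" using s(2) t(3) by simp
  then have "s = t" using s(1) t(1) by (simp add: cancel)
  moreover have "bc (q2 \<cdot> l2) t h (g2 \<cdot> b2)" by (rule bc_paste[OF t(4) h_bc])
  moreover have "bc (d2 \<cdot> l2) t j (e2 \<cdot> b2)" by (rule bc_paste[OF t(4) X1_right_bc])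
  ultimately show ?thesis using that[of a1 b1 V b2 t] a1 V b s t by blast
qed

text \<open>Intersecting the cover of \<open>X1\<close> with \<open>L2\<close> shows that
  \<open>M2\<close> and \<open>Z\<close> cover \<open>L2\<close>. Carried to \<open>X2\<close>,
  these pieces lie in \<open>O21\<close> and \<open>I3\<close>, and \<open>O2\<close> lies in
  \<open>O21\<close> anyway.\<close>

lemma X2_cover: "pts X2 \<subseteq> cl X2 (img x3 \<union> img h)"
proof -
  let ?S = "img x3 \<union> img h"
  have "img (e2 \<cdot> z2) \<subseteq> pts X1" using img_pts[of "e2 \<cdot> z2"] by simp
  then have "img e2 \<subseteq> cl X1 ((img e2 \<inter> (img x1 \<union> img x2)) \<union> (img e2 \<inter> img (e2 \<cdot> z2)))"
    using X1_cover img_pts[of e2] img_pts[of x1] img_pts[of x2] by (intro cover_Int sieve_Un) auto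
  also have "\<dots> \<subseteq> cl X1 (img (e2 \<cdot> a2) \<union> img (e2 \<cdot> z2))"
    using img_x_j pbD(10)[OF M2_pb] unfolding e2_a2 by (intro cl_mono) blast
  finally have "pts L2 \<subseteq> cl L2 (img a2 \<union> img z2)"
    by (intro cover_reflect[of e2 L2 X1 a2 M2 z2 Z]) simp_all
  then have "img g2 \<subseteq> cl X2 (img (g2 \<cdot> a2) \<union> img (g2 \<cdot> z2))"
    by (intro cover_img[of a2 M2 L2 z2 Z]) simp_all
  also have "\<dots> \<subseteq> cl X2 ?S"
    using img_comp_sub[of q2 h] img_comp_sub[of z3 x3]
    unfolding h_q2[symmetric] pbD(9)[OF Z_pb, symmetric] by (intro cl_mono) auto
  finally have "img g2 \<subseteq> cl X2 ?S" .
  moreover have "img y2 \<subseteq> cl X2 ?S" by (rule img_sub_cl[OF _ _ h_p2]) simp_all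
  ultimately show ?thesis using bcD(12)[OF X2_left] cl_trans[of "img y2 \<union> img g2" X2 ?S] by auto
qed

end

section \<open>The last two rules composed inside a triple\<close>

context triB
begin

lemma c_kb: "c \<cdot> kb = f2" and P2_pb: "pb db c jj g2"
proof -
  obtain t where t: "mor t (Dom C db) (Dom C g2)" "g2 \<cdot> t = jj \<cdot> db" "t \<cdot> kb = f2" "pb db t jj g2"
    by (rule poc_restrict[OF X2_left jj_nb[symmetric] _ N'_left]) (simp, blast)
  have "g2 \<cdot> t = g2 \<cdot> c" using t(2) g2_c by simp
  then have "t = c" using t(1) by (simp add: cancel)
  then show "c \<cdot> kb = f2" "pb db c jj g2" using t(3,4) by simp_all
qed

lemma jj_bc: "bc db c jj g2"
proof (rule cover_bcI[OF P2_pb _ bcD(12)[OF X2_left, simplified]])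
  have "img y2 \<subseteq> cl X2 (img jj \<union> img g2)" by (rule img_sub_cl[OF _ _ jj_nb]) simp_all
  then show "img y2 \<union> img g2 \<subseteq> cl X2 (img jj \<union> img g2)"
    using cl_supI[of g2 X2 "img jj \<union> img g2"] by auto
qed simp

text \<open>\<open>I32\<close> is the union of \<open>I2\<close> and \<open>P2\<close>. The part in
  \<open>P2\<close> already lies in \<open>L2\<close>, so complementing against \<open>I32\<close>
  gives the same \<open>L2\<close> as complementing against \<open>I2\<close>.\<close>

lemma l_fp: "fp qb l c e2"
proof (rule fpI)
  show "l \<cdot> qb = e2 \<cdot> c" by (rule l_qb)
  have e2x2: "img e2 \<inter> img x2 \<subseteq> img (x2 \<cdot> i2)" using fpD(10)[OF X1_right] by blast
  have "x2 \<cdot> i2 = (e2 \<cdot> c) \<cdot> kb" by (simp add: c_kb fpD(9)[OF X1_right])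
  then have sub: "img (x2 \<cdot> i2) \<subseteq> img (e2 \<cdot> c)" using img_comp_sub[of kb "e2 \<cdot> c"] by simp
  have "img e2 \<inter> img l \<subseteq> img e2 \<inter> cl X1 (img (e2 \<cdot> c) \<union> img x2)"
    using bc_cover_img[OF I32_bc, of l X1] unfolding l_qb l_rb by auto
  also have "\<dots> \<subseteq> cl X1 (img e2 \<inter> (img (e2 \<cdot> c) \<union> img x2))"
    using img_pts[of x2] img_pts[of "e2 \<cdot> c"] by (intro Int_cl sieve_Un) simp_all
  also have "\<dots> \<subseteq> img (e2 \<cdot> c)" by (rule cl_least) (use e2x2 sub in auto)
  finally show "img e2 \<inter> img l \<subseteq> img (l \<cdot> qb)" unfolding l_qb .
  fix U assume U: "U \<in> Sub (Cod C l)" "U \<inter> img l \<subseteq> img (l \<cdot> qb)"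
  have "img x2 \<subseteq> img l" using img_comp_sub[of rb l] l_rb by simp
  moreover have "img (e2 \<cdot> c) \<subseteq> img e2" by (rule img_comp_sub) simp_all
  ultimately have "U \<inter> img x2 \<subseteq> img (x2 \<cdot> i2)" using U(2) e2x2 unfolding l_qb by blast
  then show "U \<subseteq> img e2" using fp_iff[OF X1_right, of U] U(1) by simp
qed simp_all

text \<open>\<open>Z\<close> lies in both \<open>N'\<close> and \<open>L2\<close>, hence in their
  intersection \<open>P2\<close>, and therefore reaches \<open>X1\<close> through
  \<open>I32\<close>.\<close>

lemma X1_cover': "pts X1 \<subseteq> cl X1 (img l \<union> img x1)"
proof -
  let ?S = "img l \<union> img x1"
  have "jj \<cdot> (n3 \<cdot> z3) = g2 \<cdot> z2"
    by (simp add: reassoc1[OF jj_n3] pbD(9)[OF Z_pb])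
  then obtain w where w: "w \<in> MM C" "Cod C w = Dom C db" "z2 = c \<cdot> w"
    by (rule pb_point[OF P2_pb, of "n3 \<cdot> z3" z2, rotated 4]) (blast, simp_all)
  then have "z2 \<in> img c" by (simp add: imgI)
  then have "e2 \<cdot> z2 \<in> img (e2 \<cdot> c)" by (simp add: img_comp_iff)
  then have "img (e2 \<cdot> z2) \<subseteq> img (l \<cdot> qb)" unfolding l_qb by (simp add: img_subset_iff)
  also have "\<dots> \<subseteq> img l" by (rule img_comp_sub) simp_all
  finally have "img (e2 \<cdot> z2) \<subseteq> cl X1 ?S" by (intro cl_supI) auto
  moreover have "img x2 \<subseteq> cl X1 ?S" by (rule img_sub_cl[OF _ _ l_rb]) simp_all
  moreover have "img x1 \<subseteq> cl X1 ?S" by (intro cl_supI) auto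
  ultimately show ?thesis using X1_cover cl_trans[of "img x1 \<union> img x2 \<union> img (e2 \<cdot> z2)" X1 ?S] by blast
qed

end

section \<open>Transport along isomorphisms and inner contexts\<close>

context sqpo_category
begin

lemma bc_corner_iso:
  assumes b: "bc f g h k" and u: "iso_arrow C u" "mor u D' (Dom C k)" and g': "mor g' (Dom C f) D'" "u \<cdot>
      g' = g"
  shows "bc f g' h (k \<cdot> u)"
proof -
  note [simp] = bcD(1-4)[OF b] bcD(6)[OF b] bcD(8)[OF b, symmetric] u(2) g'(1)
  have "pb f g' h (k \<cdot> u)"
  proof (rule pbI)
    show "h \<cdot> f = k \<cdot> u \<cdot> g'" by (simp add: g'(2) bcD(9)[OF b])
    fix x y assume x: "x \<in> MM C" "y \<in> MM C" "Cod C x = Dom C h" "Cod C y = Dom C (k \<cdot> u)" "h \<cdot> x = (k \<cdot>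
        u) \<cdot> y"
    note [simp] = x(1,2,3) x(4)[simplified]
    obtain w where "w \<in> MM C" "Cod C w = Dom C f" "x = f \<cdot> w"
      by (rule pb_point[OF bcD(11)[OF b], of x "u \<cdot> y"]) (use x(5) in simp_all)
    then show "x \<in> img f" by blast
  qed simp_all
  moreover have "img (k \<cdot> u) = img k"
    using img_iso[OF u(1)] by (simp add: img_comp) (auto simp: img_def)
  ultimately show ?thesis unfolding bc_def using bcD(12)[OF b] by simp
qed

lemma pb_precomp_iso:
  assumes p: "pb f g h k" and u: "iso_arrow C u" "Cod C u = Dom C f"
  shows "pb (f \<cdot> u) (g \<cdot> u) h k"
  by (rule pullback_pb[OF pullback_precomp_iso[OF pb_pullback[OF p] u] pbD(3,4)[OF p]])

lemma deriv_iso: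
  assumes D: "deriv ro (u \<cdot> ri) p n" and u: "iso_arrow C u" "mor u I I'" and t: "mor ro K L" "mor ri K I"
  shows "deriv ro ri (p \<cdot> u) n"
proof -
  note [simp] = t u(2)
  have [simp]: "L \<in> Obj C" "I \<in> Obj C" using Obj_mor[OF t(1)] Obj_mor[OF t(2)] by blast+
  have "bc ro (Idn C K) (Idn C L) ro" using bc_Idn[of ro] by simp
  moreover have "fp ri u (Idn C K) (u \<cdot> ri)" 
    using bc_fp[OF bc_postcomp_iso[OF bc_Idn[of ri] u(1)]] by simp
  ultimately have "deriv ro ri (p \<cdot> u) (n \<cdot> Idn C L)" using D by (rule deriv_comp)
  moreover have "n \<cdot> Idn C L = n" using deriv_types[OF D] by simp
  ultimately show ?thesis by simp
qed

end

locale triAB = triA + triB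

context triA
begin

text \<open>Aligns \<open>V\<close> with a prescribed pushout complement \<open>d\<close> of the
  match \<open>h\<close>: complements have equal images, so the intersection is reparametrised by an
  isomorphism.\<close>

lemma V_ex':
  assumes b: "bc (q2 \<cdot> l2) s h d" and t: "mor s W V" "mor d V X2"
  obtains a1 b1 b2 where "mor a1 M1 L1" "mor b1 V L1" "mor b2 V L2"
    "e1 \<cdot> a1 = j \<cdot> d1" "a1 \<cdot> k1 = f1" "bc d1 a1 j e1" "pb b1 b2 e1 e2" "g2 \<cdot> b2 = d"
    "bc l2 s a2 b2" "bc l1 s a1 b1" "bc (d2 \<cdot> l2) s j (e2 \<cdot> b2)"
proof -
  obtain a1 V0 b1 b2 s0 where m: "mor a1 M1 L1" "mor b1 V0 L1" "mor b2 V0 L2" "mor s0 W V0"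
    and a1: "e1 \<cdot> a1 = j \<cdot> d1" "a1 \<cdot> k1 = f1" "bc d1 a1 j e1" and V: "pb b1 b2 e1 e2"
    and B: "bc l2 s0 a2 b2" "bc l1 s0 a1 b1" "bc (q2 \<cdot> l2) s0 h (g2 \<cdot> b2)" "bc (d2 \<cdot> l2) s0 j (e2 \<cdot> b2)"
    by (rule V_ex)
  note [simp] = m t
  have "img d = img (g2 \<cdot> b2)" by (rule fp_image_unique[OF bc_fp[OF B(3)] bc_fp[OF b]])
  then obtain u where u: "iso_arrow C u" "mor u V V0" "(g2 \<cdot> b2) \<cdot> u = d"
    by (rule same_img_iso[of d V X2 "g2 \<cdot> b2" V0, rotated 2]) (blast, simp, simp)
  note [simp] = u(2)
  have "(g2 \<cdot> b2) \<cdot> (u \<cdot> s) = (g2 \<cdot> b2) \<cdot> s0"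
    unfolding bcD(9)[OF B(3), symmetric] bcD(9)[OF b] u(3)[symmetric] by simp
  then have us: "u \<cdot> s = s0" by (simp add: cancel)
  show ?thesis
  proof (rule that[of a1 "b1 \<cdot> u" "b2 \<cdot> u"])
    show "pb (b1 \<cdot> u) (b2 \<cdot> u) e1 e2" by (rule pb_precomp_iso[OF V u(1)]) simp
    show "bc l2 s a2 (b2 \<cdot> u)" by (rule bc_corner_iso[OF B(1) u(1), of V]) (simp_all add: us)
    show "bc l1 s a1 (b1 \<cdot> u)" by (rule bc_corner_iso[OF B(2) u(1), of V]) (simp_all add: us)
    have "bc (d2 \<cdot> l2) s j ((e2 \<cdot> b2) \<cdot> u)" by (rule bc_corner_iso[OF B(4) u(1), of V]) (simp_all add: us)
    then show "bc (d2 \<cdot> l2) s j (e2 \<cdot> (b2 \<cdot> u))" by simp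
    show "g2 \<cdot> (b2 \<cdot> u) = d" using u(3) by simp
  qed (use a1 in simp_all)
qed

end

context triB
begin

text \<open>The context \<open>D\<close> of the composite of the last two rules at \<open>l\<close>
  is the intersection of \<open>L2\<close> with the third rule's context \<open>E3\<close>. That
  intersection lives in \<open>X2\<close>, although \<open>D\<close> is a subobject of
  \<open>X1\<close>.\<close>

lemma D_ex:
  assumes F3: "fp i3 x3 ka da" and tE: "mor ka K3 E3" "mor da E3 X2"
    and FD: "fp (qb \<cdot> mb) l kk dd" and tD: "mor kk W' D" "mor dd D X1"
  obtains a3 v1 v3 where "mor a3 P3 E3" "mor v1 D L2" "mor v3 D E3" "a3 \<cdot> k3 = ka" "pb v1 v3 g2 da"
    "e2 \<cdot> v1 = dd" "bc m3 kk a3 v3"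
proof -
  note [simp] = tE tD
  obtain a3 where a3: "mor a3 P3 E3" "da \<cdot> a3 = jj \<cdot> d3" "a3 \<cdot> k3 = ka" and Pa: "pb d3 a3 jj da"
    by (rule fp_restrict[OF F3 N'_right _ jj_n3[symmetric]]) (simp, simp)
  obtain U u1 u3 where PU: "pb u1 u3 g2 da" and tU: "mor u1 U L2" "mor u3 U E3"
    by (rule pb_ex[of g2 L2 X2 da E3]) (simp, simp, blast)
  note [simp] = a3(1) tU
  note ge = pbD(9)[OF PU] and we = pbD(9)[OF W'_pb] and p2e = pbD(9)[OF P2_pb]
  have "g2 \<cdot> (c \<cdot> mb) = da \<cdot> (a3 \<cdot> m3)"
    by (simp add: reassoc[OF g2_c] we[symmetric] reassoc[OF a3(2)])
  then obtain ku where ku: "ku \<in> MM C" "Cod C ku = Dom C u1" "Dom C ku = Dom C (c \<cdot> mb)" "c \<cdot> mb = u1 \<cdot>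
      ku" "a3 \<cdot> m3 = u3 \<cdot> ku"
    by (rule pb_point[OF PU, of "c \<cdot> mb" "a3 \<cdot> m3", rotated 4]) (blast, simp_all)
  have [simp]: "ku \<in> MM C" "Cod C ku = U" "Dom C ku = W'" using ku(1-3) by simp_all
  have leq: "l \<cdot> (qb \<cdot> mb) = e2 \<cdot> (c \<cdot> mb)" by (simp add: reassoc[OF l_qb])
  \<comment> \<open>Finality in two stages: \<open>l_fp\<close> puts a test subobject of
    \<open>X1\<close> inside \<open>L2\<close>, and from there it is carried to \<open>X2\<close>
    and tested against \<open>E3\<close>.\<close>
  have FU: "fp (qb \<cdot> mb) l ku (e2 \<cdot> u1)"
  proof (rule fpI)
    show "l \<cdot> (qb \<cdot> mb) = e2 \<cdot> u1 \<cdot> ku" by (simp add: leq ku(4))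
    show "img (e2 \<cdot> u1) \<inter> img l \<subseteq> img (l \<cdot> (qb \<cdot> mb))"
    proof
      fix z assume z: "z \<in> img (e2 \<cdot> u1) \<inter> img l"
      obtain x where x: "x \<in> MM C" "Cod C x = U" "z = e2 \<cdot> (u1 \<cdot> x)" using z by auto
      note [simp] = x(1,2)
      have "z \<in> img e2 \<inter> img l" using z img_comp_sub[of u1 e2] by auto
      then have "e2 \<cdot> (u1 \<cdot> x) \<in> img (e2 \<cdot> c)" using fpD(10)[OF l_fp] x(3) unfolding l_qb by simp
      then have "u1 \<cdot> x \<in> img c" by (simp add: img_comp_iff)
      then obtain w where w: "w \<in> MM C" "Cod C w = P2" "u1 \<cdot> x = c \<cdot> w" by auto
      note [simp] = w(1,2)
      have "jj \<cdot> (db \<cdot> w) = da \<cdot> (u3 \<cdot> x)"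
        by (simp add: reassoc[OF g2_c[symmetric]] w(3)[symmetric] reassoc[OF ge])
      then obtain v where v: "v \<in> MM C" "Cod C v = Dom C d3" "db \<cdot> w = d3 \<cdot> v"
        by (rule pb_point[OF Pa, of "db \<cdot> w" "u3 \<cdot> x", rotated 4]) (blast, simp_all)
      obtain r where r: "r \<in> MM C" "Cod C r = Dom C m3" "v = m3 \<cdot> r" "w = mb \<cdot> r"
        by (rule pb_point[OF W'_pb, of v w]) (use v in simp_all)
      have "z = (l \<cdot> (qb \<cdot> mb)) \<cdot> r" unfolding x(3) w(3) using r(1,2) by (simp add: r(4) reassoc[OF l_qb])
      then show "z \<in> img (l \<cdot> (qb \<cdot> mb))" using imgI[of r "l \<cdot> (qb \<cdot> mb)"] r(1,2) by simp
    qed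
    fix S assume S: "S \<in> Sub (Cod C l)" "S \<inter> img l \<subseteq> img (l \<cdot> (qb \<cdot> mb))"
    have "img ((l \<cdot> qb) \<cdot> mb) \<subseteq> img (l \<cdot> qb)" by (rule img_comp_sub) simp_all
    then have "S \<inter> img l \<subseteq> img (l \<cdot> qb)" using S(2) by auto
    then have "S \<subseteq> img e2" using fp_iff[OF l_fp S(1)] by simp
    moreover obtain s where s: "s \<in> MM C" "Cod C s = Cod C l" "S = img s" using S(1) by (metis SubE)
    ultimately have "s \<in> img e2" by (simp add: img_subset_iff)
    then obtain v where v: "mor v (Dom C s) L2" "e2 \<cdot> v = s"
      by (rule factor[of s e2 "Dom C s" X1 L2]) (use s(1,2) in \<open>simp, simp, blast\<close>)
    note [simp] = v(1)
    have "img (g2 \<cdot> v) \<subseteq> img da"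
    proof (subst fp_iff[OF F3, symmetric])
      show "img (g2 \<cdot> v) \<inter> img x3 \<subseteq> img (x3 \<cdot> i3)"
      proof
        fix z assume z: "z \<in> img (g2 \<cdot> v) \<inter> img x3"
        obtain a where a: "a \<in> MM C" "Cod C a = Dom C s" "z = g2 \<cdot> (v \<cdot> a)" using z by auto
        note [simp] = a(1,2)
        obtain r where r: "r \<in> MM C" "Cod C r = I3" "z = x3 \<cdot> r" using z by auto
        note [simp] = r(1,2)
        have "jj \<cdot> (n3 \<cdot> r) = g2 \<cdot> (v \<cdot> a)" using a(3) r(3) by (simp add: reassoc1[OF jj_n3])
        then obtain w where w: "w \<in> MM C" "Cod C w = Dom C db" "n3 \<cdot> r = db \<cdot> w" "v \<cdot> a = c \<cdot> w"
          by (rule pb_point[OF P2_pb, of "n3 \<cdot> r" "v \<cdot> a", rotated 4]) (blast, simp_all)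
        have [simp]: "w \<in> MM C" "Cod C w = P2" using w(1,2) by simp_all
        have "s \<cdot> a = l \<cdot> (qb \<cdot> w)"
          using s(1,2) by (simp add: reassoc1[OF v(2), symmetric] w(4) reassoc[OF l_qb])
        moreover have "s \<cdot> a \<in> img s" using s(1) by (intro imgI) simp_all
        ultimately have "l \<cdot> (qb \<cdot> w) \<in> S \<inter> img l" using s(3) imgI[of "qb \<cdot> w" l] by simp
        then have "l \<cdot> (qb \<cdot> w) \<in> img (l \<cdot> (qb \<cdot> mb))" using S(2) by blast
        then have "w \<in> img mb" by (simp add: img_comp_iff)
        then obtain w' where w': "w' \<in> MM C" "Cod C w' = W'" "w = mb \<cdot> w'" by auto
        note [simp] = w'(1,2)
        have "n3 \<cdot> r = d3 \<cdot> (m3 \<cdot> w')" by (simp add: w(3) w'(3) reassoc[OF we])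
        then have "n3 \<cdot> r \<in> img d3 \<inter> img n3" using imgI[of "m3 \<cdot> w'" d3] imgI[of r n3] by simp
        then have "n3 \<cdot> r \<in> img (n3 \<cdot> i3)" using fpD(10)[OF N'_right] by blast
        then have "r \<in> img i3" by (simp add: img_comp_iff)
        then show "z \<in> img (x3 \<cdot> i3)" unfolding r(3) by (simp add: img_comp_iff)
      qed
    qed simp
    then have "g2 \<cdot> v \<in> img g2 \<inter> img da" by (simp add: img_subset_iff imgI)
    then have "g2 \<cdot> v \<in> img (g2 \<cdot> u1)" using pbD(10)[OF PU] by blast
    then have "v \<in> img u1" by (simp add: img_comp_iff)
    then have "s \<in> img (e2 \<cdot> u1)" unfolding v(2)[symmetric] by (simp add: img_comp_iff)
    then show "S \<subseteq> img (e2 \<cdot> u1)" unfolding s(3) using s(1) by (simp add: img_subset_iff)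
  qed simp_all
  have "img dd = img (e2 \<cdot> u1)" by (rule fp_image_unique[OF FU FD])
  then obtain u where u: "iso_arrow C u" "mor u D U" "(e2 \<cdot> u1) \<cdot> u = dd"
    by (rule same_img_iso[of dd D X1 "e2 \<cdot> u1" U, rotated 2]) (blast, simp, simp)
  note [simp] = u(2)
  have PV: "pb (u1 \<cdot> u) (u3 \<cdot> u) g2 da" by (rule pb_precomp_iso[OF PU u(1)]) simp
  \<comment> \<open>The union \<open>X2\<close> of \<open>N'\<close> and \<open>L2\<close> is
    intersected with \<open>E3\<close>, giving \<open>E3\<close> as the union of \<open>P3\<close>
    and \<open>D\<close>.\<close>
  obtain \<kappa> where k: "mor \<kappa> W' D" "a3 \<cdot> m3 = (u3 \<cdot> u) \<cdot> \<kappa>" "c \<cdot> mb = (u1 \<cdot> u) \<cdot> \<kappa>" "bc m3 \<kappa> a3 (u3 \<cdot> u)"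
    by (rule bc_cube[OF jj_bc pb_flip[OF Pa] pb_flip[OF PV] W'_pb]) (simp, simp, simp, simp, simp, simp,
        simp, simp, simp, simp, simp)
  note [simp] = k(1)
  have "dd \<cdot> \<kappa> = e2 \<cdot> (c \<cdot> mb)" unfolding u(3)[symmetric] k(3) by simp
  then have "dd \<cdot> \<kappa> = dd \<cdot> kk" using fpD(9)[OF FD] leq by simp
  then have "\<kappa> = kk" by (simp add: cancel)
  then have "bc m3 kk a3 (u3 \<cdot> u)" using k(4) by simp
  moreover have "e2 \<cdot> (u1 \<cdot> u) = dd" using u(3) by simp
  ultimately show ?thesis using that[of a3 "u1 \<cdot> u" "u3 \<cdot> u"] a3 PV by simp
qed

end

section \<open>Comparison of the two nested composites\<close>

context triAB
begin

text \<open>The assumptions \<open>A\<close> describe the composite of the third rule with the first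
  two, \<open>B\<close> that of the last two with the first. All comparison arrows arise by
  recognising both sides as one construction on \<open>L1\<close>, \<open>L2\<close> and
  \<open>E3\<close>.\<close>

lemma composites:
  assumes A: "fp i3 x3 ka da" "bc (q2 \<cdot> l2) s h dl" "bc o3 ka pa qa" "bc s (q1 \<cdot> l1) Q P" "pb s3 s1 da dl"
    and tA: "mor ka K3 E3" "mor da E3 X2" "mor s W V" "mor dl V X2" "mor pa O3 X3" "mor qa E3 X3"
      "mor Q V X0" "mor P I21 X0" "mor s3 S E3" "mor s1 S V"
    and B: "fp (qb \<cdot> mb) l kk dd" "bc (q3 \<cdot> m3) kk P' Q'" "bc f1 i1 qB pB" "pb r2 r1 dd e1"
    and tB: "mor kk W' D" "mor dd D X1" "mor P' O32 X3'" "mor Q' D X3'" "mor qB L1 X0'" "mor pB I1 X0'"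
      "mor r2 R D" "mor r1 R L1"
  obtains uO uK uI where "iso_arrow C uO" "mor uO X3 X3'" "iso_arrow C uK" "mor uK S R" "iso_arrow C uI"
      "mor uI X0 X0'"
    "uO \<cdot> (qa \<cdot> s3) = (Q' \<cdot> r2) \<cdot> uK" "uI \<cdot> (Q \<cdot> s1) = (qB \<cdot> r1) \<cdot> uK" "uI \<cdot> (P \<cdot> p1) = pB"
    "\<And>p Y. mor p X0' Y \<Longrightarrow> \<exists>n n'. mor n X1 (Cod C n) \<and> mor n' X2 (Cod C n') \<and> deriv dl Q (p \<cdot> uI) n' \<and>
        deriv d1 q1 ((p \<cdot> uI) \<cdot> P) (n \<cdot> j) \<and> deriv e1 qB p n \<and> deriv db qb (n \<cdot> l) (n' \<cdot> jj)"
proof -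
  note [simp] = tA tB
  obtain a1 b1 b2 where t1: "mor a1 M1 L1" "mor b1 V L1" "mor b2 V L2"
    and a1: "e1 \<cdot> a1 = j \<cdot> d1" "a1 \<cdot> k1 = f1" "bc d1 a1 j e1" and PV: "pb b1 b2 e1 e2" and g2b2: "g2 \<cdot> b2
        = dl"
    and B1: "bc l2 s a2 b2" "bc l1 s a1 b1"
    by (rule V_ex'[OF A(2) tA(3,4)])
  obtain a3 v1 v3 where t3: "mor a3 P3 E3" "mor v1 D L2" "mor v3 D E3" and a3: "a3 \<cdot> k3 = ka"
    and PD: "pb v1 v3 g2 da" and e2v1: "e2 \<cdot> v1 = dd" and B3: "bc m3 kk a3 v3"
    by (rule D_ex[OF A(1) tA(1,2) B(1) tB(1,2)])
  note [simp] = t1 t3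
  \<comment> \<open>Both outputs turn out to be pushouts of \<open>O3\<close> and \<open>E3\<close>
    along \<open>K3\<close>, and below both inputs are pushouts of \<open>I1\<close> and
    \<open>L1\<close> along \<open>K1\<close>.\<close>
  obtain z where z: "mor z E3 X3'" "z \<cdot> v3 = Q'" "bc q3 a3 P' z"
    by (rule bc_split[OF B3 B(2)]) (simp, simp, simp)
  have "bc o3 (a3 \<cdot> k3) (P' \<cdot> p3) z" using bc_flip[OF bc_paste[OF bc_flip[OF O32_bc] bc_flip[OF z(3)]]] .
  then have "bc o3 ka (P' \<cdot> p3) z" unfolding a3 .
  then obtain uO where uO: "iso_arrow C uO" "mor uO X3 X3'" "uO \<cdot> qa = z"
    by (rule bc_unique[OF A(3)]) simp
  obtain z0 where z0: "mor z0 L1 X0" "z0 \<cdot> b1 = Q" "bc q1 a1 P z0"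
    by (rule bc_split[OF B1(2) bc_flip[OF A(4)]]) (simp, simp, simp)
  note [simp] = z(1) z0(1) uO(2)
  have "bc i1 (a1 \<cdot> k1) (P \<cdot> p1) z0"
    using bc_flip[OF bc_paste[OF I21_bc bc_flip[OF z0(3)]]] .
  then have "bc f1 i1 z0 (P \<cdot> p1)" unfolding a1(2) by (rule bc_flip)
  then obtain uI where uI: "iso_arrow C uI" "mor uI X0 X0'" "uI \<cdot> z0 = qB" "uI \<cdot> (P \<cdot> p1) = pB"
    by (rule bc_unique[OF _ B(3)]) simp
  note [simp] = uI(2)
  \<comment> \<open>\<open>S\<close> and \<open>R\<close> are bracketings of the intersection of
    \<open>E3\<close>, \<open>L2\<close> and \<open>L1\<close>. The first two meet in
    \<open>X2\<close> and the last two in \<open>X1\<close>, so the factorizations pass through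
    \<open>L2\<close>.\<close>
  have "g2 \<cdot> (b2 \<cdot> s1) = da \<cdot> s3" by (simp add: reassoc1[OF g2b2] pbD(9)[OF A(5)])
  then obtain x where x: "x \<in> MM C" "Cod C x = Dom C v1" "Dom C x = Dom C (b2 \<cdot> s1)" "b2 \<cdot> s1 = v1 \<cdot> x"
      "s3 = v3 \<cdot> x"
    by (rule pb_point[OF PD, of "b2 \<cdot> s1" s3, rotated 4]) (blast, simp_all)
  have [simp]: "x \<in> MM C" "Cod C x = D" "Dom C x = S" using x(1-3) by simp_all
  have "dd \<cdot> x = e1 \<cdot> (b1 \<cdot> s1)"
    by (simp add: e2v1[symmetric] x(4)[symmetric] reassoc[OF pbD(9)[OF PV]] del: tB)
  then obtain uK where uK: "uK \<in> MM C" "Cod C uK = Dom C r2" "Dom C uK = Dom C x" "x = r2 \<cdot> uK" "b1 \<cdot> s1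
      = r1 \<cdot> uK"
    by (rule pb_point[OF B(4), of x "b1 \<cdot> s1", rotated 4]) (blast, simp_all)
  have [simp]: "uK \<in> MM C" "Cod C uK = R" "Dom C uK = S" using uK(1-3) by simp_all
  have "e1 \<cdot> r1 = e2 \<cdot> (v1 \<cdot> r2)" by (simp add: reassoc1[OF e2v1] pbD(9)[OF B(4)])
  then obtain y where y: "y \<in> MM C" "Cod C y = Dom C b1" "Dom C y = Dom C r1" "r1 = b1 \<cdot> y" "v1 \<cdot> r2 = b2 \<cdot> y"
    by (rule pb_point[OF PV, of r1 "v1 \<cdot> r2", rotated 4]) (blast, simp_all)
  have [simp]: "y \<in> MM C" "Cod C y = V" "Dom C y = R" using y(1-3) by simp_all
  have "da \<cdot> (v3 \<cdot> r2) = dl \<cdot> y"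
    by (simp add: reassoc[OF pbD(9)[OF PD, symmetric]] y(5) reassoc1[OF g2b2])
  then obtain v where v: "v \<in> MM C" "Cod C v = Dom C s3" "Dom C v = Dom C (v3 \<cdot> r2)" "y = s1 \<cdot> v"
    by (rule pb_point[OF A(5), of "v3 \<cdot> r2" y, rotated 4]) (blast, simp_all)
  have [simp]: "v \<in> MM C" "Cod C v = S" "Dom C v = R" using v(1-3) by simp_all
  have [simp]: "R \<in> Obj C" "S \<in> Obj C" using Obj_mor[OF tB(7)] Obj_mor[OF tA(9)] by blast+
  have "r1 \<cdot> (uK \<cdot> v) = r1 \<cdot> Idn C R"
    by (simp add: reassoc[OF uK(5)[symmetric]] v(4)[symmetric] y(4)[symmetric])
  then have i1: "uK \<cdot> v = Idn C R" by (simp add: cancel del: comp_Idn)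
  have "b1 \<cdot> (s1 \<cdot> (v \<cdot> uK)) = b1 \<cdot> s1"
    by (simp add: uK(5) reassoc1[OF v(4)[symmetric]] reassoc1[OF y(4)[symmetric]])
  then have "s1 \<cdot> (v \<cdot> uK) = s1 \<cdot> Idn C S" by (simp add: cancel)
  then have i2: "v \<cdot> uK = Idn C S" by (simp add: cancel del: comp_Idn)
  have isoK: "iso_arrow C uK" by (rule isoI[of uK v]) (simp_all add: i1 i2)
  show ?thesis
  proof (rule that[OF uO(1,2) isoK _ uI(1,2)])
    show "mor uK S R" by simp
    have "uO \<cdot> (qa \<cdot> s3) = z \<cdot> (v3 \<cdot> x)" by (simp add: reassoc1[OF uO(3)] x(5)[symmetric])
    also have "\<dots> = Q' \<cdot> (r2 \<cdot> uK)" by (simp add: reassoc1[OF z(2)] uK(4)[symmetric])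
    finally show "uO \<cdot> (qa \<cdot> s3) = (Q' \<cdot> r2) \<cdot> uK" by simp
    have "uI \<cdot> (Q \<cdot> s1) = uI \<cdot> (z0 \<cdot> (b1 \<cdot> s1))" by (simp add: reassoc1[OF z0(2)])
    also have "\<dots> = qB \<cdot> (r1 \<cdot> uK)" by (simp add: reassoc1[OF uI(3)] uK(5))
    finally show "uI \<cdot> (Q \<cdot> s1) = (qB \<cdot> r1) \<cdot> uK" by simp
    show "uI \<cdot> (P \<cdot> p1) = pB" by (rule uI)
    fix p Y assume p [simp]: "mor p X0' Y"
    \<comment> \<open>The two steps through \<open>X1\<close> and \<open>X2\<close> are performed
      one after the other. The derivations occurring in the nested conditions are obtained from them
      by isomorphism, sequential composition and pasting.\<close>
    obtain Y1 n where n: "mor n X1 Y1" "deriv e1 qB p n" by (rule deriv_ex[OF tri_mor(4) tB(5) p])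
    obtain Y2 n' where n': "mor n' X2 Y2" "deriv g2 e2 n n'" by (rule deriv_ex[OF tri_mor(8,6) n(1)])
    have D0: "deriv e1 z0 (p \<cdot> uI) n"
      by (rule deriv_iso[OF _ uI(1,2) tri_mor(4) z0(1)]) (simp add: uI(3) n(2))
    have "deriv (g2 \<cdot> b2) (z0 \<cdot> b1) (p \<cdot> uI) n'"
      by (rule deriv_seq[OF D0 n'(2) PV tri_mor(4) z0(1) _ n(1) tri_mor(6,8) n'(1) t1(2,3), of Y]) simp
    then have "deriv dl Q (p \<cdot> uI) n'" unfolding g2b2 z0(2) .
    moreover have "deriv d1 q1 ((p \<cdot> uI) \<cdot> P) (n \<cdot> j)" by (rule deriv_comp[OF a1(3) bc_fp[OF z0(3)] D0])
    moreover have "deriv db qb (n \<cdot> l) (n' \<cdot> jj)" by (rule deriv_comp[OF jj_bc l_fp n'(2)])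
    moreover have "mor n X1 (Cod C n)" "mor n' X2 (Cod C n')" using n(1) n'(1) by blast+
    ultimately show "\<exists>n n'. mor n X1 (Cod C n) \<and> mor n' X2 (Cod C n') \<and> deriv dl Q (p \<cdot> uI) n' \<and>
        deriv d1 q1 ((p \<cdot> uI) \<cdot> P) (n \<cdot> j) \<and> deriv e1 qB p n \<and> deriv db qb (n \<cdot> l) (n' \<cdot> jj)"
      using n(2) by blast
  qed
qed

end

section \<open>Completing data to derivation triples\<close>

context sqpo_category
begin

text \<open>Any covering pair becomes a pushout once its pullback is added, so its legs are jointly
  epic.\<close>

lemma cover_joint:
  assumes h: "mor h B X" and k: "mor k D X" and c: "pts X \<subseteq> cl X (img h \<union> img k)"
    and s: "s \<in> Arr C" "Dom C s = X" and t: "t \<in> Arr C" "Dom C t = X" and e: "s \<cdot> h = t \<cdot> h" "s \<cdot> k = t \<cdot> k"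
  shows "s = t"
proof -
  obtain P f g where "pb f g h k" by (rule pb_ex[OF h k]) blast
  then have "bc f g h k" using c h unfolding bc_def by simp
  then show ?thesis using s t e h by (intro bc_joint[of f g h k s t]) simp_all
qed

end

locale tri21 = derivation_triple + composite21
locale tri32 = derivation_triple + composite32

context tri21
begin

lemma triA_ex:
  assumes j: "mor j N X1" "j \<cdot> n2 = x2" "j \<cdot> n1 = x1"
  obtains a2 h where "triA C O1 K1 I1 O2 K2 I2 O3 K3 I3 o1 i1 o2 i2 o3 i3 X1 X2 L1 L2 Z x1 x2 f1 e1 f2 e2
      y2 g2 x3 z3 z2
    N M2 M1 O21 I21 W n2 n1 k2 d2 k1 d1 p2 q2 q1 p1 l2 l1 j a2 h"
proof -
  note [simp] = j(1)
  obtain a2 where a2: "mor a2 (Dom C d2) (Dom C e2)" "e2 \<cdot> a2 = j \<cdot> d2" "a2 \<cdot> k2 = f2"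
    by (rule fp_restrict[OF X1_right N_right _ j(2)[symmetric]]) (simp, blast)
  have [simp]: "mor a2 M2 L2" using a2(1) by simp
  obtain h where h: "mor h (Cod C q2) (Cod C g2)" "h \<cdot> p2 = y2" "h \<cdot> q2 = g2 \<cdot> a2"
    by (rule bc_split[OF bc_flip[OF O21_bc], of a2 g2 y2]) (use bc_flip[OF X2_left] in \<open>simp_all add: a2(3)\<close>)
  have [simp]: "mor h O21 X2" using h(1) by simp
  show ?thesis
    by (rule that[of a2 h], unfold_locales) (simp_all add: j(2,3) a2(2) h(2,3))
qed

end

context tri32
begin

lemma triB_ex:
  assumes jj: "mor jj N' X2" "jj \<cdot> n3 = x3" "jj \<cdot> nb = y2"
  obtains c l where "triB C O1 K1 I1 O2 K2 I2 O3 K3 I3 o1 i1 o2 i2 o3 i3 X1 X2 L1 L2 Z x1 x2 f1 e1 f2 e2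
      y2 g2 x3 z3 z2
    N' P3 P2 O32 I32 W' n3 nb k3 d3 kb db p3 q3 qb rb m3 mb jj c l"
proof -
  note [simp] = jj(1)
  obtain c where c: "mor c (Dom C db) (Dom C g2)" "g2 \<cdot> c = jj \<cdot> db" "c \<cdot> kb = f2"
    by (rule poc_restrict[OF X2_left jj(3)[symmetric] _ N'_left]) (simp, blast)
  have [simp]: "mor c P2 L2" using c(1) by simp
  have eq: "(e2 \<cdot> c) \<cdot> kb = x2 \<cdot> i2" by (simp add: c(3) fpD(9)[OF X1_right])
  have sub: "img (e2 \<cdot> c) \<inter> img x2 \<subseteq> img ((e2 \<cdot> c) \<cdot> kb)"
    unfolding eq using fpD(10)[OF X1_right] img_comp_sub[of c e2] by auto
  obtain l where l: "mor l (Cod C qb) X1" "l \<cdot> qb = e2 \<cdot> c" "l \<cdot> rb = x2"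
    by (rule bc_univ[OF I32_bc _ _ eq sub, of X1]) (simp, simp, blast)
  have [simp]: "mor l I32 X1" using l(1) by simp
  show ?thesis
    by (rule that[of c l], unfold_locales) (simp_all add: jj(2,3) c(2) l(2,3))
qed

end

context composite21
begin

text \<open>Recovers the intermediate state from a match into the composite: the context
  \<open>V\<close> of that match is undisturbed material, and gluing it along \<open>W\<close> to
  \<open>N\<close>, \<open>M1\<close> and \<open>M2\<close> yields \<open>X1\<close>,
  \<open>L1\<close> and \<open>L2\<close>.\<close>

lemma tri_from_A:
  assumes x3: "mor x3 I3 X2" and h: "mor h O21 X2" and X2: "pts X2 \<subseteq> cl X2 (img x3 \<union> img h)"
    and b: "bc (q2 \<cdot> l2) s h d" and t: "mor s W V" "mor d V X2"
  obtains X1 L1 L2 Z x1 x2 f1 e1 f2 e2 y2 g2 z3 z2 j a2 where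
    "triA C O1 K1 I1 O2 K2 I2 O3 K3 I3 o1 i1 o2 i2 o3 i3 X1 X2 L1 L2 Z x1 x2 f1 e1 f2 e2 y2 g2 x3 z3 z2
      N M2 M1 O21 I21 W n2 n1 k2 d2 k1 d1 p2 q2 q1 p1 l2 l1 j a2 h"
proof -
  note [simp] = x3 h t
  obtain X1 j e where B: "bc (d2 \<cdot> l2) s j e" and tj: "mor j N X1" "mor e V X1"
    by (rule bc_ex[of "d2 \<cdot> l2" W N s V]) (simp, simp, blast)
  obtain L1 a1 b1 where B1: "bc l1 s a1 b1" and t1: "mor a1 M1 L1" "mor b1 V L1"
    by (rule bc_ex[of l1 W M1 s V]) (simp, simp, blast)
  obtain L2 a2 b2 where B2: "bc l2 s a2 b2" and t2: "mor a2 M2 L2" "mor b2 V L2"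
    by (rule bc_ex[of l2 W M2 s V]) (simp, simp, blast)
  note [simp] = tj t1 t2
  have we: "d2 \<cdot> l2 = d1 \<cdot> l1" by (rule pbD(9)[OF W_pb])
  obtain e1 where e1: "mor e1 L1 X1" "e1 \<cdot> b1 = e" "e1 \<cdot> a1 = j \<cdot> d1" "bc d1 a1 j e1"
    by (rule bc_split[OF B1 B[unfolded we]]) (simp, simp, simp)
  obtain e2 where e2: "mor e2 L2 X1" "e2 \<cdot> b2 = e" "e2 \<cdot> a2 = j \<cdot> d2" "bc d2 a2 j e2"
    by (rule bc_split[OF B2 B]) (simp, simp, simp)
  obtain g2 where g2: "mor g2 L2 X2" "g2 \<cdot> b2 = d" "g2 \<cdot> a2 = h \<cdot> q2" "bc q2 a2 h g2"
    by (rule bc_split[OF B2 b]) (simp, simp, simp)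
  note [simp] = e1(1) e2(1) g2(1)
  obtain Z z3 z2 where PZ: "pb z3 z2 x3 g2" and tz: "mor z3 Z I3" "mor z2 Z L2"
    by (rule pb_ex[of x3 I3 X2 g2 L2]) (simp, simp, blast)
  note [simp] = tz
  let ?S = "img (j \<cdot> n1) \<union> img (j \<cdot> n2) \<union> img (e2 \<cdot> z2)"
  have S: "?S \<subseteq> pts X1" using img_pts[of "j \<cdot> n1"] img_pts[of "j \<cdot> n2"] img_pts[of "e2 \<cdot> z2"] by simp
  have "img j \<subseteq> cl X1 (img (j \<cdot> n2) \<union> img (j \<cdot> n1))" by (rule cover_img[OF _ _ N_cover]) simp_all
  also have "\<dots> \<subseteq> cl X1 ?S" by (rule cl_mono) blast
  finally have jS: "img j \<subseteq> cl X1 ?S" .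
  \<comment> \<open>In \<open>X2\<close> the subobject \<open>L2\<close> meets \<open>I3\<close> in
    \<open>Z\<close> and \<open>O21\<close> in \<open>M2\<close>, so these two cover it;
    \<open>e2\<close> carries the cover to \<open>X1\<close>.\<close>
  have "img g2 \<subseteq> cl X2 ((img g2 \<inter> img x3) \<union> (img g2 \<inter> img h))"
    using X2 img_pts[of g2] img_pts[of x3] img_pts[of h] by (intro cover_Int) auto
  also have "\<dots> \<subseteq> cl X2 (img (g2 \<cdot> z2) \<union> img (g2 \<cdot> a2))"
    using pbD(10)[OF PZ] bcD(10)[OF g2(4)] unfolding pbD(9)[OF PZ] g2(3) by (intro cl_mono) blast
  finally have "pts L2 \<subseteq> cl L2 (img z2 \<union> img a2)" by (intro cover_reflect[of g2 L2 X2 z2 Z a2 M2]) simp_all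
  then have "img e2 \<subseteq> cl X1 (img (e2 \<cdot> z2) \<union> img (e2 \<cdot> a2))" by (intro cover_img[of z2 Z L2 a2 M2]) simp_all
  also have "\<dots> \<subseteq> cl X1 ?S"
  proof (rule cl_trans)
    have "img (e2 \<cdot> a2) \<subseteq> img j" unfolding e2(3) by (rule img_comp_sub) simp_all
    then show "img (e2 \<cdot> z2) \<union> img (e2 \<cdot> a2) \<subseteq> cl X1 ?S" using jS cl_sup[OF S] by blast
  qed
  finally have "img e2 \<subseteq> cl X1 ?S" .
  then have cov: "pts X1 \<subseteq> cl X1 ?S"
    using bcD(12)[OF e2(4)] cl_trans[of "img j \<union> img e2" X1 ?S] jS by auto
  have "bc o1 (a1 \<cdot> k1) (j \<cdot> n1) e1" using bc_flip[OF bc_paste[OF bc_flip[OF N_left] bc_flip[OF e1(4)]]] .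
  moreover have "fp i2 (j \<cdot> n2) (a2 \<cdot> k2) e2" by (rule fp_paste[OF N_right bc_fp[OF e2(4)]])
  moreover have "bc o2 (a2 \<cdot> k2) (h \<cdot> p2) g2" using bc_flip[OF bc_paste[OF bc_flip[OF O21_bc] bc_flip[OF
      g2(4)]]] .
  ultimately show ?thesis
    by (intro that[of X1 L1 L2 Z "j \<cdot> n1" "j \<cdot> n2" "a1 \<cdot> k1" e1 "a2 \<cdot> k2" e2 "h \<cdot> p2" g2 z3 z2 j a2],
        unfold_locales)
      (use PZ cov e2(3) g2(3) in simp_all)
qed

end

context composite32
begin

text \<open>Here \<open>X1\<close> is given. Complementing against \<open>I32\<close> determines
  \<open>L2\<close>, and gluing \<open>N'\<close> to it along \<open>P2\<close> produces
  \<open>X2\<close>.\<close>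

lemma tri_from_B:
  assumes l: "mor l I32 X1" and x1: "mor x1 O1 X1" and X1: "pts X1 \<subseteq> cl X1 (img l \<union> img x1)"
    and b: "bc o1 f1 x1 e1" and t: "mor f1 K1 L1" "mor e1 L1 X1"
  obtains X2 L2 Z x2 f2 e2 y2 g2 x3 z3 z2 jj c where
    "triB C O1 K1 I1 O2 K2 I2 O3 K3 I3 o1 i1 o2 i2 o3 i3 X1 X2 L1 L2 Z x1 x2 f1 e1 f2 e2 y2 g2 x3 z3 z2
      N' P3 P2 O32 I32 W' n3 nb k3 d3 kb db p3 q3 qb rb m3 mb jj c l"
proof -
  note [simp] = l x1 t
  obtain L2 c e2 where F: "fp qb l c e2" and tc: "mor c P2 L2" "mor e2 L2 X1"
    by (rule fp_ex[of qb P2 I32 l X1]) (simp, simp, blast)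
  note [simp] = tc
  obtain X2 jj g2 where B: "bc db c jj g2" and tj: "mor jj N' X2" "mor g2 L2 X2"
    by (rule bc_ex[of db P2 N' c L2]) (simp, simp, blast)
  note [simp] = tj
  obtain Z z3 z2 where PZ: "pb z3 z2 (jj \<cdot> n3) g2" and tz: "mor z3 Z I3" "mor z2 Z L2"
    by (rule pb_ex[of "jj \<cdot> n3" I3 X2 g2 L2]) (simp, simp, blast)
  note [simp] = tz
  have F2: "fp i2 (l \<cdot> rb) (c \<cdot> kb) e2" by (rule fp_paste[OF bc_fp[OF bc_flip[OF I32_bc]] F])
  have B2: "bc o2 (c \<cdot> kb) (jj \<cdot> nb) g2" using bc_flip[OF bc_paste[OF bc_flip[OF N'_left] bc_flip[OF B]]] .
  let ?S = "img x1 \<union> img (l \<cdot> rb) \<union> img (e2 \<cdot> z2)"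
  have S: "?S \<subseteq> pts X1" using img_pts[of x1] img_pts[of "l \<cdot> rb"] img_pts[of "e2 \<cdot> z2"] by simp
  obtain U u3 u2 where PU: "pb u3 u2 n3 db" and tu: "mor u3 U I3" "mor u2 U P2"
    by (rule pb_ex[of n3 I3 N' db P2]) (simp, simp, blast)
  note [simp] = tu
  \<comment> \<open>\<open>P2\<close> is covered by its intersection with \<open>I3\<close> and by
    \<open>K2\<close>. The former ends up in \<open>Z\<close> and the latter in \<open>I2\<close>,
    so the cover by \<open>I32\<close> and \<open>O1\<close> refines to the one a triple
    requires.\<close>
  have "img db \<subseteq> cl N' ((img db \<inter> img n3) \<union> (img db \<inter> img nb))"
    using N'_cover img_pts[of db] img_pts[of n3] img_pts[of nb] by (intro cover_Int) auto
  also have "\<dots> \<subseteq> cl N' (img (db \<cdot> u2) \<union> img (db \<cdot> kb))"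
    using pbD(10)[OF PU] bcD(10)[OF N'_left] unfolding pbD(9)[OF PU] bcD(9)[OF N'_left] by (intro
        cl_mono) blast
  finally have "pts P2 \<subseteq> cl P2 (img u2 \<union> img kb)" by (intro cover_reflect[of db P2 N' u2 U kb K2]) simp_all
  then have "img (e2 \<cdot> c) \<subseteq> cl X1 (img ((e2 \<cdot> c) \<cdot> u2) \<union> img ((e2 \<cdot> c) \<cdot> kb))"
    by (intro cover_img[of u2 U P2 kb K2]) simp_all
  also have "\<dots> \<subseteq> cl X1 ?S"
  proof (rule cl_mono)
    have "(jj \<cdot> n3) \<cdot> u3 = g2 \<cdot> (c \<cdot> u2)"
      by (simp add: pbD(9)[OF PU] reassoc[OF bcD(9)[OF B]])
    then obtain w where "w \<in> MM C" "Cod C w = Dom C z3" "c \<cdot> u2 = z2 \<cdot> w"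
      by (rule pb_point[OF PZ, of u3 "c \<cdot> u2", rotated 4]) (blast, simp_all)
    then have "c \<cdot> u2 \<in> img z2" by (simp add: imgI)
    then have "e2 \<cdot> (c \<cdot> u2) \<in> img (e2 \<cdot> z2)" by (simp add: img_comp_iff)
    then have 1: "img ((e2 \<cdot> c) \<cdot> u2) \<subseteq> img (e2 \<cdot> z2)" by (simp add: img_subset_iff)
    have "(l \<cdot> rb) \<cdot> i2 = (e2 \<cdot> c) \<cdot> kb" using fpD(9)[OF F2] by simp
    then have "img ((e2 \<cdot> c) \<cdot> kb) \<subseteq> img (l \<cdot> rb)" using img_comp_sub[of i2 "l \<cdot> rb"] by simp
    then show "img ((e2 \<cdot> c) \<cdot> u2) \<union> img ((e2 \<cdot> c) \<cdot> kb) \<subseteq> ?S" using 1 by blast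
  qed
  finally have ec: "img (e2 \<cdot> c) \<subseteq> cl X1 ?S" .
  have "img l \<subseteq> cl X1 (img (l \<cdot> qb) \<union> img (l \<cdot> rb))" by (rule bc_cover_img[OF I32_bc]) simp
  also have "\<dots> \<subseteq> cl X1 ?S"
    unfolding fpD(9)[OF F] by (rule cl_trans) (use ec cl_sup[OF S] in blast)
  finally have "img l \<union> img x1 \<subseteq> cl X1 ?S" using cl_sup[OF S] by blast
  then have cov: "pts X1 \<subseteq> cl X1 ?S" using X1 cl_trans by blast
  show ?thesis
    by (intro that[of X2 L2 Z "l \<cdot> rb" "c \<cdot> kb" e2 "jj \<cdot> nb" g2 "jj \<cdot> n3" z3 z2 jj c], unfold_locales)
      (use PZ cov b F2 B2 bcD(9)[OF B] fpD(9)[OF F] in simp_all)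
qed

end

section \<open>Comparison arrows between triples\<close>

locale triA_pair = composite21 C O1 K1 I1 O2 K2 I2 O3 K3 I3 o1 i1 o2 i2 o3 i3 N M2 M1 O21 I21 W n2 n1 k2
    d2 k1 d1 p2 q2 q1 p1 l2 l1 +
  A: triA C O1 K1 I1 O2 K2 I2 O3 K3 I3 o1 i1 o2 i2 o3 i3 X1 X2 L1 L2 Z x1 x2 f1 e1 f2 e2 y2 g2 x3 z3 z2
    N M2 M1 O21 I21 W n2 n1 k2 d2 k1 d1 p2 q2 q1 p1 l2 l1 j a2 h +
  A': triA C O1 K1 I1 O2 K2 I2 O3 K3 I3 o1 i1 o2 i2 o3 i3 X1' X2' L1' L2' Z' x1' x2' f1' e1' f2' e2' y2'
      g2' x3' z3' z2'
    N M2 M1 O21 I21 W n2 n1 k2 d2 k1 d1 p2 q2 q1 p1 l2 l1 j' a2' h'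
  for C :: "('o, 'm) mcat" (structure) and O1 K1 I1 O2 K2 I2 O3 K3 I3 o1 i1 o2 i2 o3 i3
    and X1 X2 L1 L2 Z x1 x2 f1 e1 f2 e2 y2 g2 x3 z3 z2
    and X1' X2' L1' L2' Z' x1' x2' f1' e1' f2' e2' y2' g2' x3' z3' z2'
    and N M2 M1 O21 I21 W n2 n1 k2 d2 k1 d1 p2 q2 q1 p1 l2 l1 j a2 h j' a2' h'
begin

text \<open>Equal match spans force the triples to be comparable. Only monic arrows in one direction
  are constructed, since these already preserve the pullback spans by which the other pair of
  matches is determined.\<close>

lemma triple_mor:
  assumes b: "bc \<mu>2 \<mu>1 x3 h" and b': "bc \<mu>2 \<mu>1 x3' h'"
  obtains u w v where "mor u X1 X1'" "mor w L2 L2'" "mor v X2 X2'"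
    "u \<cdot> x1 = x1'" "u \<cdot> x2 = x2'" "u \<cdot> e2 = e2' \<cdot> w" "v \<cdot> x3 = x3'" "v \<cdot> y2 = y2'" "v \<cdot> g2 = g2' \<cdot> w"
proof -
  obtain v where v: "mor v (Cod C x3) X2'" "v \<cdot> x3 = x3'" "v \<cdot> h = h'"
    by (rule bc_univ[OF b _ _ bcD(9)[OF b'] equalityD1[OF bcD(10)[OF b']], of X2']) (simp, simp, blast)
  have [simp]: "mor v X2 X2'" using v(1) by simp
  obtain V b1 b2 s where tV: "mor b1 V L1" "mor b2 V L2" "mor s W V"
    and B: "bc l2 s a2 b2" "bc (q2 \<cdot> l2) s h (g2 \<cdot> b2)" "bc (d2 \<cdot> l2) s j (e2 \<cdot> b2)"
    by (rule A.V_ex)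
  obtain V' b1' b2' s' where tV': "mor b1' V' L1'" "mor b2' V' L2'" "mor s' W V'"
    and B': "bc l2 s' a2' b2'" "bc (q2 \<cdot> l2) s' h' (g2' \<cdot> b2')" "bc (d2 \<cdot> l2) s' j' (e2' \<cdot> b2')"
    by (rule A'.V_ex)
  note [simp] = tV tV'
  \<comment> \<open>The image of \<open>V\<close> under \<open>v\<close> meets \<open>O21\<close>
    only in \<open>W\<close>, so it lies in the maximal such subobject \<open>V'\<close>. The
    resulting \<open>r\<close> extends to \<open>X1\<close>, the union of \<open>N\<close> and
    \<open>V\<close>.\<close>
  have "pb (q2 \<cdot> l2) s (v \<cdot> h) (v \<cdot> (g2 \<cdot> b2))" by (rule pb_postcomp[OF bcD(11)[OF B(2)]]) simp
  from pbD(10)[OF this] have "img (v \<cdot> (g2 \<cdot> b2)) \<inter> img h' \<subseteq> img (h' \<cdot> (q2 \<cdot> l2))"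
    unfolding v(3) by blast
  then have "img (v \<cdot> (g2 \<cdot> b2)) \<subseteq> img (g2' \<cdot> b2')" using fp_iff[OF bc_fp[OF B'(2)]] by simp
  then have "v \<cdot> (g2 \<cdot> b2) \<in> img (g2' \<cdot> b2')" by (simp add: img_subset_iff)
  then obtain r where r: "mor r V V'" "(g2' \<cdot> b2') \<cdot> r = v \<cdot> (g2 \<cdot> b2)"
    by (rule factor[of _ _ V X2' V']) (simp, simp, blast)
  note [simp] = r(1)
  have "(g2' \<cdot> b2') \<cdot> (r \<cdot> s) = (g2' \<cdot> b2') \<cdot> s'"
  proof -
    have "(g2' \<cdot> b2') \<cdot> (r \<cdot> s) = v \<cdot> ((g2 \<cdot> b2) \<cdot> s)" by (subst reassoc1[OF r(2)]) simp_all
    also have "\<dots> = v \<cdot> (h \<cdot> (q2 \<cdot> l2))" unfolding bcD(9)[OF B(2)] ..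
    also have "\<dots> = h' \<cdot> (q2 \<cdot> l2)" by (subst reassoc1[OF v(3)]) simp_all
    finally show ?thesis unfolding bcD(9)[OF B'(2)] .
  qed
  then have rs: "r \<cdot> s = s'" by (simp add: cancel)
  have eq: "j' \<cdot> (d2 \<cdot> l2) = ((e2' \<cdot> b2') \<cdot> r) \<cdot> s" unfolding bcD(9)[OF B'(3)] by (simp add: rs)
  have sub: "img j' \<inter> img ((e2' \<cdot> b2') \<cdot> r) \<subseteq> img (j' \<cdot> (d2 \<cdot> l2))"
    using bcD(10)[OF B'(3)] img_comp_sub[of r "e2' \<cdot> b2'"] by auto
  obtain u where u: "mor u (Cod C j) X1'" "u \<cdot> j = j'" "u \<cdot> (e2 \<cdot> b2) = (e2' \<cdot> b2') \<cdot> r"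
    by (rule bc_univ[OF B(3) _ _ eq sub, of X1']) (simp, simp, blast)
  have [simp]: "mor u X1 X1'" using u(1) by simp
  have ux1: "u \<cdot> x1 = x1'" unfolding A.j_n1[symmetric] A'.j_n1[symmetric] by (subst reassoc1[OF u(2)])
      simp_all
  have ux2: "u \<cdot> x2 = x2'" unfolding A.j_n2[symmetric] A'.j_n2[symmetric] by (subst reassoc1[OF u(2)])
      simp_all
  have vy2: "v \<cdot> y2 = y2'" unfolding A.h_p2[symmetric] A'.h_p2[symmetric] by (subst reassoc1[OF v(3)])
      simp_all
  have "img (u \<cdot> e2) \<subseteq> img e2'"
  proof (subst fp_iff[OF A'.X1_right, symmetric])
    have "pb f2 i2 e2 x2"
      using fpD[OF A.X1_right] unfolding pb_def by simp
    then have "pb f2 i2 (u \<cdot> e2) (u \<cdot> x2)" by (rule pb_postcomp) simp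
    from pbD(9,10)[OF this] show "img (u \<cdot> e2) \<inter> img x2' \<subseteq> img (x2' \<cdot> i2)" unfolding ux2 by simp
  qed simp
  then have "u \<cdot> e2 \<in> img e2'" by (simp add: img_subset_iff)
  then obtain w where w: "mor w L2 L2'" "e2' \<cdot> w = u \<cdot> e2"
    by (rule factor[of _ _ L2 X1' L2']) (simp, simp, blast)
  note [simp] = w(1)
  have "e2' \<cdot> (w \<cdot> a2) = e2' \<cdot> a2'"
    by (simp add: reassoc[OF w(2)] A.e2_a2 A'.e2_a2 reassoc1[OF u(2)])
  then have wa: "w \<cdot> a2 = a2'" by (simp add: cancel)
  have "e2' \<cdot> (w \<cdot> b2) = e2' \<cdot> (b2' \<cdot> r)" using u(3) by (simp add: reassoc[OF w(2)])
  then have wb: "w \<cdot> b2 = b2' \<cdot> r" by (simp add: cancel)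
  have "v \<cdot> g2 = g2' \<cdot> w"
  proof (rule bc_joint[OF B(1)])
    show "v \<cdot> g2 \<cdot> a2 = g2' \<cdot> w \<cdot> a2"
      by (simp add: wa A.h_q2[symmetric] A'.h_q2[symmetric] reassoc1[OF v(3)])
    show "v \<cdot> g2 \<cdot> b2 = g2' \<cdot> w \<cdot> b2" using r(2) by (simp add: wb)
  qed simp_all
  then show ?thesis using that[of u w v] ux1 ux2 vy2 v(2) w(2) by simp
qed

end

locale triB_pair = composite32 C O1 K1 I1 O2 K2 I2 O3 K3 I3 o1 i1 o2 i2 o3 i3 N' P3 P2 O32 I32 W' n3 nb
    k3 d3 kb db p3 q3 qb rb m3 mb +
  A: triB C O1 K1 I1 O2 K2 I2 O3 K3 I3 o1 i1 o2 i2 o3 i3 X1 X2 L1 L2 Z x1 x2 f1 e1 f2 e2 y2 g2 x3 z3 z2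
    N' P3 P2 O32 I32 W' n3 nb k3 d3 kb db p3 q3 qb rb m3 mb jj c l +
  A': triB C O1 K1 I1 O2 K2 I2 O3 K3 I3 o1 i1 o2 i2 o3 i3 X1' X2' L1' L2' Z' x1' x2' f1' e1' f2' e2' y2'
      g2' x3' z3' z2'
    N' P3 P2 O32 I32 W' n3 nb k3 d3 kb db p3 q3 qb rb m3 mb jj' c' l'
  for C :: "('o, 'm) mcat" (structure) and O1 K1 I1 O2 K2 I2 O3 K3 I3 o1 i1 o2 i2 o3 i3
    and X1 X2 L1 L2 Z x1 x2 f1 e1 f2 e2 y2 g2 x3 z3 z2
    and X1' X2' L1' L2' Z' x1' x2' f1' e1' f2' e2' y2' g2' x3' z3' z2'
    and N' P3 P2 O32 I32 W' n3 nb k3 d3 kb db p3 q3 qb rb m3 mb jj c l jj' c' l'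
begin

text \<open>In this direction \<open>u\<close> is given by the match span. Finality of
  \<open>L2'\<close> yields \<open>w\<close>, and the pushout \<open>X2\<close> then yields
  \<open>v\<close>.\<close>

lemma triple_mor:
  assumes b: "bc \<nu>2 \<nu>1 l x1" and b': "bc \<nu>2 \<nu>1 l' x1'"
  obtains u w v where "mor u X1 X1'" "mor w L2 L2'" "mor v X2 X2'"
    "u \<cdot> x1 = x1'" "u \<cdot> x2 = x2'" "u \<cdot> e2 = e2' \<cdot> w" "v \<cdot> x3 = x3'" "v \<cdot> y2 = y2'" "v \<cdot> g2 = g2' \<cdot> w"
proof -
  obtain u where u: "mor u (Cod C l) X1'" "u \<cdot> l = l'" "u \<cdot> x1 = x1'"
    by (rule bc_univ[OF b _ _ bcD(9)[OF b'] equalityD1[OF bcD(10)[OF b']], of X1']) (simp, simp, blast)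
  have [simp]: "mor u X1 X1'" using u(1) by simp
  have ux2: "u \<cdot> x2 = x2'" unfolding A.l_rb[symmetric] A'.l_rb[symmetric] by (subst reassoc1[OF u(2)])
      simp_all
  have "img (u \<cdot> e2) \<subseteq> img e2'"
  proof (subst fp_iff[OF A'.X1_right, symmetric])
    have "pb f2 i2 e2 x2"
      using fpD[OF A.X1_right] unfolding pb_def by simp
    then have "pb f2 i2 (u \<cdot> e2) (u \<cdot> x2)" by (rule pb_postcomp) simp
    from pbD(9,10)[OF this] show "img (u \<cdot> e2) \<inter> img x2' \<subseteq> img (x2' \<cdot> i2)" unfolding ux2 by simp
  qed simp
  then have "u \<cdot> e2 \<in> img e2'" by (simp add: img_subset_iff)
  then obtain w where w: "mor w L2 L2'" "e2' \<cdot> w = u \<cdot> e2"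
    by (rule factor[of _ _ L2 X1' L2']) (simp, simp, blast)
  note [simp] = w(1)
  have "e2' \<cdot> (w \<cdot> f2) = e2' \<cdot> f2'"
    by (simp add: reassoc[OF w(2)] fpD(9)[OF A.X1_right, symmetric] fpD(9)[OF A'.X1_right, symmetric]
        reassoc1[OF ux2])
  then have wf: "w \<cdot> f2 = f2'" by (simp add: cancel)
  have eq: "y2' \<cdot> o2 = (g2' \<cdot> w) \<cdot> f2" using bcD(9)[OF A'.X2_left] by (simp add: wf)
  have sub: "img y2' \<inter> img (g2' \<cdot> w) \<subseteq> img (y2' \<cdot> o2)"
    using bcD(10)[OF A'.X2_left] img_comp_sub[of w g2'] by auto
  obtain v where v: "mor v (Cod C y2) X2'" "v \<cdot> y2 = y2'" "v \<cdot> g2 = g2' \<cdot> w"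
    by (rule bc_univ[OF A.X2_left _ _ eq sub, of X2']) (simp, simp, blast)
  have [simp]: "mor v X2 X2'" using v(1) by simp
  have "e2' \<cdot> (w \<cdot> c) = e2' \<cdot> c'"
    by (simp add: reassoc[OF w(2)] A.l_qb[symmetric] A'.l_qb[symmetric] reassoc1[OF u(2)])
  then have wc: "w \<cdot> c = c'" by (simp add: cancel)
  have "v \<cdot> jj = jj'"
  proof (rule bc_joint[OF N'_left])
    show "v \<cdot> jj \<cdot> nb = jj' \<cdot> nb" by (simp add: A.jj_nb A'.jj_nb v(2))
    show "v \<cdot> jj \<cdot> db = jj' \<cdot> db"
      by (simp add: A.g2_c[symmetric] A'.g2_c[symmetric] reassoc[OF v(3)] wc)
  qed simp_all
  then have "v \<cdot> x3 = x3'" unfolding A.jj_n3[symmetric] A'.jj_n3[symmetric] by (subst reassoc1) simp_all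
  then show ?thesis using that[of u w v] u(3) ux2 w(2) v(2,3) by simp
qed

text \<open>A comparison constructed from the other side must also respect \<open>l\<close>; only
  then do the outer spans of both triples agree.\<close>

lemma triple_mor_B:
  assumes t [simp]: "mor u X1 X1'" "mor w L2 L2'" "mor v X2 X2'"
    and e: "u \<cdot> x1 = x1'" "u \<cdot> x2 = x2'" "u \<cdot> e2 = e2' \<cdot> w" "v \<cdot> x3 = x3'" "v \<cdot> y2 = y2'" "v \<cdot> g2 = g2' \<cdot> w"
  shows "u \<cdot> l = l'"
proof -
  have vj: "v \<cdot> jj = jj'"
    by (rule cover_joint[OF _ _ N'_cover])
      (simp_all add: A.jj_n3 A'.jj_n3 A.jj_nb A'.jj_nb e)
  have "g2' \<cdot> (w \<cdot> c) = g2' \<cdot> c'"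
    by (simp add: reassoc[OF e(6)[symmetric]] A.g2_c A'.g2_c reassoc1[OF vj])
  then have wc: "w \<cdot> c = c'" by (simp add: cancel)
  show ?thesis
  proof (rule bc_joint[OF I32_bc])
    show "u \<cdot> l \<cdot> rb = l' \<cdot> rb" by (simp add: A.l_rb A'.l_rb e)
    show "u \<cdot> l \<cdot> qb = l' \<cdot> qb" by (simp add: A.l_qb A'.l_qb reassoc[OF e(3)] wc)
  qed simp_all
qed

end

context triA_pair
begin

lemma triple_mor_A:
  assumes t [simp]: "mor u X1 X1'" "mor w L2 L2'" "mor v X2 X2'"
    and e: "u \<cdot> x1 = x1'" "u \<cdot> x2 = x2'" "u \<cdot> e2 = e2' \<cdot> w" "v \<cdot> x3 = x3'" "v \<cdot> y2 = y2'" "v \<cdot> g2 = g2' \<cdot> w"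
  shows "v \<cdot> h = h'"
proof -
  have uj: "u \<cdot> j = j'"
    by (rule cover_joint[OF _ _ N_cover])
      (simp_all add: A.j_n2 A'.j_n2 A.j_n1 A'.j_n1 e)
  have "e2' \<cdot> (w \<cdot> a2) = e2' \<cdot> a2'"
    by (simp add: reassoc[OF e(3)[symmetric]] A.e2_a2 A'.e2_a2 reassoc1[OF uj])
  then have wa: "w \<cdot> a2 = a2'" by (simp add: cancel)
  show ?thesis
  proof (rule bc_joint[OF O21_bc])
    show "v \<cdot> h \<cdot> p2 = h' \<cdot> p2" by (simp add: A.h_p2 A'.h_p2 e)
    show "v \<cdot> h \<cdot> q2 = h' \<cdot> q2" by (simp add: A.h_q2 A'.h_q2 reassoc[OF e(6)] wa)
  qed simp_all
qed

end

section \<open>Typing of composite data and representative spans\<close>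

context sqpo_category
begin

lemma composite_data_types:
  assumes D: "composite_data ((o2, i2), c2) (\<mu>2, \<mu>1) ((o1, i1), c1) (n2, n1, k2, d2, k1, d1, p2, q2, q1,
      p1, l2, l1)"
    and t: "mor o2 K2 O2" "mor i2 K2 I2" "mor o1 K1 O1" "mor i1 K1 I1" "mor \<mu>2 M I2" "mor \<mu>1 M O1"
  obtains N M2 M1 O21 I21 W where "mor n2 I2 N" "mor n1 O1 N" "mor k2 K2 M2" "mor d2 M2 N" "mor k1 K1 M1"
      "mor d1 M1 N"
      "mor p2 O2 O21" "mor q2 M2 O21" "mor q1 M1 I21" "mor p1 I1 I21" "mor l2 W M2" "mor l1 W M1"
proof -
  note n = bc_mor'[OF composite_dataD(1)[OF D] t(5,6)]
  have kd2: "mor k2 K2 (Dom C d2)" "mor d2 (Dom C d2) (Cod C n2)"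
    using fpD(2,4)[OF composite_dataD(2)[OF D]] fpD(5)[OF composite_dataD(2)[OF D], symmetric] fpD(7)[OF
        composite_dataD(2)[OF D]]
      fpD(8)[OF composite_dataD(2)[OF D], symmetric] t(2) by simp_all
  note kd1 = bc_mor[OF composite_dataD(3)[OF D] t(3) n(2)]
  note pq2 = bc_mor'[OF composite_dataD(4)[OF D] t(1) kd2(1)]
  note pq1 = bc_mor'[OF composite_dataD(5)[OF D] kd1(1) t(4)]
  have l: "mor l2 (Dom C l2) (Dom C d2)" "mor l1 (Dom C l2) (Dom C d1)"
    using pbD(1,2)[OF composite_dataD(6)[OF D]] pbD(5)[OF composite_dataD(6)[OF D], symmetric]
        pbD(6,7)[OF composite_dataD(6)[OF D]] by simp_all
  show ?thesis by (rule that[OF n kd2 kd1 pq2 pq1 l])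
qed

text \<open>The first composite must use fixed data: the legs \<open>p2\<close> and \<open>q2\<close> are not determined by the composite
  rule, and a different choice would identify the subobjects of \<open>O21\<close> differently.\<close>

definition chosen_data where
  "chosen_data R2 \<mu> R1 = (SOME D. composite_data R2 \<mu> R1 D)"

lemma chosen_data:
  assumes "composite_data R2 \<mu> R1 D" shows "composite_data R2 \<mu> R1 (chosen_data R2 \<mu> R1)"
  unfolding chosen_data_def using assms by (rule someI)

lemma pb_rep_ex:
  assumes "mor h B X" "mor k D X"
  obtains f g P where "pb f g h k" "mor f P B" "mor g P D" "span_rep C (f, g)"
proof -
  obtain P f g where p: "pb f g h k" "mor f P B" "mor g P D" by (rule pb_ex[OF assms])
  note [simp] = p(2,3)
  obtain u where u: "iso_arrow C u" "Cod C u = Dom C f" "span_rep C (f \<cdot> u, g \<cdot> u)"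
    by (rule span_rep_ex[of f g]) (simp, simp, simp, blast)
  have [simp]: "u \<in> MM C" "Cod C u = P" using u(1,2) by (simp_all add: iso_MM)
  have "mor (f \<cdot> u) (Dom C u) B" "mor (g \<cdot> u) (Dom C u) D" by simp_all
  then show ?thesis using that pb_precomp_iso[OF p(1) u(1,2)] u(3) by blast
qed

text \<open>Pullbacks of one cospan are isomorphic spans, and each isomorphism class has a single
  representative. Equality of matches is always derived in this way.\<close>

lemma pb_rep_unique:
  assumes p: "pb f g h k" and q: "pb f' g' h k" and r: "span_rep C (f, g)" "span_rep C (f', g')"
  shows "(f, g) = (f', g')"
proof (rule span_rep_unique[OF _ _ _ _ r])
  obtain u where "iso_arrow C u" "mor u (Dom C f) (Dom C f')" "f' \<cdot> u = f" "g' \<cdot> u = g"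
    by (rule pb_iso[OF q p])
  then show "span_iso C (f, g) (f', g')"
    unfolding span_iso_iff arrows_def using pbD(1,2,5)[OF q] monoD by blast
  show "f \<in> Arr C" "g \<in> Arr C" "Dom C f = Dom C g" using pbD(1,2,5)[OF p] by simp_all
qed

end

section \<open>The correspondence between nested matches\<close>

locale three_conds = three_rules C O1 K1 I1 O2 K2 I2 O3 K3 I3 o1 i1 o2 i2 o3 i3
  for C :: "('o, 'm) mcat" (structure) and O1 K1 I1 O2 K2 I2 O3 K3 I3 o1 i1 o2 i2 o3 i3 +
  fixes c1 c2 c3 :: "('i, 'm) cond"
  assumes conds: "cond_over C c1 I1" "cond_over C c2 I2" "cond_over C c3 I3"
begin

abbreviation "R1 \<equiv> ((o1, i1), c1)"
abbreviation "R2 \<equiv> ((o2, i2), c2)"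
abbreviation "R3 \<equiv> ((o3, i3), c3)"
abbreviation "R21 \<mu> \<equiv> sq_compose C R2 \<mu> R1"
abbreviation "R32 \<mu> \<equiv> sq_compose C R3 \<mu> R2"

end

text \<open>One triple presenting both nested matches. The inner composites carry their fixed data,
  whereas the outer matches are determined by the cospans \<open>(x3, h)\<close> and
  \<open>(l, x1)\<close>.\<close>

locale correspondence = three_conds C O1 K1 I1 O2 K2 I2 O3 K3 I3 o1 i1 o2 i2 o3 i3 c1 c2 c3 +
  triAB C O1 K1 I1 O2 K2 I2 O3 K3 I3 o1 i1 o2 i2 o3 i3 X1 X2 L1 L2 Z x1 x2 f1 e1 f2 e2 y2 g2 x3 z3 z2
    N M2 M1 O21 I21 W n2 n1 k2 d2 k1 d1 p2 q2 q1 p1 l2 l1 j a2 h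
    N' P3 P2 O32 I32 W' n3 nb k3 d3 kb db p3 q3 qb rb m3 mb jj c l
  for C :: "('o, 'm) mcat" (structure) and O1 K1 I1 O2 K2 I2 O3 K3 I3 o1 i1 o2 i2 o3 i3
    and c1 c2 c3 :: "('i, 'm) cond"
    and X1 X2 L1 L2 Z x1 x2 f1 e1 f2 e2 y2 g2 x3 z3 z2
    and N M2 M1 O21 I21 W n2 n1 k2 d2 k1 d1 p2 q2 q1 p1 l2 l1 j a2 h
    and N' P3 P2 O32 I32 W' n3 nb k3 d3 kb db p3 q3 qb rb m3 mb jj c l +
  fixes \<mu>2 \<mu>1 \<mu>2' \<mu>1' \<nu>2 \<nu>1 \<nu>2' \<nu>1'
  assumes compd21: "composite_data R2 (\<mu>2, \<mu>1) R1 (n2, n1, k2, d2, k1, d1, p2, q2, q1, p1, l2, l1)"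
    and compd32: "composite_data R3 (\<nu>2, \<nu>1) R2 (n3, nb, k3, d3, kb, db, p3, q3, qb, rb, m3, mb)"
    and cdat21: "chosen_data R2 (\<mu>2, \<mu>1) R1 = (n2, n1, k2, d2, k1, d1, p2, q2, q1, p1, l2, l1)"
    and cdat32: "chosen_data R3 (\<nu>2, \<nu>1) R2 = (n3, nb, k3, d3, kb, db, p3, q3, qb, rb, m3, mb)"
    and bcA: "bc \<mu>2' \<mu>1' x3 h" and bcB: "bc \<nu>2' \<nu>1' l x1"
    and reps: "span_rep C (\<mu>2, \<mu>1)" "span_rep C (\<mu>2', \<mu>1')" "span_rep C (\<nu>2, \<nu>1)" "span_rep C (\<nu>2', \<nu>1')"
begin

abbreviation "RA \<equiv> sq_compose C R3 (\<mu>2', \<mu>1') (R21 (\<mu>2, \<mu>1))"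
abbreviation "RB \<equiv> sq_compose C (R32 (\<nu>2, \<nu>1)) (\<nu>2', \<nu>1') R1"

abbreviation "satisfiable R \<equiv> \<exists>p\<in>MM C. Dom C p = Cod C (snd (fst R)) \<and> sat C (snd R) p"

lemma R21_eq: "R21 (\<mu>2, \<mu>1) = ((q2 \<cdot> l2, q1 \<cdot> l1), snd (R21 (\<mu>2, \<mu>1)))"
  using composite_dataD(7)[OF compd21] by (metis prod.collapse)

lemma R32_eq: "R32 (\<nu>2, \<nu>1) = ((q3 \<cdot> m3, qb \<cdot> mb), snd (R32 (\<nu>2, \<nu>1)))"
  using composite_dataD(7)[OF compd32] by (metis prod.collapse)

lemma span_mor:
  assumes b: "bc m' m n' n" and t: "Dom C n' = A" "Dom C n = B"
  shows "mor m' (Dom C m) A" "mor m (Dom C m) B"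
  using bcD(1,2,5,6,7)[OF b] t by simp_all

text \<open>Besides the isomorphism, the last conclusions handle admissibility: a mono satisfying an
  outer condition induces one satisfying the inner condition.\<close>

lemma composites_agree:
  obtains uO uK uI where "linear_rule_iso C (fst RA) (fst RB) uO uK uI" "cond_equiv_along C uI (snd RA)
      (snd RB)"
    "satisfiable RA \<longleftrightarrow> satisfiable RB"
    "satisfiable RA \<Longrightarrow> satisfiable (R21 (\<mu>2, \<mu>1))" "satisfiable RB \<Longrightarrow> satisfiable (R32 (\<nu>2, \<nu>1))"
proof -
  let ?c21 = "snd (R21 (\<mu>2, \<mu>1))" and ?c32 = "snd (R32 (\<nu>2, \<nu>1))"
  obtain V b2 s0 where VB: "bc (q2 \<cdot> l2) s0 h (g2 \<cdot> b2)" and tV: "mor s0 W V" "mor b2 V L2"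
    by (rule V_ex)
  have tm: "mor \<mu>2' (Dom C \<mu>1') I3" "mor \<mu>1' (Dom C \<mu>1') O21" by (rule span_mor[OF bcA], simp, simp)+
  have tn: "mor \<nu>2' (Dom C \<nu>1') I32" "mor \<nu>1' (Dom C \<nu>1') O1" by (rule span_mor[OF bcB], simp, simp)+
  have t21: "mor (q2 \<cdot> l2) W O21" "mor (q1 \<cdot> l1) W I21" by simp_all
  have t32: "mor (q3 \<cdot> m3) W' O32" "mor (qb \<cdot> mb) W' I32" by simp_all
  have c21: "cond_over C ?c21 I21" using composite_dataD(8)[OF compd21] by simp
  have c32: "cond_over C ?c32 I32" using composite_dataD(8)[OF compd32] by simp
  obtain ka da s dl pa qa Q P s3 s1 where DA: "composite_data R3 (\<mu>2', \<mu>1') ((q2 \<cdot> l2, q1 \<cdot> l1), ?c21)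
      (x3, h, ka, da, s, dl, pa, qa, Q, P, s3, s1)"
    by (rule composite_data_ex[OF rules(5,6) conds(3) t21 c21 bcA tm VB])
  obtain kk dd fb eb P' Q' qB pB r2 r1 where DB: "composite_data ((q3 \<cdot> m3, qb \<cdot> mb), ?c32) (\<nu>2', \<nu>1') R1
      (l, x1, kk, dd, fb, eb, P', Q', qB, pB, r2, r1)"
    by (rule composite_data_ex[OF t32 c32 rules(1,2) conds(1) bcB tn X1_left])
  note DA' = DA[folded R21_eq] and DB' = DB[folded R32_eq]
  obtain X2a E3 V' X3 X0 S where tA: "mor x3 I3 X2a" "mor h O21 X2a" "mor ka K3 E3" "mor da E3 X2a" "mor
      s W V'" "mor dl V' X2a"
    "mor pa O3 X3" "mor qa E3 X3" "mor Q V' X0" "mor P I21 X0" "mor s3 S E3" "mor s1 S V'"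
    by (rule composite_data_types[OF DA rules(5,6) t21 tm])
  obtain X1a D L1' X3' X0' R where tB: "mor l I32 X1a" "mor x1 O1 X1a" "mor kk W' D" "mor dd D X1a" "mor
      fb K1 L1'" "mor eb L1' X1a"
    "mor P' O32 X3'" "mor Q' D X3'" "mor qB L1' X0'" "mor pB I1 X0'" "mor r2 R D" "mor r1 R L1'"
    by (rule composite_data_types[OF DB t32 rules(1,2) tn])
  have X: "X2a = X2" "X1a = X1" using tA(1) tB(1) by simp_all
  note [simp] = tA(3-12)[unfolded X] tB(3-12)[unfolded X]
  \<comment> \<open>\<open>DB\<close> brings its own pushout complement \<open>(fb, eb)\<close>,
    possibly different from \<open>(f1, e1)\<close>. The triple is reread with it in place of
    \<open>L1\<close>.\<close>
  interpret F: triAB C O1 K1 I1 O2 K2 I2 O3 K3 I3 o1 i1 o2 i2 o3 i3 X1 X2 L1' L2 Z x1 x2 fb eb f2 e2 y2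
      g2 x3 z3 z2
    N M2 M1 O21 I21 W n2 n1 k2 d2 k1 d1 p2 q2 q1 p1 l2 l1 j a2 h
    N' P3 P2 O32 I32 W' n3 nb k3 d3 kb db p3 q3 qb rb m3 mb jj c l
    by unfold_locales
      (simp_all add: composite_dataD(3)[OF DB] X1_right X2_left Z_pb X1_cover j_n2 j_n1 e2_a2 h_p2 h_q2
        jj_n3 jj_nb g2_c l_rb l_qb)
  obtain uO uK uI where u: "iso_arrow C uO" "mor uO X3 X3'" "iso_arrow C uK" "mor uK S R" "iso_arrow C
      uI" "mor uI X0 X0'"
    "uO \<cdot> (qa \<cdot> s3) = (Q' \<cdot> r2) \<cdot> uK" "uI \<cdot> (Q \<cdot> s1) = (qB \<cdot> r1) \<cdot> uK" "uI \<cdot> (P \<cdot> p1) = pB"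
    and D: "\<And>p Y. mor p X0' Y \<Longrightarrow> \<exists>n n'. mor n X1 (Cod C n) \<and> mor n' X2 (Cod C n') \<and> deriv dl Q (p \<cdot> uI) n' \<and>
        deriv d1 q1 ((p \<cdot> uI) \<cdot> P) (n \<cdot> j) \<and> deriv eb qB p n \<and> deriv db qb (n \<cdot> l) (n' \<cdot> jj)"
    by (rule F.composites[OF composite_dataD(2)[OF DA] composite_dataD(3)[OF DA] composite_dataD(4)[OF
        DA] composite_dataD(5)[OF DA] composite_dataD(6)[OF DA]
      tA(3-12)[unfolded X] composite_dataD(2)[OF DB] composite_dataD(4)[OF DB] composite_dataD(5)[OF DB]
          composite_dataD(6)[OF DB]
      tB(3,4,7-12)[unfolded X]]) (rule that)
  have fA: "fst RA = (qa \<cdot> s3, Q \<cdot> s1)" by (rule composite_dataD(7)[OF DA, folded R21_eq])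
  have fB: "fst RB = (Q' \<cdot> r2, qB \<cdot> r1)" by (rule composite_dataD(7)[OF DB, folded R32_eq])
  note [simp] = u(2,4,6)
  have L: "linear_rule_iso C (fst RA) (fst RB) uO uK uI"
    unfolding fA fB linear_rule_iso_def using u by (simp add: arrows_def)
  \<comment> \<open>Along the derivation from \<open>p\<close>, both nested conditions unfold to
    \<open>c1\<close> at \<open>p \<cdot> pB\<close>, \<open>c2\<close> at
    \<open>n \<cdot> x2\<close> and \<open>c3\<close> at \<open>n' \<cdot> x3\<close>.\<close>
  have key: "(sat C (snd RA) (p \<cdot> uI) \<longleftrightarrow> sat C (snd RB) p) \<and>
      (sat C (snd RA) (p \<cdot> uI) \<longrightarrow> sat C ?c21 ((p \<cdot> uI) \<cdot> P)) \<and> (sat C (snd RB) p \<longrightarrow> satisfiable (R32 (\<nu>2, \<nu>1)))"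
    if p: "p \<in> MM C" "Dom C p = X0'" for p
  proof -
    have p' [simp]: "mor p X0' (Cod C p)" using p by simp
    obtain n n' where n: "mor n X1 (Cod C n)" "mor n' X2 (Cod C n')" and d: "deriv dl Q (p \<cdot> uI) n'"
      "deriv d1 q1 ((p \<cdot> uI) \<cdot> P) (n \<cdot> j)" "deriv eb qB p n" "deriv db qb (n \<cdot> l) (n' \<cdot> jj)"
      using D[OF p'] by blast
    have [simp]: "p \<in> MM C" "Dom C p = X0'" "n \<in> MM C" "Dom C n = X1" "n' \<in> MM C" "Dom C n' = X2" using p
        n by simp_all
    have "sat C (snd RA) (p \<cdot> uI) \<longleftrightarrow> sat C ?c21 ((p \<cdot> uI) \<cdot> P) \<and> sat C c3 (n' \<cdot> x3)"
      using composite_dataD(9)[OF DA d(1), folded R21_eq] .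
    moreover have "sat C ?c21 ((p \<cdot> uI) \<cdot> P) \<longleftrightarrow> sat C c1 (((p \<cdot> uI) \<cdot> P) \<cdot> p1) \<and> sat C c2 ((n \<cdot> j) \<cdot> n2)"
      using composite_dataD(9)[OF compd21 d(2)] .
    moreover have "((p \<cdot> uI) \<cdot> P) \<cdot> p1 = p \<cdot> pB" by (simp add: u(9))
    moreover have "(n \<cdot> j) \<cdot> n2 = n \<cdot> x2" by (simp add: j_n2)
    moreover have "sat C (snd RB) p \<longleftrightarrow> sat C c1 (p \<cdot> pB) \<and> sat C ?c32 (n \<cdot> l)"
      using composite_dataD(9)[OF DB d(3), folded R32_eq] .
    moreover have "sat C ?c32 (n \<cdot> l) \<longleftrightarrow> sat C c2 ((n \<cdot> l) \<cdot> rb) \<and> sat C c3 ((n' \<cdot> jj) \<cdot> n3)"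
      using composite_dataD(9)[OF compd32 d(4)] .
    moreover have "(n \<cdot> l) \<cdot> rb = n \<cdot> x2" "(n' \<cdot> jj) \<cdot> n3 = n' \<cdot> x3" by (simp_all add: l_rb jj_n3)
    moreover have "n \<cdot> l \<in> MM C" "Dom C (n \<cdot> l) = Cod C (snd (fst (R32 (\<nu>2, \<nu>1))))"
      by (simp_all add: composite_dataD(7)[OF compd32])
    ultimately show ?thesis by (smt (verit))
  qed
  have E: "cond_equiv_along C uI (snd RA) (snd RB)"
    unfolding cond_equiv_along_def using key by simp
  obtain uI' where uI': "iso_arrow C uI'" "mor uI' (Cod C uI) (Dom C uI)" "uI' \<cdot> uI = Idn C (Dom C uI)"
    using iso_inverse[OF u(5)] by metis
  have [simp]: "mor uI' X0' X0" and inv: "uI' \<cdot> uI = Idn C X0" using uI' by simp_all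
  have iA: "Cod C (snd (fst RA)) = X0" and iB: "Cod C (snd (fst RB)) = X0'" by (simp_all add: fA fB)
  have AtoB: "\<exists>p\<in>MM C. Dom C p = X0' \<and> sat C (snd RA) (p \<cdot> uI)" if "satisfiable RA"
  proof -
    obtain q where q: "q \<in> MM C" "Dom C q = X0" "sat C (snd RA) q" using \<open>satisfiable RA\<close> unfolding iA by
        blast
    have "(q \<cdot> uI') \<cdot> uI = q" using q(1,2) inv by simp
    moreover have "q \<cdot> uI' \<in> MM C" "Dom C (q \<cdot> uI') = X0'" using q(1,2) by simp_all
    ultimately show ?thesis using q(3) by metis
  qed
  have 1: "satisfiable RA \<longleftrightarrow> satisfiable RB"
  proof
    assume "satisfiable RA"
    then show "satisfiable RB" using AtoB key unfolding iB by blast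
  next
    assume "satisfiable RB"
    then obtain p where p: "p \<in> MM C" "Dom C p = X0'" "sat C (snd RB) p" unfolding iB by blast
    then have "sat C (snd RA) (p \<cdot> uI)" "p \<cdot> uI \<in> MM C" "Dom C (p \<cdot> uI) = X0" using key by simp_all
    then show "satisfiable RA" unfolding iA by blast
  qed
  have 2: "satisfiable (R21 (\<mu>2, \<mu>1))" if "satisfiable RA"
  proof -
    obtain p where p: "p \<in> MM C" "Dom C p = X0'" "sat C (snd RA) (p \<cdot> uI)" using AtoB \<open>satisfiable RA\<close> by
        blast
    then have "sat C ?c21 ((p \<cdot> uI) \<cdot> P)" using key by blast
    moreover have "(p \<cdot> uI) \<cdot> P \<in> MM C" "Dom C ((p \<cdot> uI) \<cdot> P) = Cod C (snd (fst (R21 (\<mu>2, \<mu>1))))"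
      using p by (simp_all add: composite_dataD(7)[OF compd21])
    ultimately show ?thesis by blast
  qed
  have 3: "satisfiable (R32 (\<nu>2, \<nu>1))" if "satisfiable RB"
    using that key unfolding iB by blast
  show ?thesis by (rule that[OF L E 1 2 3])
qed

text \<open>The structural requirements hold by construction of the triple, and the inner conditions
  are satisfiable whenever the outer ones are, so only outer satisfiability remains.\<close>

lemma matches:
  "(\<mu>2, \<mu>1) \<in> sq_matches C R2 R1 \<and> (\<mu>2', \<mu>1') \<in> sq_matches C R3 (R21 (\<mu>2, \<mu>1)) \<longleftrightarrow> satisfiable RA"
  "(\<nu>2, \<nu>1) \<in> sq_matches C R3 R2 \<and> (\<nu>2', \<nu>1') \<in> sq_matches C (R32 (\<nu>2, \<nu>1)) R1 \<longleftrightarrow> satisfiable RB"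
proof -
  have S: "satisfiable RA \<longrightarrow> satisfiable (R21 (\<mu>2, \<mu>1))" "satisfiable RB \<longrightarrow> satisfiable (R32 (\<nu>2, \<nu>1))"
    by (rule composites_agree; blast)+
  obtain V b2 s0 where VB: "bc (q2 \<cdot> l2) s0 h (g2 \<cdot> b2)" by (rule V_ex)
  have t21: "mor (q2 \<cdot> l2) W O21" "mor (q1 \<cdot> l1) W I21" by simp_all
  have t32: "mor (q3 \<cdot> m3) W' O32" "mor (qb \<cdot> mb) W' I32" by simp_all
  have tm: "mor \<mu>2' (Dom C \<mu>1') I3" "mor \<mu>1' (Dom C \<mu>1') O21" by (rule span_mor[OF bcA], simp, simp)+
  have tn: "mor \<nu>2' (Dom C \<nu>1') I32" "mor \<nu>1' (Dom C \<nu>1') O1" by (rule span_mor[OF bcB], simp, simp)+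
  have tm': "mor \<mu>2 (Dom C \<mu>1) I2" "mor \<mu>1 (Dom C \<mu>1) O1" by (rule span_mor[OF composite_dataD(1)[OF
      compd21]], simp, simp)+
  have tn': "mor \<nu>2 (Dom C \<nu>1) I3" "mor \<nu>1 (Dom C \<nu>1) O2" by (rule span_mor[OF composite_dataD(1)[OF
      compd32]], simp, simp)+
  have "(\<mu>2, \<mu>1) \<in> sq_matches C R2 R1 \<longleftrightarrow> satisfiable (R21 (\<mu>2, \<mu>1))"
    unfolding sq_matches_iff[OF rules(3,4,1,2)] using tm' reps(1) composite_dataD(1)[OF compd21] N_left
        by blast
  moreover have "(\<mu>2', \<mu>1') \<in> sq_matches C R3 (R21 (\<mu>2, \<mu>1)) \<longleftrightarrow> satisfiable RA"
    using sq_matches_iff[OF rules(5,6) t21, of \<mu>2' \<mu>1' c3 "snd (R21 (\<mu>2, \<mu>1))", folded R21_eq] tm reps(2)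
        bcA VB by blast
  ultimately show "(\<mu>2, \<mu>1) \<in> sq_matches C R2 R1 \<and> (\<mu>2', \<mu>1') \<in> sq_matches C R3 (R21 (\<mu>2, \<mu>1)) \<longleftrightarrow>
      satisfiable RA"
    using S(1) by blast
  have "(\<nu>2, \<nu>1) \<in> sq_matches C R3 R2 \<longleftrightarrow> satisfiable (R32 (\<nu>2, \<nu>1))"
    unfolding sq_matches_iff[OF rules(5,6,3,4)] using tn' reps(3) composite_dataD(1)[OF compd32] N'_left
        by blast
  moreover have "(\<nu>2', \<nu>1') \<in> sq_matches C (R32 (\<nu>2, \<nu>1)) R1 \<longleftrightarrow> satisfiable RB"
    using sq_matches_iff[OF t32 rules(1,2), of \<nu>2' \<nu>1' "snd (R32 (\<nu>2, \<nu>1))" c1, folded R32_eq] tn reps(4)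
        bcB X1_left by blast
  ultimately show "(\<nu>2, \<nu>1) \<in> sq_matches C R3 R2 \<and> (\<nu>2', \<nu>1') \<in> sq_matches C (R32 (\<nu>2, \<nu>1)) R1 \<longleftrightarrow>
      satisfiable RB"
    using S(2) by blast
qed

end

lemma prod_cases12:
  obtains n2 n1 k2 d2 k1 d1 p2 q2 q1 p1 l2 l1 where "D = (n2, n1, k2, d2, k1, d1, p2, q2, q1, p1, l2, l1)"
proof -
  obtain n2 n1 k2 d2 k1 d1 E where D: "D = (n2, n1, k2, d2, k1, d1, E)" by (rule prod_cases7)
  obtain p2 q2 q1 p1 l2 l1 where "E = (p2, q2, q1, p1, l2, l1)" by (rule prod_cases6)
  with D show ?thesis using that by blast
qed

text \<open>The required bijection has to be extracted from a relation, since neither direction of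
  the correspondence is canonical before representatives are fixed.\<close>

lemma bij_betw_of_relation:
  assumes "\<And>a. a \<in> A \<Longrightarrow> \<exists>b\<in>B. R a b" and "\<And>b. b \<in> B \<Longrightarrow>
      \<exists>a\<in>A. R a b"
    and "\<And>a b b'. R a b \<Longrightarrow> R a b' \<Longrightarrow> b = b'" and "\<And>a a' b. R a b
        \<Longrightarrow> R a' b \<Longrightarrow> a = a'"
  obtains \<Phi> where "bij_betw \<Phi> A B" "\<And>a. a \<in> A \<Longrightarrow> R a (\<Phi> a)"
proof -
  obtain \<Phi> where P: "\<And>a. a \<in> A \<Longrightarrow> \<Phi> a \<in> B \<and> R a (\<Phi> a)" using
      assms(1) by metis
  have "inj_on \<Phi> A" using P assms(4) by (metis inj_onI)
  moreover have "\<Phi> ` A = B" using P assms(2,3) by blast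
  ultimately show ?thesis using that P by (auto simp: bij_betw_def)
qed

context three_conds
begin

text \<open>Going through \<open>chosen_data\<close> makes the twelve arrows a function of the
  match, on which the uniqueness proofs rely.\<close>

lemma composite21_ex:
  assumes b: "bc \<mu>2 \<mu>1 n n'" and t: "mor \<mu>2 M I2" "mor \<mu>1 M O1" and k: "bc o1 k n' d"
  obtains N M2 M1 O21 I21 W n2 n1 k2 d2 k1 d1 p2 q2 q1 p1 l2 l1 where "composite_data R2 (\<mu>2, \<mu>1) R1 (n2,
      n1, k2,
      d2, k1, d1, p2, q2, q1, p1, l2, l1)"
    "chosen_data R2 (\<mu>2, \<mu>1) R1 = (n2, n1, k2, d2, k1, d1, p2, q2, q1, p1, l2, l1)" "composite21 C O1 K1
        I1 O2 K2 I2 O3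
        K3 I3 o1 i1 o2 i2 o3 i3 N M2 M1 O21 I21 W n2 n1 k2 d2 k1 d1 p2 q2 q1 p1 l2 l1"
proof -
  have "\<exists>D. composite_data R2 (\<mu>2, \<mu>1) R1 D" using composite_data_ex[OF rules(3,4) conds(2) rules(1,2)
      conds(1) b t
      k] by metis
  then have "composite_data R2 (\<mu>2, \<mu>1) R1 (chosen_data R2 (\<mu>2, \<mu>1) R1)" using chosen_data by blast
  moreover obtain n2 n1 k2 d2 k1 d1 p2 q2 q1 p1 l2 l1 where e: "chosen_data R2 (\<mu>2, \<mu>1) R1 = (n2, n1, k2,
      d2, k1,
      d1, p2, q2, q1, p1, l2, l1)" by (rule prod_cases12)
  ultimately have D: "composite_data R2 (\<mu>2, \<mu>1) R1 (n2, n1, k2, d2, k1, d1, p2, q2, q1, p1, l2, l1)" by simp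
  obtain N M2 M1 O21 I21 W where tD: "mor n2 I2 N" "mor n1 O1 N" "mor k2 K2 M2" "mor d2 M2 N" "mor k1 K1
      M1" "mor
      d1 M1 N"
      "mor p2 O2 O21" "mor q2 M2 O21" "mor q1 M1 I21" "mor p1 I1 I21" "mor l2 W M2" "mor l1 W M1"
    by (rule composite_data_types[OF D rules(3,4) rules(1,2) t])
  have "pts N \<subseteq> cl N (img n2 \<union> img n1)" using bcD(12)[OF composite_dataD(1)[OF D]] tD(1) by simp
  then have "composite21 C O1 K1 I1 O2 K2 I2 O3 K3 I3 o1 i1 o2 i2 o3 i3 N M2 M1 O21 I21 W n2 n1 k2 d2 k1
      d1 p2 q2 q1 p1 l2 l1"
    by unfold_locales (use tD composite_dataD[OF D] in auto)
  then show ?thesis by (rule that[OF D e])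
qed

lemma composite32_ex:
  assumes b: "bc \<nu>2 \<nu>1 n n'" and t: "mor \<nu>2 M I3" "mor \<nu>1 M O2" and k: "bc o2 k n' d"
  obtains N' P3 P2 O32 I32 W' n3 nb k3 d3 kb db p3 q3 qb rb m3 mb where "composite_data R3 (\<nu>2, \<nu>1) R2
      (n3, nb, k3,
      d3, kb, db, p3, q3, qb, rb, m3, mb)"
    "chosen_data R3 (\<nu>2, \<nu>1) R2 = (n3, nb, k3, d3, kb, db, p3, q3, qb, rb, m3, mb)" "composite32 C O1 K1
        I1 O2 K2 I2 O3
        K3 I3 o1 i1 o2 i2 o3 i3 N' P3 P2 O32 I32 W' n3 nb k3 d3 kb db p3 q3 qb rb m3 mb"
proof -
  have "\<exists>D. composite_data R3 (\<nu>2, \<nu>1) R2 D" using composite_data_ex[OF rules(5,6) conds(3) rules(3,4)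
      conds(2) b t
      k] by metis
  then have "composite_data R3 (\<nu>2, \<nu>1) R2 (chosen_data R3 (\<nu>2, \<nu>1) R2)" using chosen_data by blast
  moreover obtain n3 nb k3 d3 kb db p3 q3 qb rb m3 mb where e: "chosen_data R3 (\<nu>2, \<nu>1) R2 = (n3, nb, k3,
      d3, kb,
      db, p3, q3, qb, rb, m3, mb)" by (rule prod_cases12)
  ultimately have D: "composite_data R3 (\<nu>2, \<nu>1) R2 (n3, nb, k3, d3, kb, db, p3, q3, qb, rb, m3, mb)" by simp
  obtain N' P3 P2 O32 I32 W' where tD: "mor n3 I3 N'" "mor nb O2 N'" "mor k3 K3 P3" "mor d3 P3 N'" "mor
      kb K2 P2"
      "mor db P2 N'"
      "mor p3 O3 O32" "mor q3 P3 O32" "mor qb P2 I32" "mor rb I2 I32" "mor m3 W' P3" "mor mb W' P2"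
    by (rule composite_data_types[OF D rules(5,6) rules(3,4) t])
  have "pts N' \<subseteq> cl N' (img n3 \<union> img nb)" using bcD(12)[OF composite_dataD(1)[OF D]] tD(1) by simp
  then have "composite32 C O1 K1 I1 O2 K2 I2 O3 K3 I3 o1 i1 o2 i2 o3 i3 N' P3 P2 O32 I32 W' n3 nb k3 d3
      kb db p3 q3 qb rb
      m3 mb"
    by unfold_locales (use tD composite_dataD[OF D] in auto)
  then show ?thesis by (rule that[OF D e])
qed

end

locale triple_conds = three_conds C O1 K1 I1 O2 K2 I2 O3 K3 I3 o1 i1 o2 i2 o3 i3 c1 c2 c3 +
    derivation_triple C O1 K1 I1 O2 K2 I2 O3
    K3 I3 o1 i1 o2 i2 o3 i3 X1 X2 L1 L2 Z x1 x2 f1 e1 f2 e2 y2 g2 x3 z3 z2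
  for C :: "('o, 'm) mcat" (structure) and O1 K1 I1 O2 K2 I2 O3 K3 I3 o1 i1 o2 i2 o3 i3
    and c1 c2 c3 :: "('i, 'm) cond" and X1 X2 L1 L2 Z x1 x2 f1 e1 f2 e2 y2 g2 x3 z3 z2
begin

text \<open>The matches are read off as intersections: of \<open>I3\<close> and \<open>O2\<close> in
  \<open>X2\<close>, then of \<open>I32\<close> and \<open>O1\<close> in \<open>X1\<close>.\<close>

lemma triB_match_ex:
  obtains N' P3 P2 O32 I32 W' n3 nb k3 d3 kb db p3 q3 qb rb m3 mb jj c l \<nu>2 \<nu>1 \<nu>2' \<nu>1' where
    "triB C O1 K1 I1 O2 K2 I2 O3 K3 I3 o1 i1 o2 i2 o3 i3 X1 X2 L1 L2 Z x1 x2 f1 e1 f2 e2 y2 g2 x3 z3 z2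
      N' P3 P2 O32 I32 W' n3 nb k3 d3 kb db p3 q3 qb rb m3 mb jj c l"
    "composite_data R3 (\<nu>2, \<nu>1) R2 (n3, nb, k3, d3, kb, db, p3, q3, qb, rb, m3, mb)"
    "chosen_data R3 (\<nu>2, \<nu>1) R2 = (n3, nb, k3, d3, kb, db, p3, q3, qb, rb, m3, mb)"
    "bc \<nu>2' \<nu>1' l x1" "span_rep C (\<nu>2, \<nu>1)" "span_rep C (\<nu>2', \<nu>1')"
proof -
  obtain \<nu>2 \<nu>1 M where p: "pb \<nu>2 \<nu>1 x3 y2" and tn: "mor \<nu>2 M I3" "mor \<nu>1 M O2" and r:
      "span_rep C (\<nu>2, \<nu>1)"
    by (rule pb_rep_ex[OF tri_mor(9,7)])
  note sub = equalityD1[OF pbD(10)[OF p]]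
  have univ: "\<exists>jj. mor jj N X2 \<and> jj \<cdot> n = x3 \<and> jj \<cdot> n' = y2"
    if b: "bc \<nu>2 \<nu>1 n n'" and t: "mor n I3 N" "mor n' O2 N" for n n' N
    by (rule bc_univ[OF b _ _ pbD(9)[OF p] sub, of X2]) (use t in \<open>simp, simp, auto\<close>)
  obtain N n n' where b: "bc \<nu>2 \<nu>1 n n'" and t: "mor n I3 N" "mor n' O2 N" by (rule bc_ex[OF tn])
  obtain j where j: "mor j N X2" "j \<cdot> n = x3" "j \<cdot> n' = y2" using univ[OF b t] by blast
  \<comment> \<open>Intersecting \<open>L2\<close> with the union of \<open>I3\<close> and
    \<open>O2\<close> gives the pushout complement that makes the inner match composable.\<close>
  obtain Y e a where pe: "pb e a j g2" by (rule pb_ex[OF j(1) tri_mor(8)])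
  obtain g' where k: "bc o2 g' n' e"
    by (rule bc_restrict[OF X2_left j(3)[symmetric] _ _ pe]) (use t j(1) in \<open>simp, simp, blast\<close>)
  obtain N' P3 P2 O32 I32 W' n3 nb k3 d3 kb db p3 q3 qb rb m3 mb where D: "composite_data R3 (\<nu>2, \<nu>1) R2
      (n3, nb,
      k3, d3, kb, db, p3, q3, qb, rb, m3, mb)" and e: "chosen_data R3 (\<nu>2, \<nu>1) R2 = (n3, nb, k3, d3, kb,
          db, p3,
      q3, qb, rb, m3, mb)" and H: "composite32 C O1 K1 I1 O2 K2 I2 O3 K3 I3 o1 i1 o2 i2 o3 i3 N' P3 P2
          O32 I32 W' n3 nb
      k3 d3 kb db p3 q3 qb rb m3 mb"
    by (rule composite32_ex[OF b tn k])
  interpret D: composite32 C O1 K1 I1 O2 K2 I2 O3 K3 I3 o1 i1 o2 i2 o3 i3 N' P3 P2 O32 I32 W' n3 nb k3 d3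
      kb db p3 q3 qb
      rb m3 mb by (rule H)
  interpret H: tri32 C O1 K1 I1 O2 K2 I2 O3 K3 I3 o1 i1 o2 i2 o3 i3 X1 X2 L1 L2 Z x1 x2 f1 e1 f2 e2 y2 g2
      x3 z3 z2
      N' P3 P2 O32 I32 W' n3 nb k3 d3 kb db p3 q3 qb rb m3 mb by unfold_locales
  obtain jj where jj: "mor jj N' X2" "jj \<cdot> n3 = x3" "jj \<cdot> nb = y2" using univ[OF composite_dataD(1)[OF D]
      D.composite32_mor(1,2)] by blast
  obtain c l where T: "triB C O1 K1 I1 O2 K2 I2 O3 K3 I3 o1 i1 o2 i2 o3 i3 X1 X2 L1 L2 Z x1 x2 f1 e1 f2
      e2 y2 g2 x3
      z3 z2 N' P3 P2 O32 I32 W' n3 nb k3 d3 kb db p3 q3 qb rb m3 mb jj c l"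
    by (rule H.triB_ex[OF jj])
  interpret T: triB C O1 K1 I1 O2 K2 I2 O3 K3 I3 o1 i1 o2 i2 o3 i3 X1 X2 L1 L2 Z x1 x2 f1 e1 f2 e2 y2 g2
      x3 z3 z2
      N' P3 P2 O32 I32 W' n3 nb k3 d3 kb db p3 q3 qb rb m3 mb jj c l
    by (rule T)
  obtain \<nu>2' \<nu>1' M' where p': "pb \<nu>2' \<nu>1' l x1" and r': "span_rep C (\<nu>2', \<nu>1')"
    by (rule pb_rep_ex[OF T.triB_mor(3) tri_mor(1)])
  have b': "bc \<nu>2' \<nu>1' l x1" unfolding bc_def using p' T.X1_cover' T.triB_mor(3) by simp
  show ?thesis by (rule that[OF T D e b' r r'])
qed

text \<open>Dual bookkeeping: the inner match is the intersection of \<open>I2\<close> and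
  \<open>O1\<close> in \<open>X1\<close>, with its pushout complement cut out of \<open>L1\<close>;
  the outer one is the intersection of \<open>I3\<close> and \<open>O21\<close> in
  \<open>X2\<close>.\<close>

lemma triA_match_ex:
  obtains N M2 M1 O21 I21 W n2 n1 k2 d2 k1 d1 p2 q2 q1 p1 l2 l1 j a2 h \<mu>2 \<mu>1 \<mu>2' \<mu>1' where
    "triA C O1 K1 I1 O2 K2 I2 O3 K3 I3 o1 i1 o2 i2 o3 i3 X1 X2 L1 L2 Z x1 x2 f1 e1 f2 e2 y2 g2 x3 z3 z2
      N M2 M1 O21 I21 W n2 n1 k2 d2 k1 d1 p2 q2 q1 p1 l2 l1 j a2 h"
    "composite_data R2 (\<mu>2, \<mu>1) R1 (n2, n1, k2, d2, k1, d1, p2, q2, q1, p1, l2, l1)"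
    "chosen_data R2 (\<mu>2, \<mu>1) R1 = (n2, n1, k2, d2, k1, d1, p2, q2, q1, p1, l2, l1)"
    "bc \<mu>2' \<mu>1' x3 h" "span_rep C (\<mu>2, \<mu>1)" "span_rep C (\<mu>2', \<mu>1')"
proof -
  obtain \<mu>2 \<mu>1 M where p: "pb \<mu>2 \<mu>1 x2 x1" and tn: "mor \<mu>2 M I2" "mor \<mu>1 M O1" and r:
      "span_rep C (\<mu>2, \<mu>1)"
    by (rule pb_rep_ex[OF tri_mor(2,1)])
  note sub = equalityD1[OF pbD(10)[OF p]]
  have univ: "\<exists>j. mor j N X1 \<and> j \<cdot> n = x2 \<and> j \<cdot> n' = x1"
    if b: "bc \<mu>2 \<mu>1 n n'" and t: "mor n I2 N" "mor n' O1 N" for n n' N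
    by (rule bc_univ[OF b _ _ pbD(9)[OF p] sub, of X1]) (use t in \<open>simp, simp, auto\<close>)
  obtain N n n' where b: "bc \<mu>2 \<mu>1 n n'" and t: "mor n I2 N" "mor n' O1 N" by (rule bc_ex[OF tn])
  obtain i where i: "mor i N X1" "i \<cdot> n = x2" "i \<cdot> n' = x1" using univ[OF b t] by blast
  obtain Y e a where pe: "pb e a i e1" by (rule pb_ex[OF i(1) tri_mor(4)])
  obtain g' where k: "bc o1 g' n' e"
    by (rule bc_restrict[OF X1_left i(3)[symmetric] _ _ pe]) (use t i(1) in \<open>simp, simp, blast\<close>)
  obtain N M2 M1 O21 I21 W n2 n1 k2 d2 k1 d1 p2 q2 q1 p1 l2 l1 where D: "composite_data R2 (\<mu>2, \<mu>1) R1
      (n2, n1, k2,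
      d2, k1, d1, p2, q2, q1, p1, l2, l1)" and e: "chosen_data R2 (\<mu>2, \<mu>1) R1 = (n2, n1, k2, d2, k1, d1,
          p2, q2,
      q1, p1, l2, l1)" and H: "composite21 C O1 K1 I1 O2 K2 I2 O3 K3 I3 o1 i1 o2 i2 o3 i3 N M2 M1 O21 I21
          W n2 n1 k2 d2
      k1 d1 p2 q2 q1 p1 l2 l1"
    by (rule composite21_ex[OF b tn k])
  interpret D: composite21 C O1 K1 I1 O2 K2 I2 O3 K3 I3 o1 i1 o2 i2 o3 i3 N M2 M1 O21 I21 W n2 n1 k2 d2
      k1 d1 p2 q2 q1 p1
      l2 l1 by (rule H)
  interpret H: tri21 C O1 K1 I1 O2 K2 I2 O3 K3 I3 o1 i1 o2 i2 o3 i3 X1 X2 L1 L2 Z x1 x2 f1 e1 f2 e2 y2 g2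
      x3 z3 z2
      N M2 M1 O21 I21 W n2 n1 k2 d2 k1 d1 p2 q2 q1 p1 l2 l1 by unfold_locales
  obtain j where j: "mor j N X1" "j \<cdot> n2 = x2" "j \<cdot> n1 = x1" using univ[OF composite_dataD(1)[OF D]
      D.composite21_mor(1,2)] by blast
  obtain a2 h where T: "triA C O1 K1 I1 O2 K2 I2 O3 K3 I3 o1 i1 o2 i2 o3 i3 X1 X2 L1 L2 Z x1 x2 f1 e1 f2
      e2 y2 g2
      x3 z3 z2 N M2 M1 O21 I21 W n2 n1 k2 d2 k1 d1 p2 q2 q1 p1 l2 l1 j a2 h"
    by (rule H.triA_ex[OF j])
  interpret T: triA C O1 K1 I1 O2 K2 I2 O3 K3 I3 o1 i1 o2 i2 o3 i3 X1 X2 L1 L2 Z x1 x2 f1 e1 f2 e2 y2 g2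
      x3 z3 z2 N
      M2 M1 O21 I21 W n2 n1 k2 d2 k1 d1 p2 q2 q1 p1 l2 l1 j a2 h
    by (rule T)
  obtain \<mu>2' \<mu>1' M' where p': "pb \<mu>2' \<mu>1' x3 h" and r': "span_rep C (\<mu>2', \<mu>1')"
    by (rule pb_rep_ex[OF tri_mor(9) T.triA_mor(3)])
  have b': "bc \<mu>2' \<mu>1' x3 h" unfolding bc_def using p' T.X2_cover tri_mor(9) by simp
  show ?thesis by (rule that[OF T D e b' r r'])
qed

end

section \<open>The correspondence relation: totality and uniqueness\<close>

context three_conds
begin

inductive corresponds where
  corrI: "correspondence C O1 K1 I1 O2 K2 I2 O3 K3 I3 o1 i1 o2 i2 o3 i3 c1 c2 c3 X1 X2 L1 L2 Z x1 x2 f1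
      e1 f2 e2 y2 g2
      x3 z3 z2 N M2 M1 O21 I21 W n2 n1 k2 d2 k1 d1 p2 q2 q1 p1 l2 l1 j a2 h N' P3 P2 O32 I32 W' n3 nb k3
          d3 kb db
      p3 q3 qb rb m3 mb jj c l \<mu>2 \<mu>1 \<mu>2' \<mu>1' \<nu>2 \<nu>1 \<nu>2' \<nu>1'
    \<Longrightarrow> corresponds ((\<mu>2, \<mu>1), (\<mu>2', \<mu>1')) ((\<nu>2, \<nu>1), (\<nu>2', \<nu>1'))"

text \<open>The pair of matches is first completed to a triple by \<open>tri_from_A\<close>, from
  which the opposite pair is then read off.\<close>

lemma corr_ex_right:
  assumes M: "(\<mu>2, \<mu>1) \<in> sq_matches C R2 R1" and M': "(\<mu>2', \<mu>1') \<in> sq_matches C R3 (R21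
      (\<mu>2, \<mu>1))"
  shows "\<exists>b. corresponds ((\<mu>2, \<mu>1), (\<mu>2', \<mu>1')) b"
proof -
  obtain na nc k d where tm: "mor \<mu>2 (Dom C \<mu>1) I2" "mor \<mu>1 (Dom C \<mu>1) O1" and r: "span_rep C
      (\<mu>2, \<mu>1)"
    and b: "bc \<mu>2 \<mu>1 na nc" and k: "bc o1 k nc d"
    using M unfolding sq_matches_iff[OF rules(3,4,1,2)] by blast
  obtain N M2 M1 O21 I21 W n2 n1 k2 d2 k1 d1 p2 q2 q1 p1 l2 l1 where D: "composite_data R2 (\<mu>2, \<mu>1) R1
      (n2, n1, k2,
      d2, k1, d1, p2, q2, q1, p1, l2, l1)" and e: "chosen_data R2 (\<mu>2, \<mu>1) R1 = (n2, n1, k2, d2, k1, d1,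
          p2, q2,
      q1, p1, l2, l1)" and H: "composite21 C O1 K1 I1 O2 K2 I2 O3 K3 I3 o1 i1 o2 i2 o3 i3 N M2 M1 O21 I21
          W n2 n1 k2 d2
      k1 d1 p2 q2 q1 p1 l2 l1"
    by (rule composite21_ex[OF b tm k])
  interpret H: composite21 C O1 K1 I1 O2 K2 I2 O3 K3 I3 o1 i1 o2 i2 o3 i3 N M2 M1 O21 I21 W n2 n1 k2 d2
      k1 d1 p2 q2 q1 p1
      l2 l1 by (rule H)
  have R: "R21 (\<mu>2, \<mu>1) = ((q2 \<cdot> l2, q1 \<cdot> l1), snd (R21 (\<mu>2, \<mu>1)))"
    using composite_dataD(7)[OF D] by (metis prod.collapse)
  have tt: "mor (q2 \<cdot> l2) W O21" "mor (q1 \<cdot> l1) W I21" by simp_all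
  obtain x3 h s dl where tm': "mor \<mu>2' (Dom C \<mu>1') I3" "mor \<mu>1' (Dom C \<mu>1') O21" and r': "span_rep
      C (\<mu>2', \<mu>1')"
    and b': "bc \<mu>2' \<mu>1' x3 h" and B: "bc (q2 \<cdot> l2) s h dl"
    using M'[unfolded sq_matches_iff[OF rules(5,6) tt, of \<mu>2' \<mu>1' c3 "snd (R21 (\<mu>2, \<mu>1))", folded
        R]] by blast
  obtain X2 where x3: "mor x3 I3 X2" "mor h O21 X2" using bc_mor'[OF b' tm'] by blast
  obtain V where V: "mor s W V" "mor dl V X2" using bc_mor[OF B tt(1) x3(2)] by blast
  have cov2: "pts X2 \<subseteq> cl X2 (img x3 \<union> img h)" using bcD(12)[OF b'] x3(1) by simp
  obtain X1 L1 L2 Z x1 x2 f1 e1 f2 e2 y2 g2 z3 z2 j a2 where T: "triA C O1 K1 I1 O2 K2 I2 O3 K3 I3 o1 i1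
      o2 i2 o3
      i3 X1 X2 L1 L2 Z x1 x2 f1 e1 f2 e2 y2 g2 x3 z3 z2 N M2 M1 O21 I21 W n2 n1 k2 d2 k1 d1 p2 q2 q1 p1
          l2 l1 j a2 h"
    by (rule H.tri_from_A[OF x3 cov2 B V])
  interpret T: triA C O1 K1 I1 O2 K2 I2 O3 K3 I3 o1 i1 o2 i2 o3 i3 X1 X2 L1 L2 Z x1 x2 f1 e1 f2 e2 y2 g2
      x3 z3 z2 N
      M2 M1 O21 I21 W n2 n1 k2 d2 k1 d1 p2 q2 q1 p1 l2 l1 j a2 h
    by (rule T)
  interpret TC: triple_conds C O1 K1 I1 O2 K2 I2 O3 K3 I3 o1 i1 o2 i2 o3 i3 c1 c2 c3 X1 X2 L1 L2 Z x1 x2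
      f1 e1 f2 e2
      y2 g2 x3 z3 z2
    by unfold_locales
  obtain N' P3 P2 O32 I32 W' n3 nb k3 d3 kb db p3 q3 qb rb m3 mb jj c l \<nu>2 \<nu>1 \<nu>2' \<nu>1' where U:
      "triB C O1 K1 I1 O2 K2 I2 O3 K3 I3 o1 i1 o2 i2 o3 i3 X1 X2 L1 L2 Z x1 x2 f1 e1 f2 e2 y2 g2 x3 z3 z2
      N' P3 P2 O32 I32 W' n3 nb k3 d3 kb db p3 q3 qb rb m3 mb jj c l"
    and u: "composite_data R3 (\<nu>2, \<nu>1) R2 (n3, nb, k3, d3, kb, db, p3, q3, qb, rb, m3, mb)"
    "chosen_data R3 (\<nu>2, \<nu>1) R2 = (n3, nb, k3, d3, kb, db, p3, q3, qb, rb, m3, mb)"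
    "bc \<nu>2' \<nu>1' l x1" "span_rep C (\<nu>2, \<nu>1)" "span_rep C (\<nu>2', \<nu>1')"
    by (rule TC.triB_match_ex)
  have "correspondence C O1 K1 I1 O2 K2 I2 O3 K3 I3 o1 i1 o2 i2 o3 i3 c1 c2 c3 X1 X2 L1 L2 Z x1 x2 f1 e1
      f2 e2 y2 g2 x3
      z3 z2 N M2 M1 O21 I21 W n2 n1 k2 d2 k1 d1 p2 q2 q1 p1 l2 l1 j a2 h N' P3 P2 O32 I32 W' n3 nb k3 d3
          kb db p3
      q3 qb rb m3 mb jj c l \<mu>2 \<mu>1 \<mu>2' \<mu>1' \<nu>2 \<nu>1 \<nu>2' \<nu>1'"
    by (intro correspondence.intro correspondence_axioms.intro triAB.intro T U u D e b' r r'
        three_conds_axioms)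
  then show ?thesis by (blast intro: corrI)
qed

lemma corr_ex_left:
  assumes M: "(\<nu>2, \<nu>1) \<in> sq_matches C R3 R2" and M': "(\<nu>2', \<nu>1') \<in> sq_matches C (R32
      (\<nu>2, \<nu>1)) R1"
  shows "\<exists>a. corresponds a ((\<nu>2, \<nu>1), (\<nu>2', \<nu>1'))"
proof -
  obtain na nc k d where tm: "mor \<nu>2 (Dom C \<nu>1) I3" "mor \<nu>1 (Dom C \<nu>1) O2" and r: "span_rep C
      (\<nu>2, \<nu>1)"
    and b: "bc \<nu>2 \<nu>1 na nc" and k: "bc o2 k nc d"
    using M unfolding sq_matches_iff[OF rules(5,6,3,4)] by blast
  obtain N' P3 P2 O32 I32 W' n3 nb k3 d3 kb db p3 q3 qb rb m3 mb where D: "composite_data R3 (\<nu>2, \<nu>1) R2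
      (n3, nb,
      k3, d3, kb, db, p3, q3, qb, rb, m3, mb)" and e: "chosen_data R3 (\<nu>2, \<nu>1) R2 = (n3, nb, k3, d3, kb,
          db, p3,
      q3, qb, rb, m3, mb)" and H: "composite32 C O1 K1 I1 O2 K2 I2 O3 K3 I3 o1 i1 o2 i2 o3 i3 N' P3 P2
          O32 I32 W' n3 nb
      k3 d3 kb db p3 q3 qb rb m3 mb"
    by (rule composite32_ex[OF b tm k])
  interpret H: composite32 C O1 K1 I1 O2 K2 I2 O3 K3 I3 o1 i1 o2 i2 o3 i3 N' P3 P2 O32 I32 W' n3 nb k3 d3
      kb db p3 q3 qb
      rb m3 mb by (rule H)
  have R: "R32 (\<nu>2, \<nu>1) = ((q3 \<cdot> m3, qb \<cdot> mb), snd (R32 (\<nu>2, \<nu>1)))"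
    using composite_dataD(7)[OF D] by (metis prod.collapse)
  have tt: "mor (q3 \<cdot> m3) W' O32" "mor (qb \<cdot> mb) W' I32" by simp_all
  obtain l x1 f1 e1 where tm': "mor \<nu>2' (Dom C \<nu>1') I32" "mor \<nu>1' (Dom C \<nu>1') O1" and r': "span_rep
      C (\<nu>2', \<nu>1')"
    and b': "bc \<nu>2' \<nu>1' l x1" and B: "bc o1 f1 x1 e1"
    using M'[unfolded sq_matches_iff[OF tt rules(1,2), of \<nu>2' \<nu>1' "snd (R32 (\<nu>2, \<nu>1))" c1, folded
        R]] by blast
  obtain X1 where x1: "mor l I32 X1" "mor x1 O1 X1" using bc_mor'[OF b' tm'] by blast
  obtain L1 where L1: "mor f1 K1 L1" "mor e1 L1 X1" using bc_mor[OF B rules(1) x1(2)] by blast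
  have cov2: "pts X1 \<subseteq> cl X1 (img l \<union> img x1)" using bcD(12)[OF b'] x1(1) by simp
  obtain X2 L2 Z x2 f2 e2 y2 g2 x3 z3 z2 jj c where T: "triB C O1 K1 I1 O2 K2 I2 O3 K3 I3 o1 i1 o2 i2 o3
      i3 X1 X2
      L1 L2 Z x1 x2 f1 e1 f2 e2 y2 g2 x3 z3 z2 N' P3 P2 O32 I32 W' n3 nb k3 d3 kb db p3 q3 qb rb m3 mb jj c l"
    by (rule H.tri_from_B[OF x1 cov2 B L1])
  interpret T: triB C O1 K1 I1 O2 K2 I2 O3 K3 I3 o1 i1 o2 i2 o3 i3 X1 X2 L1 L2 Z x1 x2 f1 e1 f2 e2 y2 g2
      x3 z3 z2
      N' P3 P2 O32 I32 W' n3 nb k3 d3 kb db p3 q3 qb rb m3 mb jj c l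
    by (rule T)
  interpret TC: triple_conds C O1 K1 I1 O2 K2 I2 O3 K3 I3 o1 i1 o2 i2 o3 i3 c1 c2 c3 X1 X2 L1 L2 Z x1 x2
      f1 e1 f2 e2
      y2 g2 x3 z3 z2
    by unfold_locales
  obtain N M2 M1 O21 I21 W n2 n1 k2 d2 k1 d1 p2 q2 q1 p1 l2 l1 j a2 h \<mu>2 \<mu>1 \<mu>2' \<mu>1' where U: "triA
      C O1 K1 I1 O2 K2 I2 O3 K3 I3 o1 i1 o2 i2 o3 i3 X1 X2 L1 L2 Z x1 x2 f1 e1 f2 e2 y2 g2 x3 z3 z2
      N M2 M1 O21 I21 W n2 n1 k2 d2 k1 d1 p2 q2 q1 p1 l2 l1 j a2 h"
    and u: "composite_data R2 (\<mu>2, \<mu>1) R1 (n2, n1, k2, d2, k1, d1, p2, q2, q1, p1, l2, l1)"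
    "chosen_data R2 (\<mu>2, \<mu>1) R1 = (n2, n1, k2, d2, k1, d1, p2, q2, q1, p1, l2, l1)"
    "bc \<mu>2' \<mu>1' x3 h" "span_rep C (\<mu>2, \<mu>1)" "span_rep C (\<mu>2', \<mu>1')"
    by (rule TC.triA_match_ex)
  have "correspondence C O1 K1 I1 O2 K2 I2 O3 K3 I3 o1 i1 o2 i2 o3 i3 c1 c2 c3 X1 X2 L1 L2 Z x1 x2 f1 e1
      f2 e2 y2 g2 x3
      z3 z2 N M2 M1 O21 I21 W n2 n1 k2 d2 k1 d1 p2 q2 q1 p1 l2 l1 j a2 h N' P3 P2 O32 I32 W' n3 nb k3 d3
          kb db p3
      q3 qb rb m3 mb jj c l \<mu>2 \<mu>1 \<mu>2' \<mu>1' \<nu>2 \<nu>1 \<nu>2' \<nu>1'"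
    by (intro correspondence.intro correspondence_axioms.intro triAB.intro T U u D e b' r r'
        three_conds_axioms)
  then show ?thesis by (blast intro: corrI)
qed

end

context correspondence
begin

text \<open>Objects are separate locale parameters; this lets an identification of the arrows carry
  over to them.\<close>

lemma objects21: "N = Cod C n2 \<and> M2 = Dom C d2 \<and> M1 = Dom C d1 \<and> O21 = Cod C p2 \<and> I21 = Cod C
    q1 \<and> W = Dom C l2"
  by simp

lemma objects32: "N' = Cod C n3 \<and> P3 = Dom C d3 \<and> P2 = Dom C db \<and> O32 = Cod C p3 \<and> I32 = Cod C
    qb \<and> W' = Dom C m3"
  by simp

text \<open>The pullback in \<open>N\<close> remains one in \<open>X1\<close> because
  \<open>j\<close> is monic, so the inner match depends on the triple only.\<close>

lemma span21: "pb \<mu>2 \<mu>1 x2 x1"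
  using pb_postcomp[OF bcD(11)[OF composite_dataD(1)[OF compd21]], of j X1] by (simp add: j_n2 j_n1)

lemma span32: "pb \<nu>2 \<nu>1 x3 y2"
  using pb_postcomp[OF bcD(11)[OF composite_dataD(1)[OF compd32]], of jj X2] by (simp add: jj_n3 jj_nb)

end

context three_conds
begin

text \<open>Equal left matches have equal chosen data, which makes the two triples comparable. The
  comparison first equates the inner matches on the right; only then do their data coincide, and the
  outer matches can be compared over the same \<open>I32\<close>.\<close>

lemma corr_unique_right:
  assumes P: "correspondence C O1 K1 I1 O2 K2 I2 O3 K3 I3 o1 i1 o2 i2 o3 i3 c1 c2 c3 X1 X2 L1 L2 Z x1 x2
      f1 e1 f2 e2 y2
      g2 x3 z3 z2 N M2 M1 O21 I21 W n2 n1 k2 d2 k1 d1 p2 q2 q1 p1 l2 l1 j a2 h N' P3 P2 O32 I32 W' n3 nb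
          k3 d3 kb
      db p3 q3 qb rb m3 mb jj c l \<mu>2 \<mu>1 \<mu>2' \<mu>1' \<nu>2 \<nu>1 \<nu>2' \<nu>1'"
    and Q: "correspondence C O1 K1 I1 O2 K2 I2 O3 K3 I3 o1 i1 o2 i2 o3 i3 c1 c2 c3 X1s X2s L1s L2s Zs x1s
        x2s f1s e1s
        f2s e2s y2s g2s x3s z3s z2s Ns M2s M1s O21s I21s Ws n2s n1s k2s d2s k1s d1s p2s q2s q1s p1s l2s
            l1s js a2s
        hs Ns' P3s P2s O32s I32s Ws' n3s nbs k3s d3s kbs dbs p3s q3s qbs rbs m3s mbs jjs cs ls \<mu>2 \<mu>1
        \<mu>2' \<mu>1' \<nu>2s \<nu>1s \<nu>2s' \<nu>1s'"
  shows "((\<nu>2, \<nu>1), (\<nu>2', \<nu>1')) = ((\<nu>2s, \<nu>1s), (\<nu>2s', \<nu>1s'))"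
proof -
  have "(n2s, n1s, k2s, d2s, k1s, d1s, p2s, q2s, q1s, p1s, l2s, l1s) = (n2, n1, k2, d2, k1, d1, p2, q2,
      q1, p1, l2, l1)"
    using correspondence.cdat21[OF P] correspondence.cdat21[OF Q] by simp
  then have e: "n2s = n2" "n1s = n1" "k2s = k2" "d2s = d2" "k1s = k1" "d1s = d1" "p2s = p2" "q2s = q2"
      "q1s = q1"
      "p1s = p1" "l2s = l2" "l1s = l1" by simp_all
  have o: "Ns = N" "M2s = M2" "M1s = M1" "O21s = O21" "I21s = I21" "Ws = W"
    using correspondence.objects21[OF P] correspondence.objects21[OF Q] by (simp_all add: e)
  have Q1: "correspondence C O1 K1 I1 O2 K2 I2 O3 K3 I3 o1 i1 o2 i2 o3 i3 c1 c2 c3 X1s X2s L1s L2s Zs x1s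
      x2s f1s e1s
      f2s e2s y2s g2s x3s z3s z2s N M2 M1 O21 I21 W n2 n1 k2 d2 k1 d1 p2 q2 q1 p1 l2 l1 js a2s hs Ns' P3s
          P2s O32s
      I32s Ws' n3s nbs k3s d3s kbs dbs p3s q3s qbs rbs m3s mbs jjs cs ls \<mu>2 \<mu>1 \<mu>2' \<mu>1' \<nu>2s
      \<nu>1s \<nu>2s' \<nu>1s'"
    using Q unfolding e o by assumption
  interpret P: correspondence C O1 K1 I1 O2 K2 I2 O3 K3 I3 o1 i1 o2 i2 o3 i3 c1 c2 c3 X1 X2 L1 L2 Z x1 x2
      f1 e1 f2 e2 y2
      g2 x3 z3 z2 N M2 M1 O21 I21 W n2 n1 k2 d2 k1 d1 p2 q2 q1 p1 l2 l1 j a2 h N' P3 P2 O32 I32 W' n3 nb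
          k3 d3 kb
      db p3 q3 qb rb m3 mb jj c l \<mu>2 \<mu>1 \<mu>2' \<mu>1' \<nu>2 \<nu>1 \<nu>2' \<nu>1'
    by (rule P)
  interpret Q: correspondence C O1 K1 I1 O2 K2 I2 O3 K3 I3 o1 i1 o2 i2 o3 i3 c1 c2 c3 X1s X2s L1s L2s Zs
      x1s x2s f1s e1s
      f2s e2s y2s g2s x3s z3s z2s N M2 M1 O21 I21 W n2 n1 k2 d2 k1 d1 p2 q2 q1 p1 l2 l1 js a2s hs Ns' P3s
          P2s O32s
      I32s Ws' n3s nbs k3s d3s kbs dbs p3s q3s qbs rbs m3s mbs jjs cs ls \<mu>2 \<mu>1 \<mu>2' \<mu>1' \<nu>2s
      \<nu>1s \<nu>2s' \<nu>1s'
    by (rule Q1)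
  interpret A: triA_pair C O1 K1 I1 O2 K2 I2 O3 K3 I3 o1 i1 o2 i2 o3 i3 X1 X2 L1 L2 Z x1 x2 f1 e1 f2 e2
      y2 g2 x3 z3
      z2 X1s X2s L1s L2s Zs x1s x2s f1s e1s f2s e2s y2s g2s x3s z3s z2s N M2 M1 O21 I21 W n2 n1 k2 d2 k1
          d1 p2 q2
      q1 p1 l2 l1 j a2 h js a2s hs
    by unfold_locales
  obtain u w v where t: "mor u X1 X1s" "mor w L2 L2s" "mor v X2 X2s"
    and m: "u \<cdot> x1 = x1s" "u \<cdot> x2 = x2s" "u \<cdot> e2 = e2s \<cdot> w" "v \<cdot> x3 = x3s" "v \<cdot>
        y2 = y2s" "v \<cdot> g2 = g2s \<cdot> w"
    by (rule A.triple_mor[OF P.bcA Q.bcA])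
  \<comment> \<open>Both inner spans are now pullbacks of one cospan, and both are
    representatives.\<close>
  have "pb \<nu>2 \<nu>1 x3s y2s" using pb_postcomp[OF P.span32, of v X2s] t(3) by (simp add: m)
  then have n: "(\<nu>2, \<nu>1) = (\<nu>2s, \<nu>1s)" by (rule pb_rep_unique[OF _ Q.span32 P.reps(3) Q.reps(3)])
  have "(n3s, nbs, k3s, d3s, kbs, dbs, p3s, q3s, qbs, rbs, m3s, mbs) = (n3, nb, k3, d3, kb, db, p3, q3,
      qb, rb, m3, mb)"
    using P.cdat32 Q.cdat32 n by simp
  then have e': "n3s = n3" "nbs = nb" "k3s = k3" "d3s = d3" "kbs = kb" "dbs = db" "p3s = p3" "q3s = q3"
      "qbs = qb"
      "rbs = rb" "m3s = m3" "mbs = mb" by simp_all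
  have o': "Ns' = N'" "P3s = P3" "P2s = P2" "O32s = O32" "I32s = I32" "Ws' = W'"
    using P.objects32 Q.objects32 by (simp_all add: e')
  have T: "triB C O1 K1 I1 O2 K2 I2 O3 K3 I3 o1 i1 o2 i2 o3 i3 X1s X2s L1s L2s Zs x1s x2s f1s e1s f2s e2s
      y2s g2s
      x3s z3s z2s N' P3 P2 O32 I32 W' n3 nb k3 d3 kb db p3 q3 qb rb m3 mb jjs cs ls"
    using Q.triB_axioms unfolding e' o' by assumption
  interpret T: triB C O1 K1 I1 O2 K2 I2 O3 K3 I3 o1 i1 o2 i2 o3 i3 X1s X2s L1s L2s Zs x1s x2s f1s e1s f2s
      e2s y2s
      g2s x3s z3s z2s N' P3 P2 O32 I32 W' n3 nb k3 d3 kb db p3 q3 qb rb m3 mb jjs cs ls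
    by (rule T)
  interpret B: triB_pair C O1 K1 I1 O2 K2 I2 O3 K3 I3 o1 i1 o2 i2 o3 i3 X1 X2 L1 L2 Z x1 x2 f1 e1 f2 e2
      y2 g2 x3 z3
      z2 X1s X2s L1s L2s Zs x1s x2s f1s e1s f2s e2s y2s g2s x3s z3s z2s N' P3 P2 O32 I32 W' n3 nb k3 d3
          kb db p3 q3
      qb rb m3 mb jj c l jjs cs ls
    by unfold_locales
  \<comment> \<open>Meaningful only after the inner data have been identified: \<open>l\<close> and
    \<open>ls\<close> now start at the same object.\<close>
  have l: "u \<cdot> l = ls" by (rule B.triple_mor_B[OF t m])
  have "pb \<nu>2' \<nu>1' ls x1s" using pb_postcomp[OF bcD(11)[OF P.bcB], of u X1s] t(1) by (simp add: m l)
  then have "(\<nu>2', \<nu>1') = (\<nu>2s', \<nu>1s')" by (rule pb_rep_unique[OF _ bcD(11)[OF Q.bcB] P.reps(4)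
      Q.reps(4)])
  with n show ?thesis by simp
qed

lemma corr_unique_left:
  assumes P: "correspondence C O1 K1 I1 O2 K2 I2 O3 K3 I3 o1 i1 o2 i2 o3 i3 c1 c2 c3 X1 X2 L1 L2 Z x1 x2
      f1 e1 f2 e2 y2
      g2 x3 z3 z2 N M2 M1 O21 I21 W n2 n1 k2 d2 k1 d1 p2 q2 q1 p1 l2 l1 j a2 h N' P3 P2 O32 I32 W' n3 nb
          k3 d3 kb
      db p3 q3 qb rb m3 mb jj c l \<mu>2 \<mu>1 \<mu>2' \<mu>1' \<nu>2 \<nu>1 \<nu>2' \<nu>1'"
    and Q: "correspondence C O1 K1 I1 O2 K2 I2 O3 K3 I3 o1 i1 o2 i2 o3 i3 c1 c2 c3 X1s X2s L1s L2s Zs x1s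
        x2s f1s e1s
        f2s e2s y2s g2s x3s z3s z2s Ns M2s M1s O21s I21s Ws n2s n1s k2s d2s k1s d1s p2s q2s q1s p1s l2s
            l1s js a2s
        hs Ns' P3s P2s O32s I32s Ws' n3s nbs k3s d3s kbs dbs p3s q3s qbs rbs m3s mbs jjs cs ls \<mu>2s \<mu>1s
        \<mu>2s' \<mu>1s' \<nu>2 \<nu>1 \<nu>2' \<nu>1'"
  shows "((\<mu>2, \<mu>1), (\<mu>2', \<mu>1')) = ((\<mu>2s, \<mu>1s), (\<mu>2s', \<mu>1s'))"
proof -
  have "(n3s, nbs, k3s, d3s, kbs, dbs, p3s, q3s, qbs, rbs, m3s, mbs) = (n3, nb, k3, d3, kb, db, p3, q3,
      qb, rb, m3, mb)"
    using correspondence.cdat32[OF P] correspondence.cdat32[OF Q] by simp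
  then have e: "n3s = n3" "nbs = nb" "k3s = k3" "d3s = d3" "kbs = kb" "dbs = db" "p3s = p3" "q3s = q3"
      "qbs = qb"
      "rbs = rb" "m3s = m3" "mbs = mb" by simp_all
  have o: "Ns' = N'" "P3s = P3" "P2s = P2" "O32s = O32" "I32s = I32" "Ws' = W'"
    using correspondence.objects32[OF P] correspondence.objects32[OF Q] by (simp_all add: e)
  have Q1: "correspondence C O1 K1 I1 O2 K2 I2 O3 K3 I3 o1 i1 o2 i2 o3 i3 c1 c2 c3 X1s X2s L1s L2s Zs x1s
      x2s f1s e1s
      f2s e2s y2s g2s x3s z3s z2s Ns M2s M1s O21s I21s Ws n2s n1s k2s d2s k1s d1s p2s q2s q1s p1s l2s l1s
          js a2s hs
      N' P3 P2 O32 I32 W' n3 nb k3 d3 kb db p3 q3 qb rb m3 mb jjs cs ls \<mu>2s \<mu>1s \<mu>2s' \<mu>1s' \<nu>2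
      \<nu>1 \<nu>2' \<nu>1'"
    using Q unfolding e o by assumption
  interpret P: correspondence C O1 K1 I1 O2 K2 I2 O3 K3 I3 o1 i1 o2 i2 o3 i3 c1 c2 c3 X1 X2 L1 L2 Z x1 x2
      f1 e1 f2 e2 y2
      g2 x3 z3 z2 N M2 M1 O21 I21 W n2 n1 k2 d2 k1 d1 p2 q2 q1 p1 l2 l1 j a2 h N' P3 P2 O32 I32 W' n3 nb
          k3 d3 kb
      db p3 q3 qb rb m3 mb jj c l \<mu>2 \<mu>1 \<mu>2' \<mu>1' \<nu>2 \<nu>1 \<nu>2' \<nu>1'
    by (rule P)
  interpret Q: correspondence C O1 K1 I1 O2 K2 I2 O3 K3 I3 o1 i1 o2 i2 o3 i3 c1 c2 c3 X1s X2s L1s L2s Zs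
      x1s x2s f1s e1s
      f2s e2s y2s g2s x3s z3s z2s Ns M2s M1s O21s I21s Ws n2s n1s k2s d2s k1s d1s p2s q2s q1s p1s l2s l1s
          js a2s hs
      N' P3 P2 O32 I32 W' n3 nb k3 d3 kb db p3 q3 qb rb m3 mb jjs cs ls \<mu>2s \<mu>1s \<mu>2s' \<mu>1s' \<nu>2
      \<nu>1 \<nu>2' \<nu>1'
    by (rule Q1)
  interpret B: triB_pair C O1 K1 I1 O2 K2 I2 O3 K3 I3 o1 i1 o2 i2 o3 i3 X1 X2 L1 L2 Z x1 x2 f1 e1 f2 e2
      y2 g2 x3 z3
      z2 X1s X2s L1s L2s Zs x1s x2s f1s e1s f2s e2s y2s g2s x3s z3s z2s N' P3 P2 O32 I32 W' n3 nb k3 d3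
          kb db p3 q3
      qb rb m3 mb jj c l jjs cs ls
    by unfold_locales
  obtain u w v where t: "mor u X1 X1s" "mor w L2 L2s" "mor v X2 X2s"
    and m: "u \<cdot> x1 = x1s" "u \<cdot> x2 = x2s" "u \<cdot> e2 = e2s \<cdot> w" "v \<cdot> x3 = x3s" "v \<cdot>
        y2 = y2s" "v \<cdot> g2 = g2s \<cdot> w"
    by (rule B.triple_mor[OF P.bcB Q.bcB])
  have "pb \<mu>2 \<mu>1 x2s x1s" using pb_postcomp[OF P.span21, of u X1s] t(1) by (simp add: m)
  then have n: "(\<mu>2, \<mu>1) = (\<mu>2s, \<mu>1s)" by (rule pb_rep_unique[OF _ Q.span21 P.reps(1) Q.reps(1)])
  have "(n2s, n1s, k2s, d2s, k1s, d1s, p2s, q2s, q1s, p1s, l2s, l1s) = (n2, n1, k2, d2, k1, d1, p2, q2,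
      q1, p1, l2, l1)"
    using P.cdat21 Q.cdat21 n by simp
  then have e': "n2s = n2" "n1s = n1" "k2s = k2" "d2s = d2" "k1s = k1" "d1s = d1" "p2s = p2" "q2s = q2"
      "q1s = q1"
      "p1s = p1" "l2s = l2" "l1s = l1" by simp_all
  have o': "Ns = N" "M2s = M2" "M1s = M1" "O21s = O21" "I21s = I21" "Ws = W"
    using P.objects21 Q.objects21 by (simp_all add: e')
  have T: "triA C O1 K1 I1 O2 K2 I2 O3 K3 I3 o1 i1 o2 i2 o3 i3 X1s X2s L1s L2s Zs x1s x2s f1s e1s f2s e2s
      y2s g2s
      x3s z3s z2s N M2 M1 O21 I21 W n2 n1 k2 d2 k1 d1 p2 q2 q1 p1 l2 l1 js a2s hs"
    using Q.triA_axioms unfolding e' o' by assumption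
  interpret T: triA C O1 K1 I1 O2 K2 I2 O3 K3 I3 o1 i1 o2 i2 o3 i3 X1s X2s L1s L2s Zs x1s x2s f1s e1s f2s
      e2s y2s
      g2s x3s z3s z2s N M2 M1 O21 I21 W n2 n1 k2 d2 k1 d1 p2 q2 q1 p1 l2 l1 js a2s hs
    by (rule T)
  interpret A: triA_pair C O1 K1 I1 O2 K2 I2 O3 K3 I3 o1 i1 o2 i2 o3 i3 X1 X2 L1 L2 Z x1 x2 f1 e1 f2 e2
      y2 g2 x3 z3
      z2 X1s X2s L1s L2s Zs x1s x2s f1s e1s f2s e2s y2s g2s x3s z3s z2s N M2 M1 O21 I21 W n2 n1 k2 d2 k1
          d1 p2 q2
      q1 p1 l2 l1 j a2 h js a2s hs
    by unfold_locales
  have l: "v \<cdot> h = hs" by (rule A.triple_mor_A[OF t m])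
  have "pb \<mu>2' \<mu>1' x3s hs" using pb_postcomp[OF bcD(11)[OF P.bcA], of v X2s] t(3) by (simp add: m l)
  then have "(\<mu>2', \<mu>1') = (\<mu>2s', \<mu>1s')" by (rule pb_rep_unique[OF _ bcD(11)[OF Q.bcA] P.reps(2)
      Q.reps(2)])
  with n show ?thesis by simp
qed

lemma corr_right_unique: "corresponds a b \<Longrightarrow> corresponds a b' \<Longrightarrow> b = b'"
  by (elim corresponds.cases) (simp only: prod.inject, elim conjE, hypsubst, rule
      corr_unique_right[unfolded prod.inject],
      assumption+)

lemma corr_left_unique: "corresponds a b \<Longrightarrow> corresponds a' b \<Longrightarrow> a = a'"
  by (elim corresponds.cases) (simp only: prod.inject, elim conjE, hypsubst, rule
      corr_unique_left[unfolded prod.inject],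
      assumption+)

end

context correspondence
begin

lemma matches_iff:
  "(\<mu>2, \<mu>1) \<in> sq_matches C R2 R1 \<and> (\<mu>2', \<mu>1') \<in> sq_matches C R3 (R21 (\<mu>2, \<mu>1)) \<longleftrightarrow>
   (\<nu>2, \<nu>1) \<in> sq_matches C R3 R2 \<and> (\<nu>2', \<nu>1') \<in> sq_matches C (R32 (\<nu>2, \<nu>1)) R1"
  unfolding matches by (rule composites_agree; assumption)

lemma composite_iso:
  "\<exists>uO uK uI. linear_rule_iso C (fst RA) (fst RB) uO uK uI \<and> cond_equiv_along C uI (snd RA) (snd RB)"
  by (rule composites_agree; blast)

end

section \<open>The bijection\<close>

context three_conds
begin

lemma corr_matches_iff:
  assumes "corresponds (\<mu>, \<mu>') (\<nu>, \<nu>')"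
  shows "\<mu> \<in> sq_matches C R2 R1 \<and> \<mu>' \<in> sq_matches C R3 (R21 \<mu>) \<longleftrightarrow>
    \<nu> \<in> sq_matches C R3 R2 \<and> \<nu>' \<in> sq_matches C (R32 \<nu>) R1"
  using assms by (cases rule: corresponds.cases) (auto dest!: correspondence.matches_iff)

lemma corr_composite_iso:
  assumes "corresponds (\<mu>, \<mu>') (\<nu>, \<nu>')"
  shows "\<exists>uO uK uI. linear_rule_iso C (fst (sq_compose C R3 \<mu>' (R21 \<mu>))) (fst (sq_compose C (R32 \<nu>) \<nu>'
      R1)) uO uK uI \<and>
    cond_equiv_along C uI (snd (sq_compose C R3 \<mu>' (R21 \<mu>))) (snd (sq_compose C (R32 \<nu>) \<nu>' R1))"
  using assms by (cases rule: corresponds.cases) (simp only: prod.inject, blast dest: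
      correspondence.composite_iso)

lemma associativity:
  defines "M_A \<equiv> {(\<mu>, \<mu>'). \<mu> \<in> sq_matches C R2 R1 \<and> \<mu>' \<in> sq_matches C R3 (R21 \<mu>)}"
    and "M_B \<equiv> {(\<nu>, \<nu>'). \<nu> \<in> sq_matches C R3 R2 \<and> \<nu>' \<in> sq_matches C (R32 \<nu>) R1}"
  shows "\<exists>\<Phi>. bij_betw \<Phi> M_A M_B \<and>
     (\<forall>\<mu> \<mu>' \<nu> \<nu>'. (\<mu>, \<mu>') \<in> M_A \<and> \<Phi> (\<mu>, \<mu>') = (\<nu>, \<nu>') \<longrightarrow>
       (\<exists>uO uK uI. linear_rule_iso C (fst (sq_compose C R3 \<mu>' (R21 \<mu>))) (fst (sq_compose C (R32 \<nu>) \<nu>'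
           R1)) uO uK uI \<and>
         cond_equiv_along C uI (snd (sq_compose C R3 \<mu>' (R21 \<mu>))) (snd (sq_compose C (R32 \<nu>) \<nu>' R1))))"
proof -
  have "\<exists>b\<in>M_B. corresponds a b" if "a \<in> M_A" for a
  proof -
    obtain \<mu>2 \<mu>1 \<mu>2' \<mu>1' where a: "a = ((\<mu>2, \<mu>1), (\<mu>2', \<mu>1'))" by (metis surj_pair)
    have M: "(\<mu>2, \<mu>1) \<in> sq_matches C R2 R1" "(\<mu>2', \<mu>1') \<in> sq_matches C R3 (R21 (\<mu>2, \<mu>1))"
      using that by (simp_all add: M_A_def a)
    obtain \<nu> \<nu>' where c: "corresponds a (\<nu>, \<nu>')" using corr_ex_right[OF M] unfolding a by (metis surj_pair)
    then have "(\<nu>, \<nu>') \<in> M_B" using corr_matches_iff[OF c[unfolded a]] M by (simp add: M_B_def)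
    then show ?thesis using c by blast
  qed
  moreover have "\<exists>a\<in>M_A. corresponds a b" if "b \<in> M_B" for b
  proof -
    obtain \<nu>2 \<nu>1 \<nu>2' \<nu>1' where b: "b = ((\<nu>2, \<nu>1), (\<nu>2', \<nu>1'))" by (metis surj_pair)
    have M: "(\<nu>2, \<nu>1) \<in> sq_matches C R3 R2" "(\<nu>2', \<nu>1') \<in> sq_matches C (R32 (\<nu>2, \<nu>1)) R1"
      using that by (simp_all add: M_B_def b)
    obtain \<mu> \<mu>' where c: "corresponds (\<mu>, \<mu>') b" using corr_ex_left[OF M] unfolding b by (metis surj_pair)
    then have "(\<mu>, \<mu>') \<in> M_A" using corr_matches_iff[OF c[unfolded b]] M by (simp add: M_A_def)
    then show ?thesis using c by blast
  qed
  ultimately obtain \<Phi> where \<Phi>: "bij_betw \<Phi> M_A M_B" "\<And>a. a \<in> M_A \<Longrightarrow> corresponds a (\<Phi> a)"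
    by (rule bij_betw_of_relation[of M_A M_B corresponds]) (blast intro: corr_right_unique corr_left_unique)+
  then show ?thesis using corr_composite_iso by metis
qed

end

theorem theorem5p7:
  fixes C :: "('o, 'm) mcat"
    and R1 R2 R3 :: "('i, 'm) cond_rule"
  defines "M_A \<equiv> {(\<mu>21, \<mu>3_21). \<mu>21 \<in> sq_matches C R2 R1 \<and>
                                \<mu>3_21 \<in> sq_matches C R3 (sq_compose C R2 \<mu>21 R1)}"
    and "M_B \<equiv> {(\<mu>32, \<mu>32_1). \<mu>32 \<in> sq_matches C R3 R2 \<and>
                                \<mu>32_1 \<in> sq_matches C (sq_compose C R3 \<mu>32 R2) R1}"
  assumes "sqpo_category C"
    and "MM C = {f. monic C f}"
    and "linear_rule C R1" and "linear_rule C R2" and "linear_rule C R3"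
  shows "\<exists>\<Phi>. bij_betw \<Phi> M_A M_B \<and>
     (\<forall>\<mu>21 \<mu>3_21 \<mu>32 \<mu>32_1.
        (\<mu>21, \<mu>3_21) \<in> M_A \<and> \<Phi> (\<mu>21, \<mu>3_21) = (\<mu>32, \<mu>32_1) \<longrightarrow>
        (\<exists>uO uK uI.
           linear_rule_iso C
             (fst (sq_compose C R3 \<mu>3_21 (sq_compose C R2 \<mu>21 R1)))
             (fst (sq_compose C (sq_compose C R3 \<mu>32 R2) \<mu>32_1 R1)) uO uK uI \<and>
           cond_equiv_along C uI
             (snd (sq_compose C R3 \<mu>3_21 (sq_compose C R2 \<mu>21 R1)))
             (snd (sq_compose C (sq_compose C R3 \<mu>32 R2) \<mu>32_1 R1))))"
proof -
  obtain o1 i1 c1 where R1: "R1 = ((o1, i1), c1)" by (metis surj_pair)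
  obtain o2 i2 c2 where R2: "R2 = ((o2, i2), c2)" by (metis surj_pair)
  obtain o3 i3 c3 where R3: "R3 = ((o3, i3), c3)" by (metis surj_pair)
  have "three_conds C (Cod C o1) (Dom C i1) (Cod C i1) (Cod C o2) (Dom C i2) (Cod C i2) (Cod C o3) (Dom C
      i3) (Cod C i3)
    o1 i1 o2 i2 o3 i3 c1 c2 c3"
    using assms(5-7)
    by (intro three_conds.intro three_conds_axioms.intro three_rules.intro three_rules_axioms.intro assms(3))
      (simp_all add: R1 R2 R3 linear_rule_def M_span_def)
  from three_conds.associativity[OF this] show ?thesis unfolding M_A_def M_B_def R1 R2 R3 .
qed

end
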